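(* Let $n\in\mathbb{N}$, $\mu,\nu\in\mathbb{R}$, $\beta,\gamma,\delta\in\mathbb{R}\setminus\{0\}$, $H:=H^2(\mathbb{R}^n)$, and for $\varepsilon>0$ put $\Omega^\varepsilon:=\sqrt{(\delta-\nu-\varepsilon^{-1}\alpha+\mu)^2+4\varepsilon^{-1}\beta\gamma}$. Let $\alpha<0$ and let $\varepsilon$ be small enough such that $\varepsilon^{-1}\alpha-\mu<0$ and $\Omega^\varepsilon\in\mathbb{R}\setminus\{0\}$. Define $$C^-_\varepsilon:=\{(u,v)\in H\times H:(\varepsilon(\delta-\nu+\mu)-\alpha-\varepsilon\Omega^\varepsilon)u-2\beta v=0\},\qquad C_0:=\{(u,v)\in H\times H:\alpha u+\beta v=0\}.$$ Then the following is true. (i) $C^-_\varepsilon$ is the attracting slow manifold of the linear fast-reaction system $$\varepsilon\partial_t u=\varepsilon(\Delta-\mu I)u+\alpha u+\beta v,\qquad \partial_t v=(\Delta-\nu I)v+\gamma u+\delta v,$$ which is invariant under the semiflow $T_\varepsilon$ of this system. Moreover, the slow manifold has the same regularity as the critical manifold $C_0$. (ii) The slow manifold $C^-_\varepsilon$ converges to the critical manifold $C_0$ as $\varepsilon\to0$. In addition, on bounded subsets the distance between these two objects is given by $d_H(C^-_\varepsilon,C_0)=\mathcal{O}(\varepsilon)$, with $d_H$ the Hausdorff distance. (iii) The semiflow $T_\varepsilon$ restricted to $C^-_\varepsilon$ converges to the semiflow $T_0$ on $C_0$ as $\varepsilon\to0$.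
   Context: $T_\varepsilon(t)$ is the solution semiflow on $H\times H$ of the displayed system with initial data $(u(0),v(0))=(u_0,v_0)\in H\times H$. $T_0(t)$ is the semiflow on $C_0$ of the limit system $0=\alpha u^0+\beta v^0$, $\partial_t v^0=(\Delta-\nu I)v^0+\gamma u^0+\delta v^0$, $v^0(0)=v_0\in H$, $u^0(0)=-\alpha^{-1}\beta v_0$. Slow manifolds are a family of locally invariant manifolds that converge to the critical manifold as $\varepsilon\to0$ with respect to the Hausdorff distance, while also preserving the regularity, and such that the flow on them converges to the flow of the limit system as $\varepsilon\to0$. The Hausdorff distance is $d_H(U,V)=\inf\{\lambda\ge0:U\subset V+B_\lambda(0),\ V\subset U+B_\lambda(0)\}$, with $B_\lambda(0)$ the ball of radius $\lambda$ about $0$ and $+$ the Minkowski sum of sets.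
   Formalization: For α<0 the root Ω^ε is taken negative (so +ε√(...) in C^-_ε), since with the usual root C^-_ε tends to {v=0}, not C_0; attraction is claimed for all sufficiently small ε, as it can fail for some ε allowed by the stated conditions. *)

theory Defs
  imports "HOL-Analysis.Analysis" "HOL-Computational_Algebra.Polynomial" "HOL-Library.Set_Algebras"
begin

definition partial_deriv :: "'n::finite \<Rightarrow> (real^'n \<Rightarrow> real) \<Rightarrow> real^'n \<Rightarrow> real" where
  "partial_deriv i f = (\<lambda>x. frechet_derivative f (at x) (axis i 1))"

fun iter_partial :: "'n::finite list \<Rightarrow> (real^'n \<Rightarrow> real) \<Rightarrow> real^'n \<Rightarrow> real" where
  "iter_partial [] f = f"
| "iter_partial (i # is) f = partial_deriv i (iter_partial is f)"

definition smooth_fun :: "(real^'n::finite \<Rightarrow> real) \<Rightarrow> bool" where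
  "smooth_fun f \<longleftrightarrow> (\<forall>is x. iter_partial is f differentiable (at x))"

definition test_fun :: "(real^'n::finite \<Rightarrow> real) \<Rightarrow> bool" where
  "test_fun \<phi> \<longleftrightarrow> smooth_fun \<phi> \<and> compact (closure {x. \<phi> x \<noteq> 0})"

definition sq_integrable :: "(real^'n::finite \<Rightarrow> real) \<Rightarrow> bool" where
  "sq_integrable f \<longleftrightarrow> f \<in> borel_measurable lborel \<and> integrable lborel (\<lambda>x. (f x)\<^sup>2)"

lemma sq_integrable_0: "sq_integrable (\<lambda>x. 0)"
  by (simp add: sq_integrable_def)

lemma sq_integrable_mult:
  assumes "sq_integrable f" "sq_integrable g"
  shows "integrable lborel (\<lambda>x. f x * g x)"
proof (rule Bochner_Integration.integrable_bound)
  show "integrable lborel (\<lambda>x. (f x)\<^sup>2 + (g x)\<^sup>2)"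
    using assms by (auto simp: sq_integrable_def)
  show "(\<lambda>x. f x * g x) \<in> borel_measurable lborel"
    using assms by (auto simp: sq_integrable_def)
  have "\<bar>f x * g x\<bar> \<le> (f x)\<^sup>2 + (g x)\<^sup>2" for x
  proof -
    have "0 \<le> (\<bar>f x\<bar> - \<bar>g x\<bar>)\<^sup>2" by simp
    hence "2 * (\<bar>f x\<bar> * \<bar>g x\<bar>) \<le> (f x)\<^sup>2 + (g x)\<^sup>2"
      by (simp add: power2_diff)
    moreover have "0 \<le> \<bar>f x\<bar> * \<bar>g x\<bar>" by simp
    ultimately show ?thesis unfolding abs_mult by linarith
  qed
  thus "AE x in lborel. norm (f x * g x) \<le> norm ((f x)\<^sup>2 + (g x)\<^sup>2)" by simp
qed

lemma sq_integrable_add: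
  assumes "sq_integrable f" "sq_integrable g"
  shows "sq_integrable (\<lambda>x. f x + g x)"
proof -
  have "integrable lborel (\<lambda>x. (f x)\<^sup>2 + (g x)\<^sup>2 + 2 * (f x * g x))"
    using assms sq_integrable_mult[OF assms] by (auto simp: sq_integrable_def)
  thus ?thesis using assms by (auto simp: sq_integrable_def power2_sum algebra_simps)
qed

lemma sq_integrable_scale: "sq_integrable f \<Longrightarrow> sq_integrable (\<lambda>x. c * f x)"
  by (auto simp: sq_integrable_def power_mult_distrib)

definition L2_rel :: "(real^'n::finite \<Rightarrow> real) \<Rightarrow> (real^'n \<Rightarrow> real) \<Rightarrow> bool" where
  "L2_rel f g \<longleftrightarrow> sq_integrable f \<and> sq_integrable g \<and> (AE x in lborel. f x = g x)"

quotient_type (overloaded) 'n L2 = "real^('n::finite) \<Rightarrow> real" / partial: L2_rel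
  morphisms rep_L2 abs_L2
proof (rule part_equivpI)
  show "\<exists>x. L2_rel x x" using sq_integrable_0 by (auto simp: L2_rel_def)
  show "symp L2_rel" by (auto simp: symp_def L2_rel_def)
  show "transp L2_rel" by (auto simp: transp_def L2_rel_def)
qed

instantiation L2 :: (finite) real_inner
begin

lift_definition zero_L2 :: "'a L2" is "\<lambda>x. 0"
  by (simp add: L2_rel_def sq_integrable_0)

lift_definition plus_L2 :: "'a L2 \<Rightarrow> 'a L2 \<Rightarrow> 'a L2" is "\<lambda>f g x. f x + g x"
  by (auto simp: L2_rel_def intro: sq_integrable_add)

lift_definition scaleR_L2 :: "real \<Rightarrow> 'a L2 \<Rightarrow> 'a L2" is "\<lambda>c f x. c * f x"
  by (auto simp: L2_rel_def intro: sq_integrable_scale)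

lift_definition uminus_L2 :: "'a L2 \<Rightarrow> 'a L2" is "\<lambda>f x. - f x"
  using sq_integrable_scale[of _ "-1"] by (auto simp: L2_rel_def)

lift_definition minus_L2 :: "'a L2 \<Rightarrow> 'a L2 \<Rightarrow> 'a L2" is "\<lambda>f g x. f x - g x"
  using sq_integrable_add[of _ "\<lambda>x. -1 * _ x"] sq_integrable_scale[of _ "-1"]
  by (auto simp: L2_rel_def)

lift_definition inner_L2 :: "'a L2 \<Rightarrow> 'a L2 \<Rightarrow> real" is "\<lambda>f g. \<integral>x. f x * g x \<partial>lborel"
  by (rule integral_cong_AE) (auto simp: L2_rel_def sq_integrable_def)

definition norm_L2 :: "'a L2 \<Rightarrow> real" where "norm_L2 f = sqrt (f \<bullet> f)"
definition sgn_L2 :: "'a L2 \<Rightarrow> 'a L2" where "sgn_L2 f = inverse (norm f) *\<^sub>R f"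
definition dist_L2 :: "'a L2 \<Rightarrow> 'a L2 \<Rightarrow> real" where "dist_L2 f g = norm (f - g)"
definition uniformity_L2 :: "('a L2 \<times> 'a L2) filter" where
  "uniformity_L2 = (INF e\<in>{0<..}. principal {(x, y). dist x y < e})"
definition open_L2 :: "'a L2 set \<Rightarrow> bool" where
  "open_L2 U \<longleftrightarrow> (\<forall>x\<in>U. \<forall>\<^sub>F (x', y) in uniformity. x' = x \<longrightarrow> y \<in> U)"

instance
proof
  fix a b c :: "'a L2" and r s :: real
  show "a + b + c = a + (b + c)"
    by transfer (auto simp: L2_rel_def add_ac intro!: sq_integrable_add)
  show "a + b = b + a"
    by transfer (auto simp: L2_rel_def add_ac intro!: sq_integrable_add)
  show "0 + a = a"
    by transfer (auto simp: L2_rel_def)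
  show "- a + a = 0"
    by transfer (auto simp: L2_rel_def sq_integrable_0)
  show "a - b = a + - b"
  proof transfer
    fix f g :: "real^'a \<Rightarrow> real"
    assume "L2_rel f f" "L2_rel g g"
    hence "sq_integrable (\<lambda>x. f x + -1 * g x)"
      by (intro sq_integrable_add sq_integrable_scale) (auto simp: L2_rel_def)
    thus "L2_rel (\<lambda>x. f x - g x) (\<lambda>x. f x + - g x)"
      by (simp add: L2_rel_def)
  qed
  show "r *\<^sub>R (a + b) = r *\<^sub>R a + r *\<^sub>R b"
    by transfer (auto simp: L2_rel_def algebra_simps intro!: sq_integrable_add sq_integrable_scale)
  show "(r + s) *\<^sub>R a = r *\<^sub>R a + s *\<^sub>R a"
    by transfer (auto simp: L2_rel_def algebra_simps intro!: sq_integrable_add sq_integrable_scale)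
  show "r *\<^sub>R s *\<^sub>R a = (r * s) *\<^sub>R a"
    by transfer (auto simp: L2_rel_def algebra_simps intro!: sq_integrable_scale)
  show "1 *\<^sub>R a = a"
    by transfer (auto simp: L2_rel_def)
  show "a \<bullet> b = b \<bullet> a"
    by transfer (simp add: mult.commute)
  show "(a + b) \<bullet> c = a \<bullet> c + b \<bullet> c"
    by transfer (simp add: L2_rel_def distrib_right sq_integrable_mult)
  show "(r *\<^sub>R a) \<bullet> b = r * (a \<bullet> b)"
    by transfer (simp add: L2_rel_def mult.assoc)
  show "0 \<le> a \<bullet> a"
    by transfer (simp add: integral_nonneg_AE)
  show "(a \<bullet> a = 0) = (a = 0)"
  proof transfer
    fix f :: "real^'a \<Rightarrow> real"
    assume "L2_rel f f"
    hence f: "sq_integrable f" by (simp add: L2_rel_def)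
    hence "(\<integral>x. (f x)\<^sup>2 \<partial>lborel) = 0 \<longleftrightarrow> (AE x in lborel. (f x)\<^sup>2 = 0)"
      by (intro integral_nonneg_eq_0_iff_AE) (auto simp: sq_integrable_def)
    thus "(\<integral>x. f x * f x \<partial>lborel) = 0 \<longleftrightarrow> L2_rel f (\<lambda>x. 0)"
      using f by (simp add: L2_rel_def sq_integrable_0 power2_eq_square)
  qed
qed (simp_all add: norm_L2_def sgn_L2_def dist_L2_def uniformity_L2_def open_L2_def)

end

text \<open>A list of directions plays the role of a multi-index; since test functions are smooth
  the order of the entries is irrelevant.\<close>

lemma smooth_fun_iter_partial_measurable [measurable]:
  assumes "smooth_fun \<phi>"
  shows "iter_partial is \<phi> \<in> borel_measurable borel"
proof -
  have "iter_partial is \<phi> differentiable_on UNIV"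
    using assms by (auto simp: smooth_fun_def differentiable_on_def)
  thus ?thesis
    using borel_measurable_continuous_onI differentiable_imp_continuous_on by blast
qed

lemma smooth_fun_measurable: "smooth_fun \<phi> \<Longrightarrow> \<phi> \<in> borel_measurable borel"
  using smooth_fun_iter_partial_measurable[of \<phi> "[]"] by simp

lift_definition weak_deriv :: "'n::finite list \<Rightarrow> 'n L2 \<Rightarrow> 'n L2 \<Rightarrow> bool" is
  "\<lambda>is f g. \<forall>\<phi>. test_fun \<phi> \<longrightarrow>
     (\<integral>x. f x * iter_partial is \<phi> x \<partial>lborel) = (- 1) ^ length is * (\<integral>x. g x * \<phi> x \<partial>lborel)"
proof -
  fix js :: "'n list" and f f' g g' :: "real^'n \<Rightarrow> real"
  assume f: "L2_rel f f'" and g: "L2_rel g g'"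
  have "(\<integral>x. h x * \<psi> x \<partial>lborel) = (\<integral>x. h' x * \<psi> x \<partial>lborel)"
    if "L2_rel h h'" "\<psi> \<in> borel_measurable borel" for h h' and \<psi> :: "real^'n \<Rightarrow> real"
    using that by (intro integral_cong_AE) (auto simp: L2_rel_def sq_integrable_def)
  note this[OF f smooth_fun_iter_partial_measurable] this[OF g smooth_fun_measurable]
  thus "(\<forall>\<phi>. test_fun \<phi> \<longrightarrow> (\<integral>x. f x * iter_partial js \<phi> x \<partial>lborel)
           = (- 1) ^ length js * (\<integral>x. g x * \<phi> x \<partial>lborel))
      \<longleftrightarrow> (\<forall>\<phi>. test_fun \<phi> \<longrightarrow> (\<integral>x. f' x * iter_partial js \<phi> x \<partial>lborel)
           = (- 1) ^ length js * (\<integral>x. g' x * \<phi> x \<partial>lborel))"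
    by (simp add: test_fun_def)
qed

text \<open>Bump functions, built from the functions \<open>p(1/x) e\<^sup>-\<^sup>1\<^sup>/\<^sup>x\<close> extended by \<open>0\<close>, which are closed under
  differentiation. They give uniqueness of weak derivatives.\<close>

definition flat :: "real poly \<Rightarrow> real \<Rightarrow> real" where
  "flat p x = (if 0 < x then poly p (1 / x) * exp (- (1 / x)) else 0)"

lemma poly_div_exp_tendsto_0: "((\<lambda>x. poly p x / exp x) \<longlongrightarrow> 0) (at_top :: real filter)"
proof -
  have "((\<lambda>x. \<Sum>i\<le>degree p. coeff p i * (x ^ i / exp x)) \<longlongrightarrow> (\<Sum>i\<le>degree p. coeff p i * 0)) (at_top :: real filter)"
    by (intro tendsto_intros tendsto_power_div_exp_0)
  thus ?thesis by (simp add: poly_altdef sum_divide_distrib)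
qed

lemma flat_has_deriv:
  "(flat p has_real_derivative flat (monom 1 2 * (p - pderiv p)) x) (at x)"
proof -
  consider "x > 0" | "x < 0" | "x = 0" by linarith
  thus ?thesis
  proof cases
    case 1
    have "((\<lambda>y. poly p (1 / y) * exp (- (1 / y))) has_real_derivative
            flat (monom 1 2 * (p - pderiv p)) x) (at x)"
      using 1 by (auto intro!: derivative_eq_intros DERIV_chain'[OF _ poly_DERIV]
          simp: flat_def poly_monom field_simps power2_eq_square)
    moreover have "\<forall>\<^sub>F y in nhds x. poly p (1 / y) * exp (- (1 / y)) = flat p y"
      using eventually_nhds_in_open[of "{0<..}" x] 1 by (auto elim!: eventually_mono simp: flat_def)
    ultimately show ?thesis
      using DERIV_cong_ev[of x x "\<lambda>y. poly p (1 / y) * exp (- (1 / y))" "flat p"] by blast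
  next
    case 2
    have "((\<lambda>y. 0) has_real_derivative flat (monom 1 2 * (p - pderiv p)) x) (at x)"
      using 2 by (simp add: flat_def)
    moreover have "\<forall>\<^sub>F y in nhds x. 0 = flat p y"
      using eventually_nhds_in_open[of "{..<0}" x] 2 by (auto elim!: eventually_mono simp: flat_def)
    ultimately show ?thesis
      using DERIV_cong_ev[of x x "\<lambda>y. 0" "flat p"] by blast
  next
    case 3
    have "((\<lambda>h. flat p h / h) \<longlongrightarrow> 0) (at 0)"
    proof (rule filterlim_split_at)
      have "\<forall>\<^sub>F h in at_left 0. 0 = flat p h / (h::real)"
        by (auto simp: flat_def eventually_at intro: exI[of _ 1])
      thus "((\<lambda>h. flat p h / h) \<longlongrightarrow> 0) (at_left 0)"
        by (rule Lim_transform_eventually[OF tendsto_const])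
      have "((\<lambda>h. poly (monom 1 1 * p) (inverse h) / exp (inverse h)) \<longlongrightarrow> 0) (at_right (0::real))"
        by (rule filterlim_compose[OF poly_div_exp_tendsto_0 filterlim_inverse_at_top_right])
      moreover have "\<forall>\<^sub>F h in at_right 0. poly (monom 1 1 * p) (inverse h) / exp (inverse h) = flat p h / (h::real)"
        by (auto simp: flat_def poly_monom eventually_at exp_minus field_simps intro!: exI[of _ 1])
      ultimately show "((\<lambda>h. flat p h / h) \<longlongrightarrow> 0) (at_right 0)"
        by (rule Lim_transform_eventually)
    qed
    thus ?thesis using 3 by (simp add: DERIV_def flat_def)
  qed
qed

inductive_set flat_algebra :: "(real^'n::finite \<Rightarrow> real) set" where
  gen: "(\<lambda>x. flat p (c * x $ i + d)) \<in> flat_algebra"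
| const: "(\<lambda>x. c) \<in> flat_algebra"
| add: "f \<in> flat_algebra \<Longrightarrow> g \<in> flat_algebra \<Longrightarrow> (\<lambda>x. f x + g x) \<in> flat_algebra"
| mult: "f \<in> flat_algebra \<Longrightarrow> g \<in> flat_algebra \<Longrightarrow> (\<lambda>x. f x * g x) \<in> flat_algebra"

lemma partial_deriv_eqI: "(\<And>x. (f has_derivative f' x) (at x)) \<Longrightarrow> partial_deriv i f = (\<lambda>x. f' x (axis i 1))"
  unfolding partial_deriv_def by (rule ext) (metis frechet_derivative_at)

lemma flat_algebra_deriv:
  assumes "f \<in> flat_algebra"
  shows "(\<forall>x. f differentiable (at x)) \<and> partial_deriv i f \<in> flat_algebra"
  using assms
proof induction
  case (gen p c j d)
  let ?q = "monom 1 2 * (p - pderiv p)"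
  have D: "((\<lambda>x. flat p (c * x $ j + d)) has_derivative
           (\<lambda>h. flat ?q (c * x $ j + d) * (c * h $ j))) (at x)" for x
  proof -
    have "((\<lambda>x. c * x $ j + d) has_derivative (\<lambda>h. c * h $ j)) (at x)"
      by (auto intro!: derivative_eq_intros bounded_linear_imp_has_derivative bounded_linear_vec_nth)
    from has_derivative_compose[OF this flat_has_deriv[of p, unfolded has_field_derivative_def]]
    show ?thesis by (simp add: mult_ac)
  qed
  have "partial_deriv i (\<lambda>x. flat p (c * x $ j + d)) =
      (\<lambda>x. flat ?q (c * x $ j + d) * (c * axis i 1 $ j))"
    by (rule partial_deriv_eqI) (rule D)
  also have "\<dots> \<in> flat_algebra" by (intro flat_algebra.intros)
  finally show ?case using D by (auto simp: differentiable_def)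
next
  case (const c)
  have "partial_deriv i (\<lambda>x. c) = (\<lambda>x. 0)"
    by (rule partial_deriv_eqI) (rule has_derivative_const)
  thus ?case by (auto intro: flat_algebra.const)
next
  case (add f g)
  have D: "((\<lambda>x. f x + g x) has_derivative
           (\<lambda>h. frechet_derivative f (at x) h + frechet_derivative g (at x) h)) (at x)" for x
    using add by (intro has_derivative_add) (auto simp: frechet_derivative_works[symmetric])
  have "partial_deriv i (\<lambda>x. f x + g x) = (\<lambda>x. partial_deriv i f x + partial_deriv i g x)"
    unfolding partial_deriv_def[of i f] partial_deriv_def[of i g] by (rule partial_deriv_eqI) (rule D)
  thus ?case using add by (auto intro: flat_algebra.add)
next
  case (mult f g)
  have D: "((\<lambda>x. f x * g x) has_derivative
           (\<lambda>h. f x * frechet_derivative g (at x) h + frechet_derivative f (at x) h * g x)) (at x)" for x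
    using mult by (intro has_derivative_mult) (auto simp: frechet_derivative_works[symmetric])
  have "partial_deriv i (\<lambda>x. f x * g x) = (\<lambda>x. f x * partial_deriv i g x + partial_deriv i f x * g x)"
    unfolding partial_deriv_def[of i f] partial_deriv_def[of i g] by (rule partial_deriv_eqI) (rule D)
  thus ?case using mult by (auto intro!: flat_algebra.add flat_algebra.mult)
qed

lemma flat_algebra_smooth:
  assumes "f \<in> flat_algebra"
  shows "smooth_fun f"
proof -
  have "iter_partial is f \<in> flat_algebra" for "is"
    using assms flat_algebra_deriv by (induction "is") auto
  thus ?thesis using flat_algebra_deriv by (auto simp: smooth_fun_def)
qed

lemma flat_algebra_prod:
  "finite I \<Longrightarrow> (\<And>i. i \<in> I \<Longrightarrow> f i \<in> flat_algebra) \<Longrightarrow> (\<lambda>x. \<Prod>i\<in>I. f i x) \<in> flat_algebra"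
  by (induction I rule: finite_induct) (auto intro: flat_algebra.intros)

definition box_bump :: "real^'n::finite \<Rightarrow> real^'n \<Rightarrow> nat \<Rightarrow> real^'n \<Rightarrow> real" where
  "box_bump a b m x =
     (\<Prod>i\<in>UNIV. flat 1 (real (Suc m) * x $ i + - (real (Suc m) * a $ i)) *
                flat 1 (- real (Suc m) * x $ i + real (Suc m) * b $ i))"

lemma flat_1_le: "0 \<le> flat 1 x" "flat 1 x \<le> 1"
  by (auto simp: flat_def)

lemma flat_1_eq_0_iff: "flat 1 x = 0 \<longleftrightarrow> x \<le> 0"
  by (auto simp: flat_def)

lemma flat_1_tendsto:
  assumes "t > 0"
  shows "(\<lambda>m. flat 1 (real (Suc m) * t)) \<longlonglongrightarrow> 1"
proof -
  have "(\<lambda>m. exp (- (inverse (real (Suc m)) * (1 / t)))) \<longlonglongrightarrow> exp (- (0 * (1 / t)))"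
    by (intro tendsto_intros LIMSEQ_inverse_real_of_nat)
  moreover have "flat 1 (real (Suc m) * t) = exp (- (inverse (real (Suc m)) * (1 / t)))" for m
    using assms by (simp add: flat_def divide_simps)
  ultimately show ?thesis by simp
qed

lemma box_bump_range: "0 \<le> box_bump a b m x" "box_bump a b m x \<le> 1"
  unfolding box_bump_def by (auto intro!: prod_nonneg prod_le_1 mult_nonneg_nonneg mult_le_one flat_1_le)

lemma Suc_mult_le_0: "real (Suc m) * (s - t) \<le> 0 \<longleftrightarrow> s \<le> t"
  using mult_le_cancel_left_pos[of "real (Suc m)" "s - t" 0] by simp

lemma box_bump_nz_iff: "box_bump a b m x \<noteq> 0 \<longleftrightarrow> x \<in> box a b"
proof -
  have "flat 1 (real (Suc m) * x $ i + - (real (Suc m) * a $ i)) = 0 \<longleftrightarrow> x $ i \<le> a $ i" for i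
  proof -
    have "real (Suc m) * x $ i + - (real (Suc m) * a $ i) = real (Suc m) * (x $ i - a $ i)" by (simp add: algebra_simps)
    thus ?thesis unfolding flat_1_eq_0_iff by (simp only: Suc_mult_le_0)
  qed
  moreover have "flat 1 (- real (Suc m) * x $ i + real (Suc m) * b $ i) = 0 \<longleftrightarrow> b $ i \<le> x $ i" for i
  proof -
    have "- real (Suc m) * x $ i + real (Suc m) * b $ i = real (Suc m) * (b $ i - x $ i)" by (simp add: algebra_simps)
    thus ?thesis unfolding flat_1_eq_0_iff by (simp only: Suc_mult_le_0)
  qed
  ultimately show ?thesis
    unfolding box_bump_def by (simp add: prod_zero_iff mem_box_cart not_le)
qed

lemma box_bump_test_fun: "test_fun (box_bump a b m)"
proof -
  have "box_bump a b m \<in> flat_algebra"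
    unfolding box_bump_def by (intro flat_algebra_prod flat_algebra.mult flat_algebra.gen) auto
  moreover have "{x. box_bump a b m x \<noteq> 0} \<subseteq> cbox a b"
    using box_bump_nz_iff[of a b m] box_subset_cbox by blast
  hence "bounded {x. box_bump a b m x \<noteq> 0}" using bounded_cbox bounded_subset by blast
  ultimately show ?thesis by (simp add: test_fun_def flat_algebra_smooth)
qed

lemma box_bump_tendsto: "(\<lambda>m. box_bump a b m x) \<longlonglongrightarrow> indicator (box a b) x"
proof (cases "x \<in> box a b")
  case False
  thus ?thesis using box_bump_nz_iff[of a b _ x] by (auto simp: indicator_def)
next
  case True
  have "(\<lambda>m. \<Prod>i\<in>UNIV. flat 1 (real (Suc m) * (x $ i - a $ i)) * flat 1 (real (Suc m) * (b $ i - x $ i)))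
        \<longlonglongrightarrow> (\<Prod>i\<in>(UNIV :: 'a set). 1 * 1)"
    using True by (intro tendsto_prod tendsto_mult flat_1_tendsto) (auto simp: mem_box_cart)
  moreover have "box_bump a b m x =
      (\<Prod>i\<in>UNIV. flat 1 (real (Suc m) * (x $ i - a $ i)) * flat 1 (real (Suc m) * (b $ i - x $ i)))" for m
    unfolding box_bump_def by (simp add: algebra_simps)
  ultimately show ?thesis using True by simp
qed

lemma sq_integrable_indicator:
  assumes "sq_integrable g"
  shows "integrable lborel (\<lambda>x. g x * indicator (box a b) x)"
proof -
  have "sq_integrable (\<lambda>x::real^'a. indicator (box a b) x :: real)"
  proof -
    have "(\<lambda>x::real^'a. (indicator (box a b) x :: real)\<^sup>2) = indicator (box a b)"
      by (auto simp: indicator_def)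
    thus ?thesis using emeasure_lborel_box_finite[of a b]
      by (simp add: sq_integrable_def integrable_indicator_iff)
  qed
  from sq_integrable_mult[OF assms this] show ?thesis .
qed

lemma sq_integrable_box_0:
  assumes g: "sq_integrable g"
    and 0: "\<And>\<phi>. test_fun \<phi> \<Longrightarrow> (\<integral>x. g x * \<phi> x \<partial>lborel) = 0"
  shows "(\<integral>x. g x * indicator (box a b) x \<partial>lborel) = 0"
proof -
  have "(\<lambda>m. \<integral>x. g x * box_bump a b m x \<partial>lborel) \<longlonglongrightarrow> (\<integral>x. g x * indicator (box a b) x \<partial>lborel)"
  proof (rule integral_dominated_convergence)
    show "integrable lborel (\<lambda>x. \<bar>g x * indicator (box a b) x\<bar>)"
      using sq_integrable_indicator[OF g] by (rule integrable_abs)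
    show "(\<lambda>x. g x * indicator (box a b) x) \<in> borel_measurable lborel"
      using g by (auto simp: sq_integrable_def)
    show "(\<lambda>x. g x * box_bump a b m x) \<in> borel_measurable lborel" for m
      using g box_bump_test_fun[of a b m] smooth_fun_measurable[of "box_bump a b m"]
      by (auto simp: sq_integrable_def test_fun_def)
    show "AE x in lborel. (\<lambda>m. g x * box_bump a b m x) \<longlonglongrightarrow> g x * indicator (box a b) x"
      by (intro AE_I2 tendsto_mult tendsto_const box_bump_tendsto)
    show "AE x in lborel. norm (g x * box_bump a b m x) \<le> \<bar>g x * indicator (box a b) x\<bar>" for m
    proof (rule AE_I2)
      fix x
      have "\<bar>box_bump a b m x\<bar> \<le> indicator (box a b) x"
        using box_bump_nz_iff[of a b m x] box_bump_range[of a b m x] by (auto simp: indicator_def)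
      thus "norm (g x * box_bump a b m x) \<le> \<bar>g x * indicator (box a b) x\<bar>"
        by (auto simp: abs_mult intro!: mult_left_mono)
    qed
  qed
  moreover have "(\<integral>x. g x * box_bump a b m x \<partial>lborel) = 0" for m
    by (rule 0[OF box_bump_test_fun])
  ultimately show ?thesis by (simp add: LIMSEQ_const_iff)
qed

lemma fundamental_lemma_L2:
  assumes g: "sq_integrable (g :: real^'n::finite \<Rightarrow> real)"
    and 0: "\<And>\<phi>. test_fun \<phi> \<Longrightarrow> (\<integral>x. g x * \<phi> x \<partial>lborel) = 0"
  shows "AE x in lborel. g x = 0"
proof -
  let ?P = "density lborel (\<lambda>x. ennreal (max 0 (g x)))"
  let ?N = "density lborel (\<lambda>x. ennreal (max 0 (- g x)))"
  have [measurable]: "g \<in> borel_measurable borel" using g by (simp add: sq_integrable_def)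
  have box: "emeasure ?P (box a b) = emeasure ?N (box a b) \<and> emeasure ?P (box a b) \<noteq> \<infinity>" for a b :: "real^'n"
  proof -
    let ?I = "\<lambda>x. indicator (box a b) x :: real"
    have i: "integrable lborel (\<lambda>x. g x * ?I x)" by (rule sq_integrable_indicator[OF g])
    have ip: "integrable lborel (\<lambda>x. max 0 (g x * ?I x))" by (intro integrable_max i) simp
    have im: "integrable lborel (\<lambda>x. max 0 (- (g x * ?I x)))" by (intro integrable_max integrable_minus i) simp
    have P: "emeasure ?P (box a b) = ennreal (\<integral>x. max 0 (g x * ?I x) \<partial>lborel)"
    proof -
      have "emeasure ?P (box a b) = (\<integral>\<^sup>+x. ennreal (max 0 (g x)) * indicator (box a b) x \<partial>lborel)"
        by (rule emeasure_density) auto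
      also have "\<dots> = (\<integral>\<^sup>+x. ennreal (max 0 (g x * ?I x)) \<partial>lborel)"
        by (intro nn_integral_cong) (auto simp: indicator_def)
      also have "\<dots> = ennreal (\<integral>x. max 0 (g x * ?I x) \<partial>lborel)"
        by (rule nn_integral_eq_integral[OF ip]) auto
      finally show ?thesis .
    qed
    have N: "emeasure ?N (box a b) = ennreal (\<integral>x. max 0 (- (g x * ?I x)) \<partial>lborel)"
    proof -
      have "emeasure ?N (box a b) = (\<integral>\<^sup>+x. ennreal (max 0 (- g x)) * indicator (box a b) x \<partial>lborel)"
        by (rule emeasure_density) auto
      also have "\<dots> = (\<integral>\<^sup>+x. ennreal (max 0 (- (g x * ?I x))) \<partial>lborel)"
        by (intro nn_integral_cong) (auto simp: indicator_def)
      also have "\<dots> = ennreal (\<integral>x. max 0 (- (g x * ?I x)) \<partial>lborel)"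
        by (rule nn_integral_eq_integral[OF im]) auto
      finally show ?thesis .
    qed
    have "(\<integral>x. max 0 (g x * ?I x) \<partial>lborel) - (\<integral>x. max 0 (- (g x * ?I x)) \<partial>lborel)
        = (\<integral>x. max 0 (g x * ?I x) - max 0 (- (g x * ?I x)) \<partial>lborel)"
      by (rule Bochner_Integration.integral_diff[OF ip im, symmetric])
    also have "\<dots> = (\<integral>x. g x * ?I x \<partial>lborel)"
      by (intro Bochner_Integration.integral_cong) (auto simp: max_def)
    also have "\<dots> = 0" by (rule sq_integrable_box_0[OF g 0])
    finally show ?thesis using P N by simp
  qed
  have "?P = ?N"
  proof (rule measure_eqI_generator_eq[where E = "range (\<lambda>(a, b). box a b)" and \<Omega> = UNIV
        and A = "\<lambda>n. box (- real n *\<^sub>R One) (real n *\<^sub>R One)"])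
    show "Int_stable (range (\<lambda>(a, b). box a b :: (real^'n) set))"
      by (auto simp: Int_stable_def box_Int_box)
    show "range (\<lambda>(a, b). box a b :: (real^'n) set) \<subseteq> Pow UNIV" by simp
    show "sets ?P = sigma_sets UNIV (range (\<lambda>(a, b). box a b))"
      by (simp add: borel_eq_box)
    show "sets ?N = sigma_sets UNIV (range (\<lambda>(a, b). box a b))"
      by (simp add: borel_eq_box)
    show "(\<Union>n. box (- real n *\<^sub>R One) (real n *\<^sub>R One)) = (UNIV :: (real^'n) set)"
      using UN_box_eq_UNIV by simp
    show "emeasure ?P (box (- real n *\<^sub>R One) (real n *\<^sub>R One)) \<noteq> \<infinity>" for n
      using box by blast
  qed (use box in auto)
  hence "AE x in lborel. ennreal (max 0 (g x)) = ennreal (max 0 (- g x))"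
    by (intro sigma_finite_measure.density_unique[OF sigma_finite_lborel]) auto
  thus ?thesis
  proof (rule AE_mp, intro AE_I2 impI)
    fix x assume "ennreal (max 0 (g x)) = ennreal (max 0 (- g x))"
    hence "max 0 (g x) = max 0 (- g x)" by (subst (asm) ennreal_inj) auto
    thus "g x = 0" by (auto simp: max_def split: if_splits)
  qed
qed

lemma test_fun_sq_integrable:
  assumes "test_fun \<phi>"
  shows "sq_integrable \<phi>"
proof -
  let ?K = "closure {x. \<phi> x \<noteq> 0}"
  have "\<phi> differentiable_on UNIV"
    using assms unfolding test_fun_def smooth_fun_def differentiable_on_def
    by (metis UNIV_I iter_partial.simps(1))
  hence c: "continuous_on UNIV \<phi>" by (rule differentiable_imp_continuous_on)
  have "integrable lborel (\<lambda>x. indicator ?K x *\<^sub>R (\<phi> x)\<^sup>2)"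
    using assms by (intro borel_integrable_compact continuous_intros continuous_on_subset[OF c])
      (auto simp: test_fun_def)
  moreover have "(\<lambda>x. indicator ?K x *\<^sub>R (\<phi> x)\<^sup>2) = (\<lambda>x. (\<phi> x)\<^sup>2)"
    using closure_subset[of "{x. \<phi> x \<noteq> 0}"] by (auto simp: indicator_def fun_eq_iff)
  ultimately show ?thesis
    using borel_measurable_continuous_onI[OF c] by (simp add: sq_integrable_def)
qed

lemma weak_deriv_unique:
  assumes "weak_deriv is f g" "weak_deriv is f h"
  shows "g = h"
  using assms
proof transfer
  fix js :: "'a list" and f g h :: "real^'a \<Rightarrow> real"
  assume f: "L2_rel f f" and "L2_rel g g" "L2_rel h h"
  hence g: "sq_integrable g" and h: "sq_integrable h" by (auto simp: L2_rel_def)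
  have m: "sq_integrable (\<lambda>x. g x - h x)"
    using sq_integrable_add[OF g sq_integrable_scale[OF h, of "-1"]] by simp
  assume *: "\<forall>\<phi>. test_fun \<phi> \<longrightarrow> (\<integral>x. f x * iter_partial js \<phi> x \<partial>lborel) = (- 1) ^ length js * (\<integral>x. g x * \<phi> x \<partial>lborel)"
    "\<forall>\<phi>. test_fun \<phi> \<longrightarrow> (\<integral>x. f x * iter_partial js \<phi> x \<partial>lborel) = (- 1) ^ length js * (\<integral>x. h x * \<phi> x \<partial>lborel)"
  have "AE x in lborel. g x - h x = 0"
  proof (rule fundamental_lemma_L2[OF m])
    fix \<phi> :: "real^'a \<Rightarrow> real" assume t: "test_fun \<phi>"
    have p: "sq_integrable \<phi>" by (rule test_fun_sq_integrable[OF t])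
    have "(\<integral>x. g x * \<phi> x \<partial>lborel) = (\<integral>x. h x * \<phi> x \<partial>lborel)"
    proof -
      have "(- 1) ^ length js * (\<integral>x. g x * \<phi> x \<partial>lborel) = (- 1) ^ length js * (\<integral>x. h x * \<phi> x \<partial>lborel)"
        using *(1)[rule_format, OF t] *(2)[rule_format, OF t] by (rule trans[OF sym])
      thus ?thesis by simp
    qed
    thus "(\<integral>x. (g x - h x) * \<phi> x \<partial>lborel) = 0"
      by (simp add: left_diff_distrib Bochner_Integration.integral_diff sq_integrable_mult g h p)
  qed
  thus "L2_rel g h" using g h by (simp add: L2_rel_def)
qed

lemma iter_partial_append: "iter_partial (xs @ ys) \<phi> = iter_partial xs (iter_partial ys \<phi>)"
  by (induction xs) auto

lemma iter_partial_supp: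
  assumes "x \<notin> closure {x. \<phi> x \<noteq> 0}"
  shows "iter_partial is \<phi> x = 0"
  using assms
proof (induction "is" arbitrary: x)
  case Nil
  thus ?case using closure_subset[of "{x. \<phi> x \<noteq> 0}"] by auto
next
  case (Cons i js)
  have "((\<lambda>x. 0) has_derivative (\<lambda>h. 0)) (at x)" by simp
  hence "(iter_partial js \<phi> has_derivative (\<lambda>h. 0)) (at x)"
  proof (rule has_derivative_transform_within_open)
    show "open (- closure {x. \<phi> x \<noteq> 0})" by (rule open_Compl[OF closed_closure])
    show "x \<in> - closure {x. \<phi> x \<noteq> 0}" using Cons.prems by simp
    show "\<And>y. y \<in> - closure {x. \<phi> x \<noteq> 0} \<Longrightarrow> 0 = iter_partial js \<phi> y"
      using Cons.IH by simp
  qed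
  from frechet_derivative_at[OF this, symmetric]
  show ?case by (simp add: partial_deriv_def)
qed

lemma test_fun_iter_partial:
  assumes "test_fun \<phi>"
  shows "test_fun (iter_partial is \<phi>)"
proof -
  have "{x. iter_partial is \<phi> x \<noteq> 0} \<subseteq> closure {x. \<phi> x \<noteq> 0}"
    using iter_partial_supp by blast
  hence "closure {x. iter_partial is \<phi> x \<noteq> 0} \<subseteq> closure {x. \<phi> x \<noteq> 0}"
    by (rule closure_minimal) simp
  moreover have "compact (closure {x. \<phi> x \<noteq> 0})"
    using assms by (simp add: test_fun_def)
  ultimately have "compact (closure {x. iter_partial is \<phi> x \<noteq> 0})"
    by (metis closed_Int_compact closed_closure inf.absorb1)
  moreover have "smooth_fun (iter_partial is \<phi>)"
    using assms unfolding test_fun_def smooth_fun_def iter_partial_append[symmetric] by blast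
  ultimately show ?thesis by (simp add: test_fun_def)
qed

lemma weak_deriv_Nil: "weak_deriv [] f f"
  by transfer simp

lemma weak_deriv_add:
  assumes "weak_deriv is f g" "weak_deriv is f' g'"
  shows "weak_deriv is (f + f') (g + g')"
  using assms
  by transfer (simp add: L2_rel_def distrib_right distrib_left sq_integrable_mult test_fun_sq_integrable
      test_fun_iter_partial)

lemma weak_deriv_scaleR:
  assumes "weak_deriv is f g"
  shows "weak_deriv is (c *\<^sub>R f) (c *\<^sub>R g)"
  using assms by transfer (simp add: mult.assoc mult.left_commute)

typedef (overloaded) 'n H2 = "{f :: ('n::finite) L2. \<forall>is. length is \<le> 2 \<longrightarrow> (\<exists>g. weak_deriv is f g)}"
  morphisms L2_of Abs_H2
proof -
  have "weak_deriv is 0 0" for "is" :: "'n list"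
    by transfer simp
  hence "(0 :: 'n L2) \<in> {f. \<forall>is. length is \<le> 2 \<longrightarrow> (\<exists>g. weak_deriv is f g)}"
    unfolding mem_Collect_eq by (intro allI impI exI)
  thus ?thesis by (rule exI)
qed

setup_lifting type_definition_H2

definition wderiv :: "'n::finite list \<Rightarrow> 'n H2 \<Rightarrow> 'n L2" where
  "wderiv is f = (THE g. weak_deriv is (L2_of f) g)"

lemma wderiv_eqI:
  assumes "weak_deriv is (L2_of f) g"
  shows "wderiv is f = g"
  unfolding wderiv_def using assms by (rule the_equality) (rule weak_deriv_unique[OF _ assms])

lemma weak_deriv_wderiv:
  assumes "length is \<le> 2"
  shows "weak_deriv is (L2_of f) (wderiv is f)"
proof -
  have "\<exists>g. weak_deriv is (L2_of f) g"
    using L2_of[of f] assms by simp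
  then obtain g where g: "weak_deriv is (L2_of f) g" ..
  show ?thesis unfolding wderiv_eqI[OF g] by (rule g)
qed

lemma wderiv_Nil: "wderiv [] f = L2_of f"
  by (intro wderiv_eqI weak_deriv_Nil)

text \<open>The sum runs over all lists of directions, so a mixed second derivative counts once for each
  order of differentiation. This norm is equivalent to the usual one.\<close>

instantiation H2 :: (finite) real_inner
begin

lift_definition zero_H2 :: "'a H2" is 0
  using weak_deriv_scaleR[of _ _ _ 0] L2_of by fastforce

lift_definition plus_H2 :: "'a H2 \<Rightarrow> 'a H2 \<Rightarrow> 'a H2" is "(+)"
  using weak_deriv_add by blast

lift_definition scaleR_H2 :: "real \<Rightarrow> 'a H2 \<Rightarrow> 'a H2" is "(*\<^sub>R)"
  using weak_deriv_scaleR by blast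

lift_definition uminus_H2 :: "'a H2 \<Rightarrow> 'a H2" is uminus
  using weak_deriv_scaleR[of _ _ _ "- 1"] by fastforce

lift_definition minus_H2 :: "'a H2 \<Rightarrow> 'a H2 \<Rightarrow> 'a H2" is "(-)"
  using weak_deriv_add[OF _ weak_deriv_scaleR[of _ _ _ "- 1"]] by fastforce

definition inner_H2 :: "'a H2 \<Rightarrow> 'a H2 \<Rightarrow> real" where
  "inner_H2 f g = (\<Sum>is | length is \<le> 2. wderiv is f \<bullet> wderiv is g)"

definition norm_H2 :: "'a H2 \<Rightarrow> real" where "norm_H2 f = sqrt (f \<bullet> f)"
definition sgn_H2 :: "'a H2 \<Rightarrow> 'a H2" where "sgn_H2 f = inverse (norm f) *\<^sub>R f"
definition dist_H2 :: "'a H2 \<Rightarrow> 'a H2 \<Rightarrow> real" where "dist_H2 f g = norm (f - g)"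
definition uniformity_H2 :: "('a H2 \<times> 'a H2) filter" where
  "uniformity_H2 = (INF e\<in>{0<..}. principal {(x, y). dist x y < e})"
definition open_H2 :: "'a H2 set \<Rightarrow> bool" where
  "open_H2 U \<longleftrightarrow> (\<forall>x\<in>U. \<forall>\<^sub>F (x', y) in uniformity. x' = x \<longrightarrow> y \<in> U)"

instance
proof
  fix a b c :: "'a H2" and r s :: real
  show "a + b + c = a + (b + c)" by transfer (rule add.assoc)
  show "a + b = b + a" by transfer (rule add.commute)
  show "0 + a = a" by transfer simp
  show "- a + a = 0" by transfer simp
  show "a - b = a + - b" by transfer simp
  show "r *\<^sub>R (a + b) = r *\<^sub>R a + r *\<^sub>R b" by transfer (rule scaleR_add_right)
  show "(r + s) *\<^sub>R a = r *\<^sub>R a + s *\<^sub>R a" by transfer (rule scaleR_add_left)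
  show "r *\<^sub>R s *\<^sub>R a = (r * s) *\<^sub>R a" by transfer simp
  show "1 *\<^sub>R a = a" by transfer simp
  have add: "wderiv is (a + b) = wderiv is a + wderiv is b" if "length is \<le> 2" for "is"
    using that by (intro wderiv_eqI) (simp add: plus_H2.rep_eq weak_deriv_add weak_deriv_wderiv)
  have scale: "wderiv is (r *\<^sub>R a) = r *\<^sub>R wderiv is a" if "length is \<le> 2" for "is"
    using that by (intro wderiv_eqI) (simp add: scaleR_H2.rep_eq weak_deriv_scaleR weak_deriv_wderiv)
  show "a \<bullet> b = b \<bullet> a"
    by (simp add: inner_H2_def inner_commute)
  show "(a + b) \<bullet> c = a \<bullet> c + b \<bullet> c"
    by (simp add: inner_H2_def add inner_add_left sum.distrib)
  show "(r *\<^sub>R a) \<bullet> b = r * (a \<bullet> b)"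
    by (simp add: inner_H2_def scale sum_distrib_left)
  show "0 \<le> a \<bullet> a"
    by (simp add: inner_H2_def sum_nonneg)
  have fin: "finite {is :: 'a list. length is \<le> 2}"
    using finite_lists_length_le[of "UNIV :: 'a set" 2] by simp
  show "(a \<bullet> a = 0) = (a = 0)"
  proof
    assume "a \<bullet> a = 0"
    hence "\<forall>is\<in>{is. length is \<le> 2}. wderiv is a \<bullet> wderiv is a = 0"
      unfolding inner_H2_def by (subst (asm) sum_nonneg_eq_0_iff) (use fin in auto)
    hence "wderiv [] a = 0" by force
    thus "a = 0" by (simp add: wderiv_Nil zero_H2.rep_eq flip: L2_of_inject)
  next
    assume "a = 0"
    have "wderiv is (0 :: 'a H2) = 0" if "length is \<le> 2" for "is"
    proof (rule wderiv_eqI)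
      have "weak_deriv is (0 *\<^sub>R L2_of a) (0 *\<^sub>R wderiv is a)"
        using that by (intro weak_deriv_scaleR weak_deriv_wderiv)
      thus "weak_deriv is (L2_of 0) 0" by (simp add: zero_H2.rep_eq)
    qed
    thus "a \<bullet> a = 0" by (simp add: inner_H2_def \<open>a = 0\<close>)
  qed
qed (simp_all add: norm_H2_def sgn_H2_def dist_H2_def uniformity_H2_def open_H2_def)

end

definition laplacian :: "'n::finite H2 \<Rightarrow> 'n L2" where
  "laplacian f = (\<Sum>i\<in>UNIV. wderiv [i, i] f)"

text \<open>Extended-real valued, so that the distance is infinite when no radius is admissible.\<close>

definition hausdorff_dist :: "'a::real_normed_vector set \<Rightarrow> 'a set \<Rightarrow> ereal" where
  "hausdorff_dist U V = Inf {ereal r | r. 0 \<le> r \<and> U \<subseteq> V + ball 0 r \<and> V \<subseteq> U + ball 0 r}"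

text \<open>\<open>D [h\<^sub>1, \<dots>, h\<^sub>j] x\<close> is the value of the \<open>j\<close>-th Frechet derivative at \<open>x\<close> on the
  directions \<open>h\<^sub>1, \<dots>, h\<^sub>j\<close>.\<close>

definition Ck_on :: "nat \<Rightarrow> 'a::real_normed_vector set \<Rightarrow> ('a \<Rightarrow> 'b::real_normed_vector) \<Rightarrow> bool" where
  "Ck_on k U f \<longleftrightarrow> (\<exists>D :: 'a list \<Rightarrow> 'a \<Rightarrow> 'b. \<forall>x\<in>U.
     D [] x = f x \<and>
     (\<forall>hs. length hs < k \<longrightarrow> bounded_linear (\<lambda>h. D (h # hs) x)) \<and>
     (\<forall>j<k. \<forall>e>0. \<forall>\<^sub>F y in at x within U. \<forall>hs. length hs = j \<and> set hs \<subseteq> cball 0 1 \<longrightarrow>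
        norm (D hs y - D hs x - D ((y - x) # hs) x) \<le> e * norm (y - x)) \<and>
     (\<forall>j\<le>k. \<forall>e>0. \<forall>\<^sub>F y in at x within U. \<forall>hs. length hs = j \<and> set hs \<subseteq> cball 0 1 \<longrightarrow>
        norm (D hs y - D hs x) \<le> e))"

text \<open>Around each point a \<open>C\<^sup>k\<close> change of coordinates straightens the set to a closed complemented
  linear subspace, presented as the range of a bounded projection.\<close>

definition Ck_submanifold :: "nat \<Rightarrow> 'a::real_normed_vector set \<Rightarrow> bool" where
  "Ck_submanifold k M \<longleftrightarrow> (\<forall>p\<in>M. \<exists>(U :: 'a set) (V :: 'a set) \<Phi> \<Psi> P. open U \<and> open V \<and> p \<in> U \<and>
     homeomorphism U V \<Phi> \<Psi> \<and> Ck_on k U \<Phi> \<and> Ck_on k V \<Psi> \<and>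
     bounded_linear P \<and> P \<circ> P = P \<and> \<Phi> ` (U \<inter> M) = V \<inter> range P)"

type_synonym 'n state = "'n H2 \<times> 'n H2"

text \<open>Strong solutions in \<open>H \<times> H\<close>: continuous into \<open>H \<times> H\<close> up to time \<open>0\<close>, with the equations
  holding in \<open>L\<^sup>2\<close> at positive times.\<close>

definition fast_reaction_solution ::
  "real \<Rightarrow> real \<Rightarrow> real \<Rightarrow> real \<Rightarrow> real \<Rightarrow> real \<Rightarrow> real \<Rightarrow> (real \<Rightarrow> ('n::finite) state) \<Rightarrow> bool" where
  "fast_reaction_solution \<alpha> \<beta> \<gamma> \<delta> \<mu> \<nu> \<epsilon> z \<longleftrightarrow>
     continuous_on {0..} z \<and>
     (\<forall>t>0. \<exists>u' v'.
        ((\<lambda>s. L2_of (fst (z s))) has_vector_derivative u') (at t) \<and>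
        ((\<lambda>s. L2_of (snd (z s))) has_vector_derivative v') (at t) \<and>
        \<epsilon> *\<^sub>R u' = \<epsilon> *\<^sub>R (laplacian (fst (z t)) - \<mu> *\<^sub>R L2_of (fst (z t)))
                   + \<alpha> *\<^sub>R L2_of (fst (z t)) + \<beta> *\<^sub>R L2_of (snd (z t)) \<and>
        v' = (laplacian (snd (z t)) - \<nu> *\<^sub>R L2_of (snd (z t)))
                   + \<gamma> *\<^sub>R L2_of (fst (z t)) + \<delta> *\<^sub>R L2_of (snd (z t)))"

definition limit_solution ::
  "real \<Rightarrow> real \<Rightarrow> real \<Rightarrow> real \<Rightarrow> real \<Rightarrow> (real \<Rightarrow> ('n::finite) state) \<Rightarrow> bool" where
  "limit_solution \<alpha> \<beta> \<gamma> \<delta> \<nu> z \<longleftrightarrow>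
     continuous_on {0..} z \<and>
     (\<forall>t\<ge>0. 0 = \<alpha> *\<^sub>R fst (z t) + \<beta> *\<^sub>R snd (z t)) \<and>
     (\<forall>t>0. ((\<lambda>s. L2_of (snd (z s))) has_vector_derivative
        ((laplacian (snd (z t)) - \<nu> *\<^sub>R L2_of (snd (z t)))
                   + \<gamma> *\<^sub>R L2_of (fst (z t)) + \<delta> *\<^sub>R L2_of (snd (z t)))) (at t))"

definition solution_semiflow ::
  "'a set \<Rightarrow> ((real \<Rightarrow> 'a) \<Rightarrow> bool) \<Rightarrow> (real \<Rightarrow> 'a \<Rightarrow> 'a) \<Rightarrow> bool" where
  "solution_semiflow X sol T \<longleftrightarrow> (\<forall>z\<in>X.
     T 0 z = z \<and> sol (\<lambda>t. T t z) \<and> (\<forall>t\<ge>0. T t z \<in> X) \<and>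
     (\<forall>s\<ge>0. \<forall>t\<ge>0. T (s + t) z = T s (T t z)))"

definition locally_invariant :: "(real \<Rightarrow> 'a \<Rightarrow> 'a) \<Rightarrow> 'a set \<Rightarrow> bool" where
  "locally_invariant T M \<longleftrightarrow> (\<forall>z\<in>M. \<exists>\<tau>>0. \<forall>t\<in>{0..<\<tau>}. T t z \<in> M)"

text \<open>Distinct closed subspaces have infinite Hausdorff distance, so unbounded manifolds are
  compared inside balls.\<close>

definition converges_on_bounded :: "(real \<Rightarrow> 'a::real_normed_vector set) \<Rightarrow> 'a set \<Rightarrow> bool" where
  "converges_on_bounded M C \<longleftrightarrow>
     (\<forall>R>0. ((\<lambda>\<epsilon>. hausdorff_dist (M \<epsilon> \<inter> cball 0 R) (C \<inter> cball 0 R)) \<longlongrightarrow> 0) (at_right 0))"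

text \<open>Orbits on \<open>M \<epsilon>\<close> and on \<open>C\<close> are matched through the initial datum of the slow variable \<open>v\<close>, the
  only datum of the limit system; convergence is uniform on compact time intervals and for
  bounded data.\<close>

definition flow_converges ::
  "(real \<Rightarrow> real \<Rightarrow> 'a \<times> 'b \<Rightarrow> 'a \<times> 'b) \<Rightarrow> (real \<Rightarrow> ('a::real_normed_vector \<times> 'b::real_normed_vector) set)
     \<Rightarrow> (real \<Rightarrow> 'a \<times> 'b \<Rightarrow> 'a \<times> 'b) \<Rightarrow> ('a \<times> 'b) set \<Rightarrow> bool" where
  "flow_converges T M T\<^sub>0 C \<longleftrightarrow>
     (\<forall>R>0. \<forall>\<tau>>0. \<forall>e>0. \<forall>\<^sub>F \<epsilon> in at_right 0. \<forall>z\<in>M \<epsilon>. \<forall>w\<in>C.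
        snd z = snd w \<and> norm (snd w) \<le> R \<longrightarrow> (\<forall>t\<in>{0..\<tau>}. dist (T \<epsilon> t z) (T\<^sub>0 t w) < e))"

text \<open>\<open>E\<close> is the set of admissible parameters \<open>\<epsilon>\<close>; it is meant to contain all small positive \<open>\<epsilon>\<close>.\<close>

definition slow_manifold ::
  "real set \<Rightarrow> (real \<Rightarrow> real \<Rightarrow> 'a \<times> 'b \<Rightarrow> 'a \<times> 'b) \<Rightarrow> (real \<Rightarrow> ('a::real_normed_vector \<times> 'b::real_normed_vector) set)
     \<Rightarrow> (real \<Rightarrow> 'a \<times> 'b \<Rightarrow> 'a \<times> 'b) \<Rightarrow> ('a \<times> 'b) set \<Rightarrow> bool" where
  "slow_manifold E T M T\<^sub>0 C \<longleftrightarrow>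
     (\<forall>\<epsilon>\<in>E. Ck_submanifold 1 (M \<epsilon>) \<and> locally_invariant (T \<epsilon>) (M \<epsilon>)) \<and>
     (\<forall>\<epsilon>\<in>E. \<forall>k. Ck_submanifold k C \<longrightarrow> Ck_submanifold k (M \<epsilon>)) \<and>
     converges_on_bounded M C \<and>
     flow_converges T M T\<^sub>0 C"

text \<open>Exponential attraction at the fast rate, of order \<open>1/\<epsilon>\<close>.\<close>

definition attracting ::
  "(real \<Rightarrow> real \<Rightarrow> 'a \<Rightarrow> 'a) \<Rightarrow> (real \<Rightarrow> 'a::metric_space set) \<Rightarrow> bool" where
  "attracting T M \<longleftrightarrow> (\<exists>\<kappa>>0. \<exists>K. \<forall>\<^sub>F \<epsilon> in at_right 0. \<forall>z. \<forall>t\<ge>0.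
     infdist (T \<epsilon> t z) (M \<epsilon>) \<le> K * exp (- \<kappa> * t / \<epsilon>) * infdist z (M \<epsilon>))"

text \<open>\<open>\<Omega>\<close> is real and nonzero iff this is positive.\<close>

definition discriminant :: "real \<Rightarrow> real \<Rightarrow> real \<Rightarrow> real \<Rightarrow> real \<Rightarrow> real \<Rightarrow> real \<Rightarrow> real" where
  "discriminant \<alpha> \<beta> \<gamma> \<delta> \<mu> \<nu> \<epsilon> = (\<delta> - \<nu> - \<alpha> / \<epsilon> + \<mu>)\<^sup>2 + 4 * \<beta> * \<gamma> / \<epsilon>"

text \<open>For \<open>\<alpha> < 0\<close> the square root in \<open>\<Omega>\<close> has to be taken on the branch with the sign of \<open>\<alpha>\<close>,
  that is, with \<open>\<epsilon>\<Omega> \<rightarrow> \<alpha>\<close> as \<open>\<epsilon> \<rightarrow> 0\<close>. The coefficient of \<open>u\<close> in \<open>C_minus\<close> then tends to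
  \<open>- 2\<alpha>\<close> (\<open>coefficient_tendsto\<close>) and \<open>C_minus\<close> tends to the critical manifold. With the nonnegative
  root that coefficient tends to \<open>0\<close> (\<open>coefficient_nonneg_root_tendsto\<close>); the formula would describe
  the eigenspace of the fast eigenvalue (of order \<open>\<alpha>/\<epsilon>\<close>), which tends to \<open>{v = 0}\<close> and so cannot be a
  slow manifold. For \<open>\<alpha> > 0\<close> this branch is the usual square root.\<close>

definition Omega :: "real \<Rightarrow> real \<Rightarrow> real \<Rightarrow> real \<Rightarrow> real \<Rightarrow> real \<Rightarrow> real \<Rightarrow> real" where
  "Omega \<alpha> \<beta> \<gamma> \<delta> \<mu> \<nu> \<epsilon> = sgn \<alpha> * sqrt (discriminant \<alpha> \<beta> \<gamma> \<delta> \<mu> \<nu> \<epsilon>)"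

definition C_minus :: "real \<Rightarrow> real \<Rightarrow> real \<Rightarrow> real \<Rightarrow> real \<Rightarrow> real \<Rightarrow> real \<Rightarrow> ('n::finite) state set" where
  "C_minus \<alpha> \<beta> \<gamma> \<delta> \<mu> \<nu> \<epsilon> =
     {(u, v). (\<epsilon> * (\<delta> - \<nu> + \<mu>) - \<alpha> - \<epsilon> * Omega \<alpha> \<beta> \<gamma> \<delta> \<mu> \<nu> \<epsilon>) *\<^sub>R u - (2 * \<beta>) *\<^sub>R v = 0}"

definition critical_manifold :: "real \<Rightarrow> real \<Rightarrow> ('n::finite) state set" where
  "critical_manifold \<alpha> \<beta> = {(u, v). \<alpha> *\<^sub>R u + \<beta> *\<^sub>R v = 0}"

lemma eps_sqrt_discriminant_tendsto:
  "((\<lambda>\<epsilon>. \<epsilon> * sqrt (discriminant \<alpha> \<beta> \<gamma> \<delta> \<mu> \<nu> \<epsilon>)) \<longlongrightarrow> \<bar>\<alpha>\<bar>) (at_right 0)"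
proof -
  have "((\<lambda>\<epsilon>. sqrt ((\<epsilon> * (\<delta> - \<nu> + \<mu>) - \<alpha>)\<^sup>2 + 4 * \<beta> * \<gamma> * \<epsilon>)) \<longlongrightarrow>
         sqrt ((0 * (\<delta> - \<nu> + \<mu>) - \<alpha>)\<^sup>2 + 4 * \<beta> * \<gamma> * 0)) (at_right 0)"
    by (intro tendsto_intros)
  moreover have "\<forall>\<^sub>F \<epsilon> in at_right 0. sqrt ((\<epsilon> * (\<delta> - \<nu> + \<mu>) - \<alpha>)\<^sup>2 + 4 * \<beta> * \<gamma> * \<epsilon>)
      = \<epsilon> * sqrt (discriminant \<alpha> \<beta> \<gamma> \<delta> \<mu> \<nu> \<epsilon>)"
    unfolding eventually_at_right_field
  proof (intro exI[of _ 1] conjI allI impI)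
    fix \<epsilon> :: real assume "0 < \<epsilon>" "\<epsilon> < 1"
    have "(\<epsilon> * (\<delta> - \<nu> + \<mu>) - \<alpha>)\<^sup>2 + 4 * \<beta> * \<gamma> * \<epsilon> = \<epsilon>\<^sup>2 * discriminant \<alpha> \<beta> \<gamma> \<delta> \<mu> \<nu> \<epsilon>"
      using \<open>0 < \<epsilon>\<close> by (simp add: discriminant_def power2_eq_square field_simps)
    thus "sqrt ((\<epsilon> * (\<delta> - \<nu> + \<mu>) - \<alpha>)\<^sup>2 + 4 * \<beta> * \<gamma> * \<epsilon>) = \<epsilon> * sqrt (discriminant \<alpha> \<beta> \<gamma> \<delta> \<mu> \<nu> \<epsilon>)"
      using \<open>0 < \<epsilon>\<close> by (simp add: real_sqrt_mult)
  qed simp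
  ultimately have "((\<lambda>\<epsilon>. \<epsilon> * sqrt (discriminant \<alpha> \<beta> \<gamma> \<delta> \<mu> \<nu> \<epsilon>)) \<longlongrightarrow>
      sqrt ((0 * (\<delta> - \<nu> + \<mu>) - \<alpha>)\<^sup>2 + 4 * \<beta> * \<gamma> * 0)) (at_right 0)"
    by (rule Lim_transform_eventually)
  thus ?thesis by simp
qed

lemma coefficient_tendsto:
  "((\<lambda>\<epsilon>. \<epsilon> * (\<delta> - \<nu> + \<mu>) - \<alpha> - \<epsilon> * Omega \<alpha> \<beta> \<gamma> \<delta> \<mu> \<nu> \<epsilon>) \<longlongrightarrow> - 2 * \<alpha>) (at_right 0)"
proof -
  have "((\<lambda>\<epsilon>. \<epsilon> * (\<delta> - \<nu> + \<mu>) - \<alpha> - sgn \<alpha> * (\<epsilon> * sqrt (discriminant \<alpha> \<beta> \<gamma> \<delta> \<mu> \<nu> \<epsilon>)))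
         \<longlongrightarrow> 0 * (\<delta> - \<nu> + \<mu>) - \<alpha> - sgn \<alpha> * \<bar>\<alpha>\<bar>) (at_right 0)"
    by (intro tendsto_intros eps_sqrt_discriminant_tendsto)
  thus ?thesis by (simp add: Omega_def mult_ac abs_mult_sgn)
qed

lemma coefficient_nonneg_root_tendsto:
  assumes "\<alpha> < 0"
  shows "((\<lambda>\<epsilon>. \<epsilon> * (\<delta> - \<nu> + \<mu>) - \<alpha> - \<epsilon> * sqrt (discriminant \<alpha> \<beta> \<gamma> \<delta> \<mu> \<nu> \<epsilon>)) \<longlongrightarrow> 0) (at_right 0)"
proof -
  have "((\<lambda>\<epsilon>. \<epsilon> * (\<delta> - \<nu> + \<mu>) - \<alpha> - \<epsilon> * sqrt (discriminant \<alpha> \<beta> \<gamma> \<delta> \<mu> \<nu> \<epsilon>))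
         \<longlongrightarrow> 0 * (\<delta> - \<nu> + \<mu>) - \<alpha> - \<bar>\<alpha>\<bar>) (at_right 0)"
    by (intro tendsto_intros eps_sqrt_discriminant_tendsto)
  thus ?thesis using assms by simp
qed

end

(* The combination w = m u - 2 beta v that vanishes on C_minus solves w_t = Lap w + l w with the fast
   eigenvalue l ~ alpha/eps of the reaction matrix, while on C_minus the equation for v decouples with
   the slow eigenvalue, which converges to the growth rate of the limit system. Everything therefore
   follows from |w(t)| <= exp(l t) |w(0)| in H^2 for solutions of such an equation. No heat kernel or
   Fourier transform is needed: test functions are dense in L^2, so weak derivatives are strong
   derivatives along the translation group; the energy estimate in L^2 holds for the image of w under every
   operator commuting with translations, in particular for its difference quotients, and passes to the
   derivatives in the limit. *)

theory Submission
  imports Defs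
begin

subsection \<open>Density of test functions\<close>

text \<open>A solution has values in H^2 but is differentiable in time only as a map into L^2, and
  an energy estimate for second derivatives would pair \<open>D^2 w\<close> with \<open>D^2\<close>
  of its Laplacian, which need not exist. The estimate is therefore made for \<open>B w\<close> with
  an arbitrary bounded \<open>B\<close> commuting with translations: such a \<open>B\<close> maps
  strong derivatives to strong derivatives, so pairing \<open>B w\<close> with \<open>B\<close> of
  the Laplacian still gives minus a sum of squares. One or two difference quotients inside
  \<open>B\<close> then replace the missing regularity. The norm bound also yields uniqueness. Hence
  two solutions with the same datum and rates a and b differ by the scalar factor exp((a - b) t),
  and comparing the flow on the slow manifold with the limit flow becomes a comparison of numbers.
  With m = \<open>C_coeff\<close>, which tends to -2 \<alpha>, the fast eigenvalue is \<delta> -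
  \<nu> - m / (2 \<epsilon>), and the slow one is \<delta> - \<nu> + 2 \<beta> \<gamma> / m, with
  limit \<delta> - \<nu> - \<beta> \<gamma> / \<alpha>.\<close>

lemma L2_rel_same [simp]: "L2_rel f f \<longleftrightarrow> sq_integrable f"
  by (simp add: L2_rel_def)

text \<open>The quotient is partial, so \<open>abs_L2\<close> is meaningful only on square
  integrable representatives. This case rule supplies one together with the side condition that the
  rules for \<open>abs_L2\<close> ask for.\<close>

lemma L2_cases:
  obtains f where "sq_integrable f" "F = abs_L2 f"
  using Quotient_abs_rep[OF Quotient_L2, of F] Quotient_rep_reflp[OF Quotient_L2, of F]
  by (metis L2_rel_same)

lemma inner_abs_L2:
  "sq_integrable f \<Longrightarrow> sq_integrable g \<Longrightarrow> abs_L2 f \<bullet> abs_L2 g = (\<integral>x. f x * g x \<partial>lborel)"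
  by (simp add: inner_L2.abs_eq)

lemma norm_abs_L2_sq:
  "sq_integrable f \<Longrightarrow> (norm (abs_L2 f))\<^sup>2 = (\<integral>x. (f x)\<^sup>2 \<partial>lborel)"
  using inner_abs_L2[of f f] by (simp add: power2_norm_eq_inner power2_eq_square[of "f _"])

lemma abs_L2_add: "sq_integrable f \<Longrightarrow> sq_integrable g \<Longrightarrow> abs_L2 f + abs_L2 g = abs_L2 (\<lambda>x. f x + g x)"
  by (simp add: plus_L2.abs_eq)

lemma abs_L2_scaleR: "sq_integrable f \<Longrightarrow> c *\<^sub>R abs_L2 f = abs_L2 (\<lambda>x. c * f x)"
  by (simp add: scaleR_L2.abs_eq)

lemma abs_L2_diff: "sq_integrable f \<Longrightarrow> sq_integrable g \<Longrightarrow> abs_L2 f - abs_L2 g = abs_L2 (\<lambda>x. f x - g x)"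
  by (simp add: minus_L2.abs_eq)

lemma sq_integrable_diff: "sq_integrable f \<Longrightarrow> sq_integrable g \<Longrightarrow> sq_integrable (\<lambda>x. f x - g x)"
  using sq_integrable_add[of f "\<lambda>x. -1 * g x"] sq_integrable_scale[of g "-1"] by simp

lemma sq_integrable_bound:
  assumes "sq_integrable g" "f \<in> borel_measurable borel" "\<And>x. \<bar>f x\<bar> \<le> \<bar>g x\<bar>"
  shows "sq_integrable f"
proof -
  have "integrable lborel (\<lambda>x. (f x)\<^sup>2)"
  proof (rule Bochner_Integration.integrable_bound)
    show "integrable lborel (\<lambda>x. (g x)\<^sup>2)" using assms(1) by (simp add: sq_integrable_def)
    show "AE x in lborel. norm ((f x)\<^sup>2) \<le> norm ((g x)\<^sup>2)"
      using assms(3) by (auto simp: abs_le_square_iff)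
  qed (use assms(2) in measurable)
  thus ?thesis using assms(2) by (simp add: sq_integrable_def)
qed

lemma abs_L2_sum:
  assumes "finite I" "\<And>i. i \<in> I \<Longrightarrow> sq_integrable (f i)"
  shows "sq_integrable (\<lambda>x. \<Sum>i\<in>I. c i * f i x)"
    and "(\<Sum>i\<in>I. c i *\<^sub>R abs_L2 (f i)) = abs_L2 (\<lambda>x. \<Sum>i\<in>I. c i * f i x)"
proof -
  have "sq_integrable (\<lambda>x. \<Sum>i\<in>I. c i * f i x) \<and>
      (\<Sum>i\<in>I. c i *\<^sub>R abs_L2 (f i)) = abs_L2 (\<lambda>x. \<Sum>i\<in>I. c i * f i x)"
    using assms
  proof (induction I rule: finite_induct)
    case empty
    show ?case by (simp add: sq_integrable_0 zero_L2_def)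
  next
    case (insert i I)
    thus ?case by (simp add: abs_L2_scaleR abs_L2_add sq_integrable_add sq_integrable_scale)
  qed
  thus "sq_integrable (\<lambda>x. \<Sum>i\<in>I. c i * f i x)"
    and "(\<Sum>i\<in>I. c i *\<^sub>R abs_L2 (f i)) = abs_L2 (\<lambda>x. \<Sum>i\<in>I. c i * f i x)" by auto
qed

text \<open>The limit inherits the bound by \<open>g\<close>, so the squared differences are
  dominated by the integrable function 4 g^2. Every approximation step of the density proof, and the
  derivative of a test function, goes through this lemma.\<close>

lemma abs_L2_dominated_convergence:
  assumes g: "sq_integrable g" and f: "\<And>k. f k \<in> borel_measurable borel"
    and bound: "\<And>k x. \<bar>f k x\<bar> \<le> g x" and lim: "\<And>x. (\<lambda>k. f k x) \<longlonglongrightarrow> f' x"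
  shows "sq_integrable f'" and "(\<lambda>k. abs_L2 (f k)) \<longlonglongrightarrow> abs_L2 f'"
proof -
  have g0: "0 \<le> g x" for x using order_trans[OF abs_ge_zero bound] .
  have m': "f' \<in> borel_measurable borel"
    by (rule borel_measurable_LIMSEQ_real[OF lim f])
  have b': "\<bar>f' x\<bar> \<le> g x" for x
    using bound by (intro LIMSEQ_le_const2[OF tendsto_rabs[OF lim]]) auto
  have fk: "sq_integrable (f k)" for k
    using bound g0 by (intro sq_integrable_bound[OF g f]) simp
  show f': "sq_integrable f'"
    using b' g0 by (intro sq_integrable_bound[OF g m']) simp
  have "(\<lambda>k. \<integral>x. (f k x - f' x)\<^sup>2 \<partial>lborel) \<longlonglongrightarrow> (\<integral>x. 0 \<partial>(lborel :: (real^'a) measure))"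
  proof (rule integral_dominated_convergence)
    show "integrable lborel (\<lambda>x. 4 * (g x)\<^sup>2)" using g by (simp add: sq_integrable_def)
    show "(\<lambda>x. (f k x - f' x)\<^sup>2) \<in> borel_measurable lborel" for k using f m' by measurable
    show "AE x in lborel. (\<lambda>k. (f k x - f' x)\<^sup>2) \<longlonglongrightarrow> 0"
    proof (rule AE_I2)
      fix x
      have "(\<lambda>k. (f k x - f' x)\<^sup>2) \<longlonglongrightarrow> (f' x - f' x)\<^sup>2" by (intro tendsto_intros lim)
      thus "(\<lambda>k. (f k x - f' x)\<^sup>2) \<longlonglongrightarrow> 0" by simp
    qed
    show "AE x in lborel. norm ((f k x - f' x)\<^sup>2) \<le> 4 * (g x)\<^sup>2" for k
    proof (rule AE_I2)
      fix x
      have "\<bar>f k x - f' x\<bar> \<le> \<bar>2 * g x\<bar>" using bound[of k x] b'[of x] g0[of x] by linarith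
      hence "(f k x - f' x)\<^sup>2 \<le> (2 * g x)\<^sup>2" by (simp only: abs_le_square_iff)
      thus "norm ((f k x - f' x)\<^sup>2) \<le> 4 * (g x)\<^sup>2" by (simp add: power_mult_distrib)
    qed
  qed simp
  hence "(\<lambda>k. (norm (abs_L2 (f k) - abs_L2 f'))\<^sup>2) \<longlonglongrightarrow> 0"
    by (simp add: abs_L2_diff fk f' norm_abs_L2_sq sq_integrable_diff)
  hence "(\<lambda>k. sqrt ((norm (abs_L2 (f k) - abs_L2 f'))\<^sup>2)) \<longlonglongrightarrow> sqrt 0"
    by (rule tendsto_real_sqrt)
  hence "(\<lambda>k. norm (abs_L2 (f k) - abs_L2 f')) \<longlonglongrightarrow> 0" by simp
  thus "(\<lambda>k. abs_L2 (f k)) \<longlonglongrightarrow> abs_L2 f'"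
    using LIM_zero_iff tendsto_norm_zero_iff by blast
qed

section \<open>Linear combinations and limits of test functions\<close>

lemma iter_partial_lincomb:
  assumes "smooth_fun \<phi>" "smooth_fun \<psi>"
  shows "iter_partial is (\<lambda>x. a * \<phi> x + b * \<psi> x) = (\<lambda>x. a * iter_partial is \<phi> x + b * iter_partial is \<psi> x)"
proof (induction "is")
  case (Cons i js)
  have D: "(iter_partial js \<xi> has_derivative frechet_derivative (iter_partial js \<xi>) (at x)) (at x)"
    if "smooth_fun \<xi>" for \<xi> x
    using that by (auto simp: smooth_fun_def frechet_derivative_works[symmetric])
  have "partial_deriv i (\<lambda>x. a * iter_partial js \<phi> x + b * iter_partial js \<psi> x)
      = (\<lambda>x. a * frechet_derivative (iter_partial js \<phi>) (at x) (axis i 1)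
            + b * frechet_derivative (iter_partial js \<psi>) (at x) (axis i 1))"
    by (rule partial_deriv_eqI) (intro has_derivative_add has_derivative_mult_right D assms)
  thus ?case by (simp add: Cons.IH) (simp add: partial_deriv_def)
qed simp

lemma test_fun_lincomb:
  assumes "test_fun \<phi>" "test_fun \<psi>"
  shows "test_fun (\<lambda>x. a * \<phi> x + b * \<psi> x)"
proof -
  have s: "smooth_fun \<phi>" "smooth_fun \<psi>" using assms by (auto simp: test_fun_def)
  have "smooth_fun (\<lambda>x. a * \<phi> x + b * \<psi> x)"
    using s unfolding smooth_fun_def iter_partial_lincomb[OF s]
    by (auto intro!: differentiable_add differentiable_mult)
  moreover have "compact (closure {x. a * \<phi> x + b * \<psi> x \<noteq> 0})"
  proof -
    have "{x. a * \<phi> x + b * \<psi> x \<noteq> 0} \<subseteq> closure {x. \<phi> x \<noteq> 0} \<union> closure {x. \<psi> x \<noteq> 0}"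
      using closure_subset[of "{x. \<phi> x \<noteq> 0}"] closure_subset[of "{x. \<psi> x \<noteq> 0}"] by fastforce
    moreover have "bounded (closure {x. \<phi> x \<noteq> 0} \<union> closure {x. \<psi> x \<noteq> 0})"
      using assms by (auto simp: test_fun_def compact_imp_bounded)
    ultimately show ?thesis using bounded_subset compact_closure by blast
  qed
  ultimately show ?thesis by (simp add: test_fun_def)
qed

definition test_L2 :: "'n::finite L2 set" where
  "test_L2 = abs_L2 ` {\<phi>. test_fun \<phi>}"

lemma test_fun_in_closure: "test_fun \<phi> \<Longrightarrow> abs_L2 \<phi> \<in> closure test_L2"
  using closure_subset[of test_L2] by (auto simp: test_L2_def)

lemma test_L2_lincomb:
  assumes "F \<in> test_L2" "G \<in> test_L2"
  shows "a *\<^sub>R F + b *\<^sub>R G \<in> test_L2"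
proof -
  obtain \<phi> \<psi> where p: "test_fun \<phi>" "test_fun \<psi>" "F = abs_L2 \<phi>" "G = abs_L2 \<psi>"
    using assms by (auto simp: test_L2_def)
  hence "a *\<^sub>R F + b *\<^sub>R G = abs_L2 (\<lambda>x. a * \<phi> x + b * \<psi> x)"
    by (simp add: test_fun_sq_integrable abs_L2_scaleR abs_L2_add sq_integrable_scale)
  thus ?thesis using test_fun_lincomb[OF p(1,2)] by (auto simp: test_L2_def)
qed

lemma closure_test_L2_lincomb:
  assumes "F \<in> closure test_L2" "G \<in> closure test_L2"
  shows "a *\<^sub>R F + b *\<^sub>R G \<in> closure test_L2"
proof -
  obtain X Y where "\<And>n. X n \<in> test_L2" "X \<longlonglongrightarrow> F" "\<And>n. Y n \<in> test_L2" "Y \<longlonglongrightarrow> G"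
    using assms unfolding closure_sequential by blast
  thus ?thesis unfolding closure_sequential
    by (intro exI[of _ "\<lambda>n. a *\<^sub>R X n + b *\<^sub>R Y n"]) (auto intro!: test_L2_lincomb tendsto_intros)
qed

lemma closure_test_L2_sum:
  assumes "finite I" "\<And>i. i \<in> I \<Longrightarrow> F i \<in> closure test_L2"
  shows "(\<Sum>i\<in>I. c i *\<^sub>R F i) \<in> closure (test_L2 :: 'n::finite L2 set)"
  using assms
proof (induction I rule: finite_induct)
  case empty
  \<comment> \<open>The empty sum needs some element of the closure to multiply by 0; any bump
    serves.\<close>
  have "abs_L2 (box_bump 0 1 0) \<in> closure (test_L2 :: 'n L2 set)"
    by (intro test_fun_in_closure box_bump_test_fun)
  from closure_test_L2_lincomb[OF this this, of 0 0] show ?case by simp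
next
  case (insert i I)
  have "c i *\<^sub>R F i + 1 *\<^sub>R (\<Sum>i\<in>I. c i *\<^sub>R F i) \<in> closure test_L2"
    using insert by (intro closure_test_L2_lincomb) auto
  thus ?case using insert by simp
qed

lemma zero_in_closure_test_L2: "(0 :: 'n::finite L2) \<in> closure test_L2"
  using closure_test_L2_sum[of "{}" "\<lambda>_. 0 :: 'n L2"] by simp

lemma closure_test_L2_lim:
  "(\<And>k::nat. X k \<in> closure test_L2) \<Longrightarrow> X \<longlonglongrightarrow> F \<Longrightarrow> F \<in> closure test_L2"
  using closed_sequentially[OF closed_closure] by blast

section \<open>Density: from boxes through measurable sets to all of L^2\<close>

lemma sq_integrable_indicator_set:
  assumes "A \<in> sets borel" "emeasure lborel A < \<infinity>"
  shows "sq_integrable (indicator A :: real^'n::finite \<Rightarrow> real)"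
proof -
  have "(\<lambda>x::real^'n. (indicator A x :: real)\<^sup>2) = indicator A" by (auto simp: indicator_def)
  thus ?thesis using assms by (simp add: sq_integrable_def integrable_indicator_iff)
qed

text \<open>The bumps vanish off the box, have values between 0 and 1 and converge pointwise to the
  indicator, so the indicator itself is the majorant.\<close>

lemma indicator_box_in_closure:
  "abs_L2 (indicator (box a b)) \<in> closure (test_L2 :: 'n::finite L2 set)"
proof (rule closure_test_L2_lim)
  show "abs_L2 (box_bump a b m) \<in> closure test_L2" for m
    by (intro test_fun_in_closure box_bump_test_fun)
  show "(\<lambda>m. abs_L2 (box_bump a b m)) \<longlonglongrightarrow> abs_L2 (indicator (box a b))"
  proof (rule abs_L2_dominated_convergence(2))
    show "sq_integrable (indicator (box a b) :: real^'n \<Rightarrow> real)"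
      by (intro sq_integrable_indicator_set emeasure_lborel_box_finite) auto
    show "box_bump a b m \<in> borel_measurable borel" for m
      using box_bump_test_fun smooth_fun_measurable by (auto simp: test_fun_def)
    show "\<bar>box_bump a b m x\<bar> \<le> indicator (box a b) x" for m x
      using box_bump_nz_iff[of a b m x] box_bump_range[of a b m x] by (auto simp: indicator_def)
    show "(\<lambda>m. box_bump a b m x) \<longlonglongrightarrow> indicator (box a b) x" for x
      by (rule box_bump_tendsto)
  qed
qed

text \<open>Induction over the Borel sets generated by the intersection-stable family of open boxes.
  Cutting with a fixed box keeps all measures finite, so that complements become differences in
  L^2.\<close>

lemma indicator_Int_box_in_closure:
  assumes "A \<in> sets (borel :: (real^'n::finite) measure)"
  shows "abs_L2 (indicator (A \<inter> box c d)) \<in> closure test_L2"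
proof -
  let ?B = "box c d"
  have fin: "sq_integrable (indicator (S \<inter> ?B) :: real^'n \<Rightarrow> real)" if "S \<in> sets borel" for S
  proof (rule sq_integrable_indicator_set)
    show "emeasure lborel (S \<inter> ?B) < \<infinity>"
      using emeasure_mono[of "S \<inter> ?B" ?B lborel] emeasure_lborel_box_finite[of c d] by (auto simp: order_le_less_trans)
  qed (use that in auto)
  have "Int_stable (range (\<lambda>(a, b). box a b :: (real^'n) set))"
    by (auto simp: Int_stable_def box_Int_box)
  moreover have "range (\<lambda>(a, b). box a b) \<subseteq> Pow (UNIV :: (real^'n) set)" by simp
  moreover have "A \<in> sigma_sets UNIV (range (\<lambda>(a, b). box a b))" using assms by (simp add: borel_eq_box)
  ultimately show ?thesis
  proof (induction rule: sigma_sets_induct_disjoint)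
    case (basic S)
    thus ?case using indicator_box_in_closure by (auto simp: box_Int_box)
  next
    show "abs_L2 (indicator ({} \<inter> ?B)) \<in> closure (test_L2 :: 'n L2 set)"
    proof -
      have "indicator ({} \<inter> ?B) x = (0 :: real)" for x :: "real^'n" by simp
      hence "(indicator ({} \<inter> ?B) :: real^'n \<Rightarrow> real) = (\<lambda>x. 0)" by (rule ext)
      hence "abs_L2 (indicator ({} \<inter> ?B)) = (0 :: 'n L2)" by (simp only: zero_L2_def)
      thus ?thesis using zero_in_closure_test_L2 by (simp only:)
    qed
  next
    fix S :: "(real^'n) set" assume S: "S \<in> sigma_sets UNIV (range (\<lambda>(a, b). box a b))"
      and IH: "abs_L2 (indicator (S \<inter> ?B)) \<in> closure test_L2"
    have m: "S \<in> sets borel" using S by (simp add: borel_eq_box)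
    have "1 *\<^sub>R abs_L2 (indicator ?B) + (-1) *\<^sub>R abs_L2 (indicator (S \<inter> ?B)) \<in> closure test_L2"
      by (intro closure_test_L2_lincomb indicator_box_in_closure IH)
    moreover have "abs_L2 (indicator ?B) - abs_L2 (indicator (S \<inter> ?B)) = abs_L2 (indicator ((UNIV - S) \<inter> ?B))"
    proof -
      have "(\<lambda>x. indicator ?B x - indicator (S \<inter> ?B) x :: real) = indicator ((UNIV - S) \<inter> ?B)"
        by (auto simp: indicator_def)
      thus ?thesis using fin[OF m] fin[of UNIV] by (simp add: abs_L2_diff)
    qed
    ultimately show "abs_L2 (indicator ((UNIV - S) \<inter> ?B)) \<in> closure test_L2" by simp
  next
    fix S :: "nat \<Rightarrow> (real^'n) set"
    assume disj: "disjoint_family S" and S: "range S \<subseteq> sigma_sets UNIV (range (\<lambda>(a, b). box a b))"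
      and IH: "\<And>i. abs_L2 (indicator (S i \<inter> ?B)) \<in> closure test_L2"
    have m: "S i \<in> sets borel" for i using S by (auto simp: borel_eq_box)
    show "abs_L2 (indicator (\<Union>(range S) \<inter> ?B)) \<in> closure test_L2"
    proof (rule closure_test_L2_lim)
      \<comment> \<open>The countable union is reached as the limit of finite unions; disjointness
        makes the indicators of the latter additive, so they stay in the closure by induction on
        \<open>k\<close>.\<close>
      show "(\<lambda>k. abs_L2 (indicator ((\<Union>i<k. S i) \<inter> ?B))) \<longlonglongrightarrow> abs_L2 (indicator (\<Union>(range S) \<inter> ?B))"
      proof (rule abs_L2_dominated_convergence(2))
        show "sq_integrable (indicator (UNIV \<inter> ?B) :: real^'n \<Rightarrow> real)" by (rule fin) simp
        show "indicator ((\<Union>i<k. S i) \<inter> ?B) \<in> borel_measurable borel" for k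
          using m by measurable
        show "\<bar>indicator ((\<Union>i<k. S i) \<inter> ?B) x\<bar> \<le> (indicator (UNIV \<inter> ?B) x :: real)" for k x
          by (auto simp: indicator_def)
        show "(\<lambda>k. indicator ((\<Union>i<k. S i) \<inter> ?B) x) \<longlonglongrightarrow> (indicator (\<Union>(range S) \<inter> ?B) x :: real)" for x
        proof (cases "x \<in> \<Union>(range S) \<inter> ?B")
          case True
          then obtain j where "x \<in> S j" "x \<in> ?B" by auto
          hence "\<forall>\<^sub>F k in sequentially. indicator ((\<Union>i<k. S i) \<inter> ?B) x = (1::real)"
            by (intro eventually_sequentiallyI[of "Suc j"]) (auto simp: indicator_def)
          with True show ?thesis by (simp add: tendsto_eventually)
        qed (auto simp: indicator_def)
      qed
      show "abs_L2 (indicator ((\<Union>i<k. S i) \<inter> ?B)) \<in> closure test_L2" for k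
      proof (induction k)
        case 0
        have "indicator ((\<Union>i<0. S i) \<inter> ?B) = (\<lambda>x. 0 :: real)" by (rule ext) simp
        thus ?case using zero_in_closure_test_L2 by (simp only: zero_L2_def)
      next
        case (Suc k)
        have "(\<lambda>x. indicator ((\<Union>i<k. S i) \<inter> ?B) x + indicator (S k \<inter> ?B) x :: real)
            = indicator ((\<Union>i<Suc k. S i) \<inter> ?B)"
        proof
          fix x
          have "S i \<inter> S k = {}" if "i < k" for i
            using disjoint_family_onD[OF disj, of i k] that by simp
          hence "(\<Union>i<k. S i) \<inter> S k = {}" by blast
          thus "indicator ((\<Union>i<k. S i) \<inter> ?B) x + indicator (S k \<inter> ?B) x = (indicator ((\<Union>i<Suc k. S i) \<inter> ?B) x :: real)"
            unfolding lessThan_Suc by (auto simp: indicator_def)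
        qed
        hence "abs_L2 (indicator ((\<Union>i<k. S i) \<inter> ?B)) + abs_L2 (indicator (S k \<inter> ?B))
            = abs_L2 (indicator ((\<Union>i<Suc k. S i) \<inter> ?B))"
          using m by (subst abs_L2_add) (auto intro!: fin)
        with closure_test_L2_lincomb[OF Suc.IH IH[of k], of 1 1] show ?case by (simp only: scaleR_one)
      qed
    qed
  qed
qed

text \<open>Removes the fixed box: the boxes exhaust the space, and finite measure makes the
  indicator of \<open>A\<close> a square integrable majorant.\<close>

lemma indicator_in_closure:
  assumes "A \<in> sets (borel :: (real^'n::finite) measure)" "emeasure lborel A < \<infinity>"
  shows "abs_L2 (indicator A) \<in> closure test_L2"
proof (rule closure_test_L2_lim)
  let ?B = "\<lambda>k. box (- (real k *\<^sub>R One)) (real k *\<^sub>R One) :: (real^'n) set"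
  show "abs_L2 (indicator (A \<inter> ?B k)) \<in> closure test_L2" for k
    by (rule indicator_Int_box_in_closure[OF assms(1)])
  show "(\<lambda>k. abs_L2 (indicator (A \<inter> ?B k))) \<longlonglongrightarrow> abs_L2 (indicator A)"
  proof (rule abs_L2_dominated_convergence(2))
    show "sq_integrable (indicator A :: real^'n \<Rightarrow> real)"
      by (rule sq_integrable_indicator_set[OF assms])
    show "indicator (A \<inter> ?B k) \<in> borel_measurable borel" for k
      using assms(1) by measurable
    show "\<bar>indicator (A \<inter> ?B k) x\<bar> \<le> (indicator A x :: real)" for k x
      by (auto simp: indicator_def)
    show "(\<lambda>k. indicator (A \<inter> ?B k) x) \<longlonglongrightarrow> (indicator A x :: real)" for x
    proof -
      obtain j where j: "x \<in> ?B j" using UN_box_eq_UNIV[where 'a="real^'n"] by auto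
      have "?B j \<subseteq> ?B k" if "j \<le> k" for k
      proof -
        have "(One :: real^'n) \<bullet> i = 1" if "i \<in> Basis" for i
          using that inner_sum_left_Basis[of i "\<lambda>_. 1"] by simp
        thus ?thesis using that by (intro subset_box_imp) auto
      qed
      hence "\<forall>\<^sub>F k in sequentially. indicator (A \<inter> ?B k) x = (indicator A x :: real)"
        using j by (intro eventually_sequentiallyI[of j]) (auto simp: indicator_def)
      thus ?thesis by (rule tendsto_eventually)
    qed
  qed
qed

text \<open>Simple functions with |F i| <= 2 |f| converge to \<open>f\<close> pointwise, hence in
  L^2, and each is a finite combination of indicators of sets of finite measure.\<close>

lemma closure_test_L2: "closure test_L2 = (UNIV :: 'n::finite L2 set)"
proof -
  have "abs_L2 f \<in> closure test_L2" if f: "sq_integrable f" for f :: "real^'n \<Rightarrow> real"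
  proof -
    have m: "f \<in> borel_measurable borel" using f by (simp add: sq_integrable_def)
    obtain F where F: "\<And>i. simple_function borel (F i)" "\<And>x. (\<lambda>i. F i x) \<longlonglongrightarrow> f x"
        "\<And>i x. dist (F i x) 0 \<le> 2 * dist (f x) 0"
      using borel_measurable_implies_sequence_metric[OF m, of 0] by auto
    have mF: "F i \<in> borel_measurable borel" for i by (rule borel_measurable_simple_function[OF F(1)])
    have b: "\<bar>F i x\<bar> \<le> 2 * \<bar>f x\<bar>" for i x using F(3)[of i x] by simp
    have g: "sq_integrable (\<lambda>x. 2 * \<bar>f x\<bar>)"
      using f by (intro sq_integrable_scale) (auto simp: sq_integrable_def)
    show ?thesis
    proof (rule closure_test_L2_lim)
      show "(\<lambda>i. abs_L2 (F i)) \<longlonglongrightarrow> abs_L2 f"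
        by (rule abs_L2_dominated_convergence(2)[OF g mF b F(2)])
      fix i
      have Fi: "sq_integrable (F i)" using b by (intro sq_integrable_bound[OF g mF]) simp
      \<comment> \<open>The value 0 is left out: its level set may have infinite measure and
        contributes nothing to the sum.\<close>
      let ?A = "\<lambda>y. F i -` {y}" and ?R = "range (F i) - {0}"
      have R: "finite ?R" using simple_functionD(1)[OF F(1), of i] by simp
      have A: "?A y \<in> sets borel" for y using simple_functionD(2)[OF F(1), of i "{y}"] by simp
      \<comment> \<open>Chebyshev: on the level set of y the function (F i)^2 / y^2 equals
        1.\<close>
      have fin: "emeasure lborel (?A y) < \<infinity>" if "y \<noteq> 0" for y
      proof -
        have "integrable lborel (indicator (?A y) :: real^'n \<Rightarrow> real)"
        proof (rule Bochner_Integration.integrable_bound)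
          show "integrable lborel (\<lambda>x. inverse (y\<^sup>2) * (F i x)\<^sup>2)"
            using Fi by (intro integrable_mult_right) (auto simp: sq_integrable_def)
          show "AE x in lborel. norm (indicator (?A y) x :: real) \<le> norm (inverse (y\<^sup>2) * (F i x)\<^sup>2)"
            using that by (auto simp: indicator_def)
        qed (use A in measurable)
        thus ?thesis using A by (simp add: integrable_indicator_iff)
      qed
      have sq: "sq_integrable (indicator (?A y) :: real^'n \<Rightarrow> real)" if "y \<in> ?R" for y
        using that A fin by (intro sq_integrable_indicator_set) auto
      note sumA = abs_L2_sum[OF R, of "\<lambda>y. indicator (?A y)" "\<lambda>y. y", OF sq]
      have "F i x = (\<Sum>y\<in>?R. y * indicator (?A y) x)" for x
      proof (cases "F i x = 0")
        case True
        thus ?thesis by (auto simp: indicator_def intro!: sum.neutral)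
      next
        case False
        have "(\<Sum>y\<in>?R. y * indicator (?A y) x) = (\<Sum>y\<in>?R. if F i x = y then y else 0)"
          by (intro sum.cong) (auto simp: indicator_def)
        thus ?thesis using False R by (simp add: sum.delta')
      qed
      hence "F i = (\<lambda>x. \<Sum>y\<in>?R. y * indicator (?A y) x)" by (rule ext)
      hence "abs_L2 (F i) = (\<Sum>y\<in>?R. y *\<^sub>R abs_L2 (indicator (?A y)))"
        using sumA(2) by (rule trans[OF arg_cong[of _ _ abs_L2] sym])
      also have "\<dots> \<in> closure test_L2"
        using R A fin by (intro closure_test_L2_sum indicator_in_closure) auto
      finally show "abs_L2 (F i) \<in> closure test_L2" .
    qed
  qed
  thus ?thesis by (metis L2_cases UNIV_eq_I)
qed

text \<open>Turns an estimate tested against smooth functions into a norm estimate: by density the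
  test functions may approach \<open>F\<close> itself, which gives |F|^2 <= M |F|.\<close>

lemma norm_le_of_test:
  assumes "0 \<le> M" and "\<And>\<phi>. test_fun \<phi> \<Longrightarrow> F \<bullet> abs_L2 \<phi> \<le> M * norm (abs_L2 \<phi>)"
  shows "norm (F :: 'n::finite L2) \<le> M"
proof -
  obtain X where X: "\<And>n. X n \<in> test_L2" "X \<longlonglongrightarrow> F"
    using closure_test_L2 closure_sequential[of F test_L2] by auto
  have "F \<bullet> F \<le> M * norm F"
  proof (rule LIMSEQ_le)
    show "(\<lambda>n. F \<bullet> X n) \<longlonglongrightarrow> F \<bullet> F" "(\<lambda>n. M * norm (X n)) \<longlonglongrightarrow> M * norm F"
      by (intro tendsto_intros X)+
    show "\<exists>N. \<forall>n\<ge>N. F \<bullet> X n \<le> M * norm (X n)" 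
    proof (intro exI allI impI)
      fix n
      obtain \<phi> where "test_fun \<phi>" "X n = abs_L2 \<phi>" using X(1)[of n] by (auto simp: test_L2_def)
      thus "F \<bullet> X n \<le> M * norm (X n)" using assms(2) by simp
    qed
  qed
  hence "norm F * norm F \<le> M * norm F" by (simp add: dot_square_norm power2_eq_square)
  thus ?thesis using assms(1) by (cases "F = 0") auto
qed

subsection \<open>Translations and strong derivatives\<close>

lemma
  assumes f: "sq_integrable f" and g: "sq_integrable g"
  shows sq_integrable_translate: "sq_integrable (\<lambda>x. f (a + x))"
    and integral_mult_translate: "(\<integral>x. f (a + x) * g (a + x) \<partial>lborel) = (\<integral>x. f x * g x \<partial>lborel)"
proof -
  have D: "distr lborel borel ((+) a) = lborel" by (rule lborel_distr_plus)
  have [measurable]: "f \<in> borel_measurable borel" "g \<in> borel_measurable borel"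
    using f g by (auto simp: sq_integrable_def)
  have "integrable (distr lborel borel ((+) a)) (\<lambda>x. (f x)\<^sup>2)"
    using f by (simp add: D sq_integrable_def)
  hence "integrable lborel (\<lambda>x. (f (a + x))\<^sup>2)" by (subst (asm) integrable_distr_eq) auto
  thus "sq_integrable (\<lambda>x. f (a + x))" by (simp add: sq_integrable_def)
  have "(\<integral>x. f x * g x \<partial>distr lborel borel ((+) a)) = (\<integral>x. f (a + x) * g (a + x) \<partial>lborel)"
    by (rule integral_distr) auto
  thus "(\<integral>x. f (a + x) * g (a + x) \<partial>lborel) = (\<integral>x. f x * g x \<partial>lborel)" by (simp add: D)
qed

lift_definition translate :: "real^'n::finite \<Rightarrow> 'n L2 \<Rightarrow> 'n L2" is "\<lambda>a f x. f (a + x)"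
proof -
  fix a :: "real^'n" and f g :: "real^'n \<Rightarrow> real"
  assume r: "L2_rel f g"
  hence sq: "sq_integrable f" "sq_integrable g" by (auto simp: L2_rel_def)
  hence [measurable]: "f \<in> borel_measurable borel" "g \<in> borel_measurable borel"
    by (auto simp: sq_integrable_def)
  have D: "distr lborel borel ((+) a) = lborel" by (rule lborel_distr_plus)
  have "AE x in distr lborel borel ((+) a). f x = g x"
    unfolding D using r by (simp add: L2_rel_def)
  hence "AE x in lborel. f (a + x) = g (a + x)"
    by (subst (asm) AE_distr_iff) auto
  thus "L2_rel (\<lambda>x. f (a + x)) (\<lambda>x. g (a + x))"
    using sq by (simp add: L2_rel_def sq_integrable_translate)
qed

lemma translate_abs_L2: "sq_integrable f \<Longrightarrow> translate a (abs_L2 f) = abs_L2 (\<lambda>x. f (a + x))"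
  by (simp add: translate.abs_eq)

lemma translate_add: "translate a (F + G) = translate a F + translate a G"
  by (cases F rule: L2_cases, cases G rule: L2_cases)
    (simp add: abs_L2_add translate_abs_L2 sq_integrable_translate sq_integrable_add)

lemma translate_scaleR: "translate a (c *\<^sub>R F) = c *\<^sub>R translate a F"
  by (cases F rule: L2_cases)
    (simp add: abs_L2_scaleR translate_abs_L2 sq_integrable_translate sq_integrable_scale)

lemma translate_translate: "translate a (translate b F) = translate (a + b) F"
  by (cases F rule: L2_cases)
    (simp add: translate_abs_L2 sq_integrable_translate add.assoc add.left_commute)

lemma translate_zero [simp]: "translate 0 F = F"
  by (cases F rule: L2_cases) (simp add: translate_abs_L2)

lemma inner_translate: "translate a F \<bullet> translate a G = F \<bullet> G"
  by (cases F rule: L2_cases, cases G rule: L2_cases)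
    (simp add: translate_abs_L2 inner_abs_L2 sq_integrable_translate integral_mult_translate)

text \<open>Translations are a group of isometries, so the adjoint of a translation is its inverse.
  This takes the place of integration by parts below.\<close>

lemma inner_translate_left: "translate a F \<bullet> G = F \<bullet> translate (- a) G"
  using inner_translate[of a F "translate (- a) G"] by (simp add: translate_translate)

lemma norm_translate [simp]: "norm (translate a F) = norm F"
  by (simp add: norm_eq_sqrt_inner inner_translate)

lemma bounded_linear_translate: "bounded_linear (translate a)"
  by (rule bounded_linear_intro[of _ 1]) (auto simp: translate_add translate_scaleR)

lemma translate_diff: "translate a (F - G) = translate a F - translate a G"
  by (rule linear_diff) (rule bounded_linear.linear[OF bounded_linear_translate])

section \<open>Test functions under translation and along coordinate lines\<close>

lemma smooth_fun_has_derivative: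
  "smooth_fun \<phi> \<Longrightarrow> (iter_partial is \<phi> has_derivative frechet_derivative (iter_partial is \<phi>) (at x)) (at x)"
  by (auto simp: smooth_fun_def frechet_derivative_works[symmetric])

lemma has_derivative_shift:
  assumes "(f has_derivative f') (at (a + x))"
  shows "((\<lambda>x. f (a + x)) has_derivative f') (at x)"
proof -
  have "((\<lambda>x. a + x) has_derivative (\<lambda>h. h)) (at x)" by (auto intro!: derivative_eq_intros)
  from has_derivative_compose[OF this assms] show ?thesis .
qed

lemma iter_partial_translate:
  assumes "smooth_fun \<phi>"
  shows "iter_partial is (\<lambda>x. \<phi> (a + x)) = (\<lambda>x. iter_partial is \<phi> (a + x))"
proof (induction "is")
  case (Cons i js)
  have "partial_deriv i (\<lambda>x. iter_partial js \<phi> (a + x))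
      = (\<lambda>x. frechet_derivative (iter_partial js \<phi>) (at (a + x)) (axis i 1))"
    by (rule partial_deriv_eqI) (intro has_derivative_shift smooth_fun_has_derivative assms)
  thus ?case by (simp add: Cons.IH) (simp add: partial_deriv_def)
qed simp

lemma test_fun_bounded_support:
  assumes "test_fun \<phi>"
  shows "bounded {x. \<phi> x \<noteq> 0}"
  using assms by (intro bounded_subset[OF compact_imp_bounded closure_subset]) (simp add: test_fun_def)

lemma test_fun_translate:
  assumes "test_fun \<phi>"
  shows "test_fun (\<lambda>x. \<phi> (a + x))"
proof -
  have s: "smooth_fun \<phi>" using assms by (simp add: test_fun_def)
  have "smooth_fun (\<lambda>x. \<phi> (a + x))"
    unfolding smooth_fun_def iter_partial_translate[OF s]
    using has_derivative_shift[OF smooth_fun_has_derivative[OF s]] by (auto simp: differentiable_def)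
  moreover have "compact (closure {x. \<phi> (a + x) \<noteq> 0})"
  proof -
    have "bounded {x. \<phi> x \<noteq> 0}" by (rule test_fun_bounded_support[OF assms])
    hence "bounded ((+) (- a) ` {x. \<phi> x \<noteq> 0})" by (rule bounded_translation)
    moreover have "{x. \<phi> (a + x) \<noteq> 0} \<subseteq> (+) (- a) ` {x. \<phi> x \<noteq> 0}"
    proof
      fix x assume "x \<in> {x. \<phi> (a + x) \<noteq> 0}"
      thus "x \<in> (+) (- a) ` {x. \<phi> x \<noteq> 0}" by (intro image_eqI[of _ _ "a + x"]) auto
    qed
    ultimately have "bounded {x. \<phi> (a + x) \<noteq> 0}" by (rule bounded_subset)
    thus ?thesis by simp
  qed
  ultimately show ?thesis by (simp add: test_fun_def)
qed

lemma test_fun_bounded: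
  assumes "test_fun \<phi>"
  obtains M where "0 \<le> M" "\<And>x. \<bar>\<phi> x\<bar> \<le> M"
proof -
  let ?K = "closure {x. \<phi> x \<noteq> 0}"
  have "\<phi> differentiable_on UNIV"
    using assms unfolding test_fun_def smooth_fun_def differentiable_on_def
    by (metis iter_partial.simps(1))
  hence "continuous_on ?K \<phi>"
    by (intro continuous_on_subset[OF differentiable_imp_continuous_on]) auto
  hence "compact (\<phi> ` ?K)" using assms by (intro compact_continuous_image) (auto simp: test_fun_def)
  hence "bounded (\<phi> ` ?K)" by (rule compact_imp_bounded)
  then obtain M where M: "\<And>x. x \<in> ?K \<Longrightarrow> \<bar>\<phi> x\<bar> \<le> M" by (auto simp: bounded_iff)
  have "\<bar>\<phi> x\<bar> \<le> max M 0" for x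
    using M[of x] closure_subset[of "{x. \<phi> x \<noteq> 0}"] by (cases "\<phi> x = 0") force+
  thus ?thesis using that[of "max M 0"] by simp
qed

lemma smooth_fun_line_deriv:
  assumes "smooth_fun \<phi>"
  shows "((\<lambda>s. \<phi> (s *\<^sub>R axis i 1 + x)) has_real_derivative partial_deriv i \<phi> (s *\<^sub>R axis i 1 + x)) (at s)"
proof -
  let ?D = "frechet_derivative \<phi> (at (s *\<^sub>R axis i 1 + x))"
  have D: "(\<phi> has_derivative ?D) (at (s *\<^sub>R axis i 1 + x))"
    using smooth_fun_has_derivative[OF assms, of "[]"] by simp
  have "((\<lambda>s. s *\<^sub>R axis i 1 + x) has_derivative (\<lambda>h. h *\<^sub>R axis i 1)) (at s)"
    by (auto intro!: derivative_eq_intros)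
  from has_derivative_compose[OF this D]
  have "((\<lambda>s. \<phi> (s *\<^sub>R axis i 1 + x)) has_derivative (\<lambda>h. ?D (h *\<^sub>R axis i 1))) (at s)" .
  moreover have "(\<lambda>h. ?D (h *\<^sub>R axis i 1)) = (*) (partial_deriv i \<phi> (s *\<^sub>R axis i 1 + x))"
    using linear_scale[OF has_derivative_linear[OF D]] by (auto simp: partial_deriv_def mult.commute)
  ultimately show ?thesis by (simp add: has_field_derivative_def)
qed

section \<open>Difference quotients and continuity of translations\<close>

definition diff_quot :: "'n::finite \<Rightarrow> real \<Rightarrow> 'n L2 \<Rightarrow> 'n L2" where
  "diff_quot i h F = (1 / h) *\<^sub>R (translate (h *\<^sub>R axis i 1) F - F)"

text \<open>The graph of the generator of the translation group in direction \<open>i\<close>; a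
  relation, because the limit exists only on a dense subspace.\<close>

definition strong_deriv :: "'n::finite \<Rightarrow> 'n L2 \<Rightarrow> 'n L2 \<Rightarrow> bool" where
  "strong_deriv i F G \<longleftrightarrow> ((\<lambda>h. diff_quot i h F) \<longlongrightarrow> G) (at 0)"

lemma strong_deriv_test_fun:
  assumes "test_fun \<phi>"
  shows "strong_deriv i (abs_L2 \<phi>) (abs_L2 (partial_deriv i \<phi>))"
  unfolding strong_deriv_def tendsto_at_iff_sequentially
proof (intro allI impI)
  fix X :: "nat \<Rightarrow> real"
  assume X: "\<forall>k. X k \<in> UNIV - {0}" and lim: "X \<longlonglongrightarrow> 0"
  have s: "smooth_fun \<phi>" using assms by (simp add: test_fun_def)
  have sq: "sq_integrable (\<lambda>x. \<phi> (a + x))" for a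
    by (intro test_fun_sq_integrable test_fun_translate assms)
  have sq0: "sq_integrable \<phi>" using sq[of 0] by simp
  obtain M where M: "0 \<le> M" "\<And>x. \<bar>partial_deriv i \<phi> x\<bar> \<le> M"
    using test_fun_bounded[OF test_fun_iter_partial[OF assms, of "[i]"]] by auto
  obtain r where r: "\<And>k. \<bar>X k\<bar> \<le> r"
    using convergent_imp_bounded[of X] lim by (auto simp: convergent_def bounded_iff)
  have "bounded {x. \<phi> x \<noteq> 0}" by (rule test_fun_bounded_support[OF assms])
  then obtain R where R: "\<And>x. \<phi> x \<noteq> 0 \<Longrightarrow> norm x \<le> R" by (auto simp: bounded_iff)
  let ?q = "\<lambda>k x. (1 / X k) * (\<phi> (X k *\<^sub>R axis i 1 + x) - \<phi> x)"
  \<comment> \<open>Majorant of the quotients: the mean value theorem bounds them by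
    \<open>M\<close>, and outside the ball both values of \<phi> vanish, since \<open>R\<close>
    bounds the support and \<open>r\<close> the steps.\<close>
  let ?g = "\<lambda>x. M * indicator (cball 0 (R + r)) x"
  have "(\<lambda>k. abs_L2 (?q k)) \<longlonglongrightarrow> abs_L2 (partial_deriv i \<phi>)"
  proof (rule abs_L2_dominated_convergence(2))
    show "sq_integrable ?g"
      by (intro sq_integrable_scale sq_integrable_indicator_set emeasure_bounded_finite bounded_cball) auto
    show "?q k \<in> borel_measurable borel" for k
    proof -
      have "(\<lambda>x. \<phi> (X k *\<^sub>R axis i 1 + x)) \<in> borel_measurable borel" "\<phi> \<in> borel_measurable borel"
        using sq[of "X k *\<^sub>R axis i 1"] sq0 unfolding sq_integrable_def by auto
      thus ?thesis by (intro borel_measurable_times borel_measurable_diff borel_measurable_const)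
    qed
    show "\<bar>?q k x\<bar> \<le> ?g x" for k x
    proof (cases "x \<in> cball 0 (R + r)")
      case True
      have "norm (\<phi> (X k *\<^sub>R axis i 1 + x) - \<phi> (0 *\<^sub>R axis i 1 + x)) \<le> M * norm (X k - 0)"
        by (rule field_differentiable_bound[where f = "\<lambda>s. \<phi> (s *\<^sub>R axis i 1 + x)" and S = UNIV])
          (use smooth_fun_line_deriv[OF s] M(2) in auto)
      thus ?thesis using True X by (simp add: abs_mult divide_simps)
    next
      case False
      have "\<bar>X k\<bar> + R < norm x" using False r[of k] by simp
      moreover have "norm x \<le> norm (X k *\<^sub>R axis i 1 + x) + \<bar>X k\<bar>"
        using norm_triangle_ineq4[of "X k *\<^sub>R axis i 1 + x" "X k *\<^sub>R axis i 1"]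
        by simp
      ultimately have "\<phi> (X k *\<^sub>R axis i 1 + x) = 0" "\<phi> x = 0"
        using R[of "X k *\<^sub>R axis i 1 + x"] R[of x] by linarith+
      thus ?thesis using M(1) by simp
    qed
    show "(\<lambda>k. ?q k x) \<longlonglongrightarrow> partial_deriv i \<phi> x" for x
    proof -
      have "((\<lambda>h. (\<phi> (h *\<^sub>R axis i 1 + x) - \<phi> x) / h) \<longlongrightarrow> partial_deriv i \<phi> x) (at 0)"
        using smooth_fun_line_deriv[OF s, of i x 0] by (simp add: DERIV_def)
      moreover have "filterlim X (at 0) sequentially"
        using X lim by (auto simp: filterlim_at)
      ultimately have "(\<lambda>k. (\<phi> (X k *\<^sub>R axis i 1 + x) - \<phi> x) / X k) \<longlonglongrightarrow> partial_deriv i \<phi> x"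
        by (rule filterlim_compose)
      thus ?thesis by simp
    qed
  qed
  moreover have "abs_L2 (?q k) = diff_quot i (X k) (abs_L2 \<phi>)" for k
    by (simp only: diff_quot_def translate_abs_L2 sq0 abs_L2_diff sq abs_L2_scaleR sq_integrable_diff)
  ultimately show "((\<lambda>h. diff_quot i h (abs_L2 \<phi>)) \<circ> X) \<longlonglongrightarrow> abs_L2 (partial_deriv i \<phi>)"
    by (simp add: comp_def)
qed

lemma strong_deriv_continuous:
  assumes "strong_deriv i F G"
  shows "((\<lambda>h. translate (h *\<^sub>R axis i 1) F) \<longlongrightarrow> F) (at 0)"
proof -
  have "((\<lambda>h. F + h *\<^sub>R diff_quot i h F) \<longlongrightarrow> F + 0 *\<^sub>R G) (at 0)"
    using assms unfolding strong_deriv_def by (intro tendsto_intros)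
  moreover have "\<forall>\<^sub>F h in at 0. F + h *\<^sub>R diff_quot i h F = translate (h *\<^sub>R axis i 1) F"
    by (auto simp: diff_quot_def eventually_at_filter)
  ultimately show ?thesis by (auto dest: Lim_transform_eventually)
qed

text \<open>Translations are isometries, so continuity extends from the dense set of test functions
  by a three-epsilon argument.\<close>

lemma translate_continuous:
  "((\<lambda>h. translate (h *\<^sub>R axis i 1) F) \<longlongrightarrow> F) (at 0)"
proof (rule tendstoI)
  fix e :: real assume "0 < e"
  then obtain P where P: "P \<in> test_L2" "dist P F < e / 3"
    using closure_test_L2 closure_approachable[of F test_L2] by (metis UNIV_I divide_pos_pos zero_less_numeral)
  then obtain \<phi> where "test_fun \<phi>" "P = abs_L2 \<phi>" by (auto simp: test_L2_def)
  hence "((\<lambda>h. translate (h *\<^sub>R axis i 1) P) \<longlongrightarrow> P) (at 0)"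
    using strong_deriv_continuous strong_deriv_test_fun by blast
  hence "\<forall>\<^sub>F h in at 0. dist (translate (h *\<^sub>R axis i 1) P) P < e / 3"
    using \<open>0 < e\<close> by (intro tendstoD) auto
  thus "\<forall>\<^sub>F h in at 0. dist (translate (h *\<^sub>R axis i 1) F) F < e"
  proof eventually_elim
    case (elim h)
    have "dist (translate (h *\<^sub>R axis i 1) F) (translate (h *\<^sub>R axis i 1) P) = dist P F"
      by (simp add: dist_norm norm_minus_commute flip: translate_diff)
    thus ?case
      using elim P(2) dist_triangle[of "translate (h *\<^sub>R axis i 1) F" F "translate (h *\<^sub>R axis i 1) P"]
        dist_triangle[of "translate (h *\<^sub>R axis i 1) P" F P] by linarith
  qed
qed

section \<open>Weak derivatives are strong derivatives\<close>

lemma weak_deriv_abs_L2: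
  assumes "sq_integrable f" "sq_integrable g"
  shows "weak_deriv is (abs_L2 f) (abs_L2 g) \<longleftrightarrow>
    (\<forall>\<phi>. test_fun \<phi> \<longrightarrow> abs_L2 f \<bullet> abs_L2 (iter_partial is \<phi>) = (- 1) ^ length is * (abs_L2 g \<bullet> abs_L2 \<phi>))"
  using assms by (simp add: weak_deriv.abs_eq inner_abs_L2 test_fun_sq_integrable test_fun_iter_partial)

lemma weak_deriv_iff_inner:
  "weak_deriv is F G \<longleftrightarrow>
    (\<forall>\<phi>. test_fun \<phi> \<longrightarrow> F \<bullet> abs_L2 (iter_partial is \<phi>) = (- 1) ^ length is * (G \<bullet> abs_L2 \<phi>))"
  by (metis L2_cases weak_deriv_abs_L2)

text \<open>Testing the first-order identity with \<open>iter_partial js \<phi>\<close>, again a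
  test function, peels off one derivative. In this way a second derivative becomes the derivative of
  a first one.\<close>

lemma weak_deriv_Cons:
  assumes "weak_deriv [i] F G" "weak_deriv (i # js) F H"
  shows "weak_deriv js G H"
  unfolding weak_deriv_iff_inner
proof (intro allI impI)
  fix \<phi> :: "real^'a \<Rightarrow> real" assume "test_fun \<phi>"
  thus "G \<bullet> abs_L2 (iter_partial js \<phi>) = (- 1) ^ length js * (H \<bullet> abs_L2 \<phi>)"
    using assms(1)[unfolded weak_deriv_iff_inner, rule_format, of "iter_partial js \<phi>"]
      assms(2)[unfolded weak_deriv_iff_inner, rule_format, of \<phi>] by (simp add: test_fun_iter_partial)
qed

lemma translate_axis_add:
  "translate (s *\<^sub>R axis i 1) (translate (h *\<^sub>R axis i 1) F) = translate ((s + h) *\<^sub>R axis i 1) F"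
  by (simp add: translate_translate scaleR_add_left)

text \<open>Moving the translation by \<open>s\<close> to the factor \<open>K\<close> reduces the
  derivative at \<open>s\<close> to the limit of difference quotients at 0.\<close>

lemma inner_translate_has_derivative:
  assumes "strong_deriv i F G"
  shows "((\<lambda>s. K \<bullet> translate (s *\<^sub>R axis i 1) F) has_real_derivative K \<bullet> translate (s *\<^sub>R axis i 1) G) (at s)"
  unfolding DERIV_def
proof -
  let ?e = "axis i 1"
  have "((\<lambda>h. translate (- (s *\<^sub>R ?e)) K \<bullet> diff_quot i h F) \<longlongrightarrow> translate (- (s *\<^sub>R ?e)) K \<bullet> G) (at 0)"
    using assms unfolding strong_deriv_def by (intro tendsto_intros)
  moreover have "translate (- (s *\<^sub>R ?e)) K \<bullet> diff_quot i h F
      = (K \<bullet> translate ((s + h) *\<^sub>R ?e) F - K \<bullet> translate (s *\<^sub>R ?e) F) / h" for h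
    by (simp add: inner_translate_left diff_quot_def translate_scaleR translate_diff translate_axis_add
        inner_diff_right)
  ultimately show "((\<lambda>h. (K \<bullet> translate ((s + h) *\<^sub>R ?e) F - K \<bullet> translate (s *\<^sub>R ?e) F) / h)
      \<longlongrightarrow> K \<bullet> translate (s *\<^sub>R ?e) G) (at 0)"
    by (simp add: inner_translate_left)
qed

text \<open>The first-order Taylor remainder of the translation orbit is at most e/2 |h|. By duality
  it suffices to test it with \<phi>: there it is an increment of a real function whose derivative
  is controlled by the continuity of s -> \<open>translate (s *\<^sub>R axis i 1) G\<close>.\<close>

lemma weak_deriv_imp_strong_deriv:
  assumes "weak_deriv [i] F G"
  shows "strong_deriv i F G"
  unfolding strong_deriv_def
proof (rule tendstoI)
  let ?\<tau> = "\<lambda>s. translate (s *\<^sub>R axis i 1)"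
  fix e :: real assume e: "0 < e"
  obtain d where d: "0 < d" "\<And>s. \<bar>s\<bar> < d \<Longrightarrow> norm (?\<tau> s G - G) \<le> e / 2"
  proof -
    have "\<forall>\<^sub>F s in at 0. dist (?\<tau> s G) G < e / 2"
      using translate_continuous e by (intro tendstoD) auto
    then obtain d where "0 < d" "\<And>s. s \<noteq> 0 \<Longrightarrow> \<bar>s\<bar> < d \<Longrightarrow> norm (?\<tau> s G - G) < e / 2"
      by (auto simp: eventually_at dist_norm)
    moreover have "norm (?\<tau> 0 G - G) \<le> e / 2" using e by simp
    ultimately show ?thesis by (intro that[of d]) (metis less_imp_le)+
  qed
  have "dist (diff_quot i h F) G < e" if h: "h \<noteq> 0" "\<bar>h\<bar> < d" for h
  proof -
    have "norm (?\<tau> h F - F - h *\<^sub>R G) \<le> e / 2 * \<bar>h\<bar>"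
    proof (rule norm_le_of_test)
      fix \<phi> :: "real^'a \<Rightarrow> real" assume t: "test_fun \<phi>"
      let ?\<Phi> = "abs_L2 \<phi>" and ?\<Phi>' = "abs_L2 (partial_deriv i \<phi>)"
      \<comment> \<open>The weak identity for the translated test function; differentiation commutes
        with translation.\<close>
      have F': "F \<bullet> ?\<tau> s ?\<Phi>' = - (G \<bullet> ?\<tau> s ?\<Phi>)" for s :: real
      proof -
        have "smooth_fun \<phi>" using t by (simp add: test_fun_def)
        note ip = iter_partial_translate[OF this, of "[i]" "s *\<^sub>R axis i 1"]
        have "F \<bullet> abs_L2 (iter_partial [i] (\<lambda>x. \<phi> (s *\<^sub>R axis i 1 + x)))
            = - (G \<bullet> abs_L2 (\<lambda>x. \<phi> (s *\<^sub>R axis i 1 + x)))"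
          using assms t unfolding weak_deriv_iff_inner by (simp add: test_fun_translate)
        thus ?thesis unfolding ip
          using test_fun_sq_integrable[OF t] test_fun_sq_integrable[OF test_fun_iter_partial[OF t, of "[i]"]]
          by (simp add: translate_abs_L2)
      qed
      \<comment> \<open>Its increment from 0 to \<open>h\<close> is the tested remainder. The sign
        in \<open>- s\<close> comes from moving the translation of \<open>F\<close> onto the test
        function.\<close>
      let ?\<psi> = "\<lambda>s. F \<bullet> ?\<tau> (- s) ?\<Phi> - s * (G \<bullet> ?\<Phi>)"
      have D: "(?\<psi> has_real_derivative (?\<tau> s G - G) \<bullet> ?\<Phi>) (at s)" for s
      proof -
        have "((\<lambda>s. F \<bullet> ?\<tau> (- s) ?\<Phi>) has_real_derivative (F \<bullet> ?\<tau> (- s) ?\<Phi>') * (- 1)) (at s)"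
          using inner_translate_has_derivative[OF strong_deriv_test_fun[OF t], of F i "- s"]
          by (rule DERIV_chain2) (auto intro!: derivative_eq_intros)
        hence "(?\<psi> has_real_derivative (F \<bullet> ?\<tau> (- s) ?\<Phi>') * (- 1) - G \<bullet> ?\<Phi>) (at s)"
          by (auto intro!: derivative_eq_intros)
        thus ?thesis unfolding F' by (simp add: inner_translate_left inner_diff_left)
      qed
      have "norm (?\<psi> h - ?\<psi> 0) \<le> e / 2 * norm ?\<Phi> * norm (h - 0)"
      proof (rule field_differentiable_bound[where S = "cball 0 \<bar>h\<bar>"])
        fix s :: real assume "s \<in> cball 0 \<bar>h\<bar>"
        hence "norm (?\<tau> s G - G) \<le> e / 2" using h by (intro d) auto
        thus "norm ((?\<tau> s G - G) \<bullet> ?\<Phi>) \<le> e / 2 * norm ?\<Phi>"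
          using Cauchy_Schwarz_ineq2[of "?\<tau> s G - G" ?\<Phi>] mult_right_mono[OF _ norm_ge_zero[of ?\<Phi>]]
          by (fastforce intro: order_trans)
      qed (use D DERIV_subset in \<open>auto intro: has_field_derivative_at_within\<close>)
      moreover have "?\<psi> h - ?\<psi> 0 = (?\<tau> h F - F - h *\<^sub>R G) \<bullet> ?\<Phi>"
        by (simp add: inner_diff_left inner_translate_left)
      ultimately show "(?\<tau> h F - F - h *\<^sub>R G) \<bullet> ?\<Phi> \<le> e / 2 * \<bar>h\<bar> * norm ?\<Phi>"
        by (simp add: mult_ac)
    qed (use e in auto)
    moreover have "diff_quot i h F - G = (1 / h) *\<^sub>R (?\<tau> h F - F - h *\<^sub>R G)"
      using h by (simp add: diff_quot_def scaleR_diff_right)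
    ultimately have "norm (diff_quot i h F - G) \<le> e / 2"
      using h by (simp add: divide_simps) 
    thus ?thesis using e by (simp add: dist_norm)
  qed
  thus "\<forall>\<^sub>F h in at 0. dist (diff_quot i h F) G < e"
    using d(1) unfolding eventually_at by (auto simp: dist_norm)
qed

section \<open>Operators commuting with translations\<close>

text \<open>These are the bounded Fourier multipliers, characterised by their commutation with
  translations.\<close>

definition translation_invariant :: "('n::finite L2 \<Rightarrow> 'n L2) \<Rightarrow> bool" where
  "translation_invariant B \<longleftrightarrow> bounded_linear B \<and> (\<forall>a F. B (translate a F) = translate a (B F))"

lemma translation_invariant_id: "translation_invariant (\<lambda>F. F)"
  by (simp add: translation_invariant_def)

lemma diff_quot_commute:
  assumes "translation_invariant B"
  shows "B (diff_quot i h F) = diff_quot i h (B F)"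
proof -
  interpret bounded_linear B using assms by (simp add: translation_invariant_def)
  show ?thesis using assms by (simp add: translation_invariant_def diff_quot_def scaleR diff)
qed

lemma translation_invariant_diff_quot:
  assumes "translation_invariant B"
  shows "translation_invariant (\<lambda>F. B (diff_quot i h F))"
proof -
  have "bounded_linear (\<lambda>F. B (diff_quot i h F))"
    using assms unfolding diff_quot_def translation_invariant_def
    by (auto intro!: bounded_linear_intros bounded_linear_compose[of B] bounded_linear_translate)
  moreover have "B (diff_quot i h (translate a F)) = translate a (B (diff_quot i h F))" for a F
    using assms diff_quot_commute[of "translate a" i h F, symmetric]
    by (simp add: translation_invariant_def bounded_linear_translate translate_translate add.commute)
  ultimately show ?thesis by (simp add: translation_invariant_def)
qed

lemma strong_deriv_map:
  assumes "strong_deriv i F G" "translation_invariant B"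
  shows "strong_deriv i (B F) (B G)"
  using assms bounded_linear.tendsto[of B]
  unfolding strong_deriv_def by (simp add: translation_invariant_def flip: diff_quot_commute[OF assms(2)])

text \<open>Integration by parts: the adjoint of the difference quotient with step \<open>h\<close>
  is minus the one with step \<open>-h\<close>, and both sides are limits as \<open>h\<close> tends
  to 0.\<close>

lemma inner_strong_deriv2:
  assumes "strong_deriv i F G" "strong_deriv i G H"
  shows "F \<bullet> H = - (G \<bullet> G)"
proof (rule tendsto_unique[of "at 0"])
  show "((\<lambda>h. F \<bullet> diff_quot i h G) \<longlongrightarrow> F \<bullet> H) (at 0)"
    using assms(2) unfolding strong_deriv_def by (intro tendsto_intros)
  have "filterlim (\<lambda>h::real. - h) (at 0) (at 0)"
    by (auto simp: filterlim_at eventually_at_filter intro!: tendsto_eq_intros)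
  hence "((\<lambda>h. diff_quot i (- h) F) \<longlongrightarrow> G) (at 0)"
    using assms(1) unfolding strong_deriv_def by (rule filterlim_compose[rotated])
  hence "((\<lambda>h. - (diff_quot i (- h) F \<bullet> G)) \<longlongrightarrow> - (G \<bullet> G)) (at 0)"
    by (intro tendsto_intros)
  moreover have "- (diff_quot i (- h) F \<bullet> G) = F \<bullet> diff_quot i h G" for h
    by (simp add: diff_quot_def inner_diff_left inner_diff_right inner_translate_left)
  ultimately show "((\<lambda>h. F \<bullet> diff_quot i h G) \<longlongrightarrow> - (G \<bullet> G)) (at 0)" by simp
qed simp

text \<open>The conclusion has the form of the hypothesis, now for \<open>G\<close> and
  \<open>G'\<close>. Keeping \<open>B\<close> arbitrary therefore allows a second application, which
  reaches the second derivatives.\<close>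

lemma strong_deriv_norm_mono:
  assumes "strong_deriv i F G" "strong_deriv i F' G'"
    and le: "\<And>B. translation_invariant B \<Longrightarrow> norm (B F) \<le> c * norm (B F')"
    and B: "translation_invariant B"
  shows "norm (B G) \<le> c * norm (B G')"
proof (rule tendsto_le)
  show "((\<lambda>h. c * norm (B (diff_quot i h F'))) \<longlongrightarrow> c * norm (B G')) (at 0)"
    using strong_deriv_map[OF assms(2) B] unfolding strong_deriv_def diff_quot_commute[OF B]
    by (intro tendsto_intros)
  show "((\<lambda>h. norm (B (diff_quot i h F))) \<longlongrightarrow> norm (B G)) (at 0)"
    using strong_deriv_map[OF assms(1) B] unfolding strong_deriv_def diff_quot_commute[OF B]
    by (intro tendsto_intros)
  show "\<forall>\<^sub>F h in at 0. norm (B (diff_quot i h F)) \<le> c * norm (B (diff_quot i h F'))"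
    by (intro always_eventually allI le[OF translation_invariant_diff_quot[OF B]])
qed simp

subsection \<open>The heat equation with a linear reaction term in \<open>H\<^sup>2\<close>\<close>

lemma wderiv_strong_deriv:
  shows "strong_deriv i (L2_of f) (wderiv [i] f)"
    and "strong_deriv j (wderiv [i] f) (wderiv [i, j] f)"
  using weak_deriv_Cons[OF weak_deriv_wderiv[of "[i]" f] weak_deriv_wderiv[of "[i, j]" f]]
  by (auto intro!: weak_deriv_imp_strong_deriv weak_deriv_wderiv)

lemma wderiv_add: "length is \<le> 2 \<Longrightarrow> wderiv is (f + g) = wderiv is f + wderiv is g"
  by (intro wderiv_eqI) (simp add: plus_H2.rep_eq weak_deriv_add weak_deriv_wderiv)

lemma wderiv_scaleR: "length is \<le> 2 \<Longrightarrow> wderiv is (c *\<^sub>R f) = c *\<^sub>R wderiv is f"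
  by (intro wderiv_eqI) (simp add: scaleR_H2.rep_eq weak_deriv_scaleR weak_deriv_wderiv)

lemma laplacian_add: "laplacian (f + g) = laplacian f + laplacian g"
  by (simp add: laplacian_def wderiv_add sum.distrib)

lemma laplacian_scaleR: "laplacian (c *\<^sub>R f) = c *\<^sub>R laplacian f"
  by (simp add: laplacian_def wderiv_scaleR scaleR_sum_right)

lemma laplacian_diff: "laplacian (f - g) = laplacian f - laplacian g"
  using laplacian_add[of f "(-1) *\<^sub>R g"] laplacian_scaleR[of "-1" g] by simp

lemma norm_H2_sq: "(norm (f :: 'n::finite H2))\<^sup>2 = (\<Sum>is | length is \<le> 2. (norm (wderiv is f))\<^sup>2)"
  by (simp add: power2_norm_eq_inner inner_H2_def)

lemma finite_multi_indices: "finite {is :: 'n::finite list. length is \<le> 2}"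
  using finite_lists_length_le[of "UNIV :: 'n set" 2] by simp

lemma norm_L2_of_le: "norm (L2_of f) \<le> norm f"
proof -
  have "(norm (wderiv [] f))\<^sup>2 \<le> (norm f)\<^sup>2"
    unfolding norm_H2_sq by (rule member_le_sum) (use finite_multi_indices in auto)
  thus ?thesis unfolding wderiv_Nil by (rule power2_le_imp_le) simp
qed

lemma bounded_linear_L2_of: "bounded_linear L2_of"
  by (rule bounded_linear_intro[of _ 1]) (simp_all add: plus_H2.rep_eq scaleR_H2.rep_eq norm_L2_of_le)

text \<open>The scalar equation to which both the fast and the slow mode reduce, with the same
  notion of solution as for the systems.\<close>

definition heat_solution :: "real \<Rightarrow> (real \<Rightarrow> 'n::finite H2) \<Rightarrow> bool" where
  "heat_solution l w \<longleftrightarrow> continuous_on {0..} w \<and>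
     (\<forall>t>0. ((\<lambda>s. L2_of (w s)) has_vector_derivative laplacian (w t) + l *\<^sub>R L2_of (w t)) (at t))"

text \<open>\<open>B\<close> preserves strong derivatives, so integration by parts turns each
  summand into minus the squared norm of \<open>B (wderiv [i] f)\<close>.\<close>

lemma inner_laplacian_nonpos:
  assumes "translation_invariant B"
  shows "B (L2_of f) \<bullet> B (laplacian f) \<le> 0"
proof -
  interpret bounded_linear B using assms by (simp add: translation_invariant_def)
  have "B (L2_of f) \<bullet> B (wderiv [i, i] f) \<le> 0" for i
    using inner_strong_deriv2[OF wderiv_strong_deriv[THEN strong_deriv_map[OF _ assms]]] by simp
  thus ?thesis by (simp add: laplacian_def sum inner_sum_right sum_nonpos)
qed

text \<open>The weight exp(-2 l s) cancels the reaction term in the derivative of the energy, and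
  what remains is the nonpositive diffusion term.\<close>

lemma heat_solution_decay_L2:
  assumes w: "heat_solution l w" and B: "translation_invariant B" and t: "0 \<le> t"
  shows "norm (B (L2_of (w t))) \<le> exp (l * t) * norm (B (L2_of (w 0)))"
proof -
  have bl: "bounded_linear B" using B by (simp add: translation_invariant_def)
  let ?y = "\<lambda>s. B (L2_of (w s))"
  let ?E = "\<lambda>s. exp (- 2 * l * s) * (?y s \<bullet> ?y s)"
  have "continuous_on {0..t} ?y"
    using w unfolding heat_solution_def
    by (intro bounded_linear.continuous_on[OF bl] bounded_linear.continuous_on[OF bounded_linear_L2_of])
      (auto intro: continuous_on_subset)
  hence cont: "continuous_on {0..t} ?E" by (intro continuous_intros)
  have "?E t \<le> ?E 0"
  \<comment> \<open>The equation holds only at positive times; continuity of the energy covers the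
    endpoint 0.\<close>
  proof (rule DERIV_nonpos_imp_decreasing_open[OF t _ cont])
    fix s assume "0 < s" "s < t"
    let ?y' = "B (laplacian (w s) + l *\<^sub>R L2_of (w s))"
    have "(?y has_vector_derivative ?y') (at s)"
      using w \<open>0 < s\<close> bounded_linear.has_vector_derivative[OF bl] unfolding heat_solution_def by blast
    hence "((\<lambda>s. ?y s \<bullet> ?y s) has_vector_derivative (?y s \<bullet> ?y' + ?y' \<bullet> ?y s)) (at s)"
      by (intro bounded_bilinear.has_vector_derivative[OF bounded_bilinear_inner])
    hence "((\<lambda>s. ?y s \<bullet> ?y s) has_real_derivative 2 * (?y s \<bullet> ?y')) (at s)"
      by (simp add: has_real_derivative_iff_has_vector_derivative inner_commute)
    moreover have "?y s \<bullet> ?y' = ?y s \<bullet> B (laplacian (w s)) + l * (?y s \<bullet> ?y s)"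
      using bounded_linear.linear[OF bl] by (simp add: linear_add linear_scale inner_add_right)
    ultimately have "(?E has_real_derivative exp (- 2 * l * s) * (2 * (?y s \<bullet> B (laplacian (w s))))) (at s)"
      by (auto intro!: derivative_eq_intros simp: algebra_simps)
    thus "\<exists>D. (?E has_real_derivative D) (at s) \<and> D \<le> 0"
      using inner_laplacian_nonpos[OF B, of "w s"]
      by (intro exI[of _ "exp (- 2 * l * s) * (2 * (?y s \<bullet> B (laplacian (w s))))"]) (simp add: mult_le_0_iff)
  qed
  hence "exp (2 * l * t) * ?E t \<le> exp (2 * l * t) * ?E 0" by (intro mult_left_mono) auto
  moreover have "exp (2 * l * t) * ?E t = (norm (?y t))\<^sup>2"
    by (simp add: power2_norm_eq_inner flip: mult.assoc exp_add)
  moreover have "exp (2 * l * t) * ?E 0 = (exp (l * t) * norm (?y 0))\<^sup>2"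
    using exp_double[of "l * t"] by (simp add: mult.assoc power2_norm_eq_inner power_mult_distrib)
  ultimately have "(norm (?y t))\<^sup>2 \<le> (exp (l * t) * norm (?y 0))\<^sup>2" by (simp only:)
  thus ?thesis by (rule power2_le_imp_le) simp
qed

text \<open>A bound that holds after applying every translation-invariant operator is inherited by the strong
  derivatives, because difference quotients are such operators.\<close>

lemma heat_solution_norm_le:
  assumes w: "heat_solution l w" and t: "0 \<le> t"
  shows "norm (w t) \<le> exp (l * t) * norm (w 0)"
proof -
  let ?c = "exp (l * t)"
  have 0: "norm (B (L2_of (w t))) \<le> ?c * norm (B (L2_of (w 0)))" if "translation_invariant B" for B
    by (rule heat_solution_decay_L2[OF w that t])
  have 1: "norm (B (wderiv [i] (w t))) \<le> ?c * norm (B (wderiv [i] (w 0)))" if "translation_invariant B" for B i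
    by (rule strong_deriv_norm_mono[where i = i, OF wderiv_strong_deriv(1) wderiv_strong_deriv(1) _ that])
      (rule 0)
  \<comment> \<open>The operator may be the identity here, while the bound for first derivatives had
    to hold for every \<open>B\<close>: it is now used with difference quotients.\<close>
  have 2: "norm (wderiv [i, j] (w t)) \<le> ?c * norm (wderiv [i, j] (w 0))" for i j
    by (rule strong_deriv_norm_mono[where i = j, OF wderiv_strong_deriv(2) wderiv_strong_deriv(2) _
          translation_invariant_id]) (rule 1)
  have "norm (wderiv is (w t)) \<le> ?c * norm (wderiv is (w 0))" if "length is \<le> 2" for "is"
  proof -
    have "is = [] \<or> (\<exists>i. is = [i]) \<or> (\<exists>i j. is = [i, j])"
      using that by (cases "is"; cases "tl is") auto
    then consider "is = []" | i where "is = [i]" | i j where "is = [i, j]" by blast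
    thus ?thesis
      using 0[OF translation_invariant_id] 1[OF translation_invariant_id] 2
      by cases (auto simp: wderiv_Nil)
  qed
  hence "(norm (w t))\<^sup>2 \<le> (\<Sum>is | length is \<le> 2. (?c * norm (wderiv is (w 0)))\<^sup>2)"
    unfolding norm_H2_sq[of "w t"] by (intro sum_mono power_mono) auto
  also have "\<dots> = (?c * norm (w 0))\<^sup>2"
    by (simp add: power_mult_distrib norm_H2_sq sum_distrib_left)
  finally show ?thesis by (rule power2_le_imp_le) simp
qed

lemma heat_solution_diff:
  assumes "heat_solution l w" "heat_solution l w'"
  shows "heat_solution l (\<lambda>t. w t - w' t)"
  unfolding heat_solution_def
proof (intro conjI allI impI)
  show "continuous_on {0..} (\<lambda>t. w t - w' t)"
    using assms by (auto simp: heat_solution_def intro!: continuous_intros)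
  fix t :: real assume "0 < t"
  hence "((\<lambda>s. L2_of (w s) - L2_of (w' s)) has_vector_derivative
      (laplacian (w t) + l *\<^sub>R L2_of (w t)) - (laplacian (w' t) + l *\<^sub>R L2_of (w' t))) (at t)"
    using assms by (intro has_vector_derivative_diff) (auto simp: heat_solution_def)
  thus "((\<lambda>s. L2_of (w s - w' s)) has_vector_derivative
      laplacian (w t - w' t) + l *\<^sub>R L2_of (w t - w' t)) (at t)"
    by (simp add: minus_H2.rep_eq laplacian_diff algebra_simps)
qed

lemma heat_solution_unique:
  assumes "heat_solution l w" "heat_solution l w'" "w 0 = w' 0" "0 \<le> t"
  shows "w t = w' t"
  using heat_solution_norm_le[OF heat_solution_diff[OF assms(1,2)] assms(4)] assms(3) by simp

text \<open>Shifts the rate. Together with uniqueness this makes solutions with the same datum and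
  different rates scalar multiples of each other.\<close>

lemma heat_solution_exp:
  assumes "heat_solution l w"
  shows "heat_solution (l + c) (\<lambda>t. exp (c * t) *\<^sub>R w t)"
  unfolding heat_solution_def
proof (intro conjI allI impI)
  show "continuous_on {0..} (\<lambda>t. exp (c * t) *\<^sub>R w t)"
    using assms by (auto simp: heat_solution_def intro!: continuous_intros)
  fix t :: real assume "0 < t"
  have "((\<lambda>s. exp (c * s)) has_real_derivative exp (c * t) * c) (at t)"
    by (auto intro!: derivative_eq_intros)
  hence "((\<lambda>s. exp (c * s) *\<^sub>R L2_of (w s)) has_vector_derivative
      exp (c * t) *\<^sub>R (laplacian (w t) + l *\<^sub>R L2_of (w t)) + (exp (c * t) * c) *\<^sub>R L2_of (w t)) (at t)"
    using assms \<open>0 < t\<close> by (intro has_vector_derivative_scaleR) (auto simp: heat_solution_def)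
  thus "((\<lambda>s. L2_of (exp (c * s) *\<^sub>R w s)) has_vector_derivative
      laplacian (exp (c * t) *\<^sub>R w t) + (l + c) *\<^sub>R L2_of (exp (c * t) *\<^sub>R w t)) (at t)"
    by (simp add: scaleR_H2.rep_eq laplacian_scaleR algebra_simps)
qed

subsection \<open>Graphs of scalar multiples\<close>

lemma Ck_on_id: "Ck_on k U (\<lambda>x. x)"
  unfolding Ck_on_def
proof (intro exI ballI conjI allI impI)
  \<comment> \<open>The derivatives of the identity: the point at order 0, the direction at order 1,
    and 0 from order 2 on.\<close>
  let ?D = "\<lambda>hs x. case hs of [] \<Rightarrow> x | [h] \<Rightarrow> h | _ \<Rightarrow> 0"
  fix x :: 'a
  show "?D [] x = x" by simp
  show "bounded_linear (\<lambda>h. ?D (h # hs) x)" for hs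
    by (cases hs) (simp_all add: bounded_linear_ident bounded_linear_zero)
  have diff: "?D hs y - ?D hs x = (if hs = [] then y - x else 0)" for hs y
    by (auto split: list.split)
  show "\<forall>\<^sub>F y in at x within U. \<forall>hs. length hs = j \<and> set hs \<subseteq> cball 0 1 \<longrightarrow>
      norm (?D hs y - ?D hs x - ?D ((y - x) # hs) x) \<le> e * norm (y - x)" if "0 < e" for j and e :: real
    unfolding diff using that by (intro always_eventually allI impI) (auto split: list.split)
  show "\<forall>\<^sub>F y in at x within U. \<forall>hs. length hs = j \<and> set hs \<subseteq> cball 0 1 \<longrightarrow>
      norm (?D hs y - ?D hs x) \<le> e" if "0 < e" for j and e :: real
    unfolding diff eventually_at using that by (intro exI[of _ e]) (auto simp: dist_norm)
qed

text \<open>A complemented subspace is already straight: the identity is a global chart and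
  \<open>P\<close> is the projection.\<close>

lemma Ck_submanifold_range:
  assumes "bounded_linear P" "\<And>x. P (P x) = P x"
  shows "Ck_submanifold k (range P)"
  unfolding Ck_submanifold_def
proof
  fix p :: 'a
  show "\<exists>U (V :: 'a set) \<Phi> \<Psi> Q. open U \<and> open V \<and> p \<in> U \<and> homeomorphism U V \<Phi> \<Psi> \<and> Ck_on k U \<Phi> \<and>
      Ck_on k V \<Psi> \<and> bounded_linear Q \<and> Q \<circ> Q = Q \<and> \<Phi> ` (U \<inter> range P) = V \<inter> range Q"
  proof (intro exI conjI)
    show "homeomorphism UNIV UNIV (\<lambda>x :: 'a. x) (\<lambda>x. x)" by (simp add: homeomorphism_def)
    show "P \<circ> P = P" using assms(2) by auto
  qed (use assms in \<open>auto simp: Ck_on_id\<close>)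
qed

text \<open>The common form of the slow and the critical manifold. Regularity of every order is then
  immediate, and their Hausdorff distance in a ball is controlled by the difference of the
  slopes.\<close>

definition scaling_graph :: "real \<Rightarrow> ('a::real_normed_vector \<times> 'a) set" where
  "scaling_graph a = {(u, v). v = a *\<^sub>R u}"

lemma Ck_submanifold_scaling_graph: "Ck_submanifold k (scaling_graph a)"
proof -
  let ?P = "\<lambda>z :: 'a \<times> 'a. (fst z, a *\<^sub>R fst z)"
  have "range ?P = scaling_graph a" by (auto simp: scaling_graph_def image_iff)
  moreover have "Ck_submanifold k (range ?P)"
    by (intro Ck_submanifold_range bounded_linear_Pair bounded_linear_fst
        bounded_linear_compose[OF bounded_linear_scaleR_right]) auto
  ultimately show ?thesis by simp
qed

section \<open>Hausdorff distance between graphs and distance to a graph\<close>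

lemma hausdorff_dist_le:
  "0 \<le> r \<Longrightarrow> U \<subseteq> V + ball 0 r \<Longrightarrow> V \<subseteq> U + ball 0 r \<Longrightarrow> hausdorff_dist U V \<le> ereal r"
  unfolding hausdorff_dist_def by (intro Inf_lower) auto

lemma hausdorff_dist_nonneg: "0 \<le> hausdorff_dist U V"
  unfolding hausdorff_dist_def by (intro Inf_greatest) auto

text \<open>The point of the other graph over the same \<open>u\<close> may leave the ball, and is then scaled back to
  its boundary; this doubles the error.\<close>

lemma scaling_graph_cball_subset:
  assumes "0 < R" "2 * \<bar>a - b\<bar> * R < r"
  shows "scaling_graph a \<inter> cball 0 R \<subseteq> scaling_graph b \<inter> cball 0 R + ball 0 r"
proof
  fix p :: "'a \<times> 'a" assume p: "p \<in> scaling_graph a \<inter> cball 0 R"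
  obtain u where u: "p = (u, a *\<^sub>R u)" using p by (auto simp: scaling_graph_def)
  let ?q' = "(u, b *\<^sub>R u)"
  define c where "c = (if norm ?q' \<le> R then 1 else R / norm ?q')"
  have "norm u \<le> norm p" using norm_fst_le[of u "a *\<^sub>R u"] by (simp add: u)
  hence "norm u \<le> R" using p by simp
  moreover have "norm (p - ?q') = \<bar>a - b\<bar> * norm u"
    by (simp add: u norm_Pair flip: scaleR_diff_left)
  ultimately have d: "norm (p - ?q') \<le> \<bar>a - b\<bar> * R" by (simp add: mult_left_mono)
  \<comment> \<open>The overshoot beyond the ball is at most the distance already incurred, and
    scaling back costs exactly the overshoot.\<close>
  have q': "norm ?q' \<le> R + \<bar>a - b\<bar> * R"
    using d norm_triangle_ineq2[of ?q' p] p by (simp add: norm_minus_commute)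
  have "norm (?q' - c *\<^sub>R ?q') \<le> \<bar>a - b\<bar> * R"
  proof (cases "norm ?q' \<le> R")
    case True
    thus ?thesis using \<open>0 < R\<close> by (simp add: c_def)
  next
    case False
    hence "c = R / norm ?q'" "norm ?q' > 0" "c < 1" using \<open>0 < R\<close> unfolding c_def by (auto simp del: zero_less_norm_iff)
    moreover have "norm (?q' - c *\<^sub>R ?q') = \<bar>1 - c\<bar> * norm ?q'"
      unfolding norm_scaleR[symmetric] by (simp only: scaleR_diff_left scaleR_one)
    ultimately have "norm (?q' - c *\<^sub>R ?q') = norm ?q' - R" by (simp add: left_diff_distrib)
    thus ?thesis using q' by simp
  qed
  hence "norm (p - c *\<^sub>R ?q') < r"
    using d assms(2) dist_triangle[of p "c *\<^sub>R ?q'" ?q'] unfolding dist_norm by linarith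
  hence "p - c *\<^sub>R ?q' \<in> ball 0 r" by simp
  moreover have "c *\<^sub>R ?q' \<in> scaling_graph b \<inter> cball 0 R"
  proof
    show "c *\<^sub>R ?q' \<in> scaling_graph b" by (simp add: scaling_graph_def)
    have "norm (c *\<^sub>R ?q') \<le> R"
      using \<open>0 < R\<close> unfolding norm_scaleR c_def by (auto simp: abs_mult simp del: zero_less_norm_iff)
    thus "c *\<^sub>R ?q' \<in> cball 0 R" by simp
  qed
  ultimately have "c *\<^sub>R ?q' + (p - c *\<^sub>R ?q') \<in> scaling_graph b \<inter> cball 0 R + ball 0 r"
    by (intro set_plus_intro)
  thus "p \<in> scaling_graph b \<inter> cball 0 R + ball 0 r" by simp
qed

lemma hausdorff_dist_scaling_graph:
  assumes "0 < R" "2 * \<bar>a - b\<bar> * R < r"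
  shows "hausdorff_dist (scaling_graph a \<inter> cball 0 R) (scaling_graph b \<inter> cball 0 R) \<le> ereal r"
proof (rule hausdorff_dist_le)
  have "0 \<le> 2 * \<bar>a - b\<bar> * R" using assms(1) by simp
  thus "0 \<le> r" using assms(2) by linarith
qed (use assms in \<open>simp_all add: scaling_graph_cball_subset abs_minus_commute\<close>)

text \<open>The formula for the distance to a hyperplane, valid over any normed space because the
  product norm is Euclidean in the two component norms: an explicit point gives the upper bound,
  Cauchy-Schwarz in the plane the lower one.\<close>

lemma infdist_kernel:
  fixes u v :: "'a::real_normed_vector"
  assumes "b \<noteq> 0"
  shows "infdist (u, v) {(u, v). a *\<^sub>R u - b *\<^sub>R v = 0} = norm (a *\<^sub>R u - b *\<^sub>R v) / sqrt (a\<^sup>2 + b\<^sup>2)"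
proof (rule antisym)
  let ?S = "{(u :: 'a, v). a *\<^sub>R u - b *\<^sub>R v = 0}"
  let ?w = "a *\<^sub>R u - b *\<^sub>R v" and ?N = "a\<^sup>2 + b\<^sup>2"
  have N: "0 < ?N" using assms by (simp add: sum_power2_gt_zero_iff)
  \<comment> \<open>Foot of the perpendicular: the step goes along the normal direction (a,
    -b).\<close>
  let ?q = "(u - (a / ?N) *\<^sub>R ?w, v + (b / ?N) *\<^sub>R ?w)"
  have "a *\<^sub>R (u - c *\<^sub>R w) - b *\<^sub>R (v + d *\<^sub>R w) = ?w - (a * c + b * d) *\<^sub>R w" for c d w
    by (simp add: algebra_simps)
  moreover have "a * (a / ?N) + b * (b / ?N) = 1"
    using assms by (simp add: power2_eq_square flip: add_divide_distrib)
  ultimately have "?q \<in> ?S" by (simp only: mem_Collect_eq case_prod_conv scaleR_one diff_self)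
  moreover have "dist (u, v) ?q = norm ?w / sqrt ?N"
  proof -
    have "dist (u, v) ?q = sqrt ((a / ?N * norm ?w)\<^sup>2 + (b / ?N * norm ?w)\<^sup>2)"
      by (simp add: dist_norm norm_Pair power_mult_distrib power_divide)
    also have "(a / ?N * norm ?w)\<^sup>2 + (b / ?N * norm ?w)\<^sup>2 = (norm ?w)\<^sup>2 / ?N"
    proof -
      have "(a / M * x)\<^sup>2 + (b / M * x)\<^sup>2 = ?N * x\<^sup>2 / M\<^sup>2" for M x
        by (simp add: power_mult_distrib power_divide distrib_right add_divide_distrib)
      thus ?thesis using N by (simp add: power2_eq_square[of ?N])
    qed
    finally show ?thesis by (simp add: real_sqrt_divide)
  qed
  ultimately show "infdist (u, v) ?S \<le> norm ?w / sqrt ?N" by (metis infdist_le)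
  have "norm ?w / sqrt ?N \<le> dist (u, v) q" if "q \<in> ?S" for q
  proof -
    let ?x = "norm (u - fst q)" and ?y = "norm (v - snd q)"
    have "?w = a *\<^sub>R (u - fst q) - b *\<^sub>R (v - snd q)"
      using that by (auto simp: algebra_simps)
    hence "norm ?w \<le> \<bar>a\<bar> * ?x + \<bar>b\<bar> * ?y"
      using norm_triangle_ineq4[of "a *\<^sub>R (u - fst q)" "b *\<^sub>R (v - snd q)"] by simp
    also have "\<dots> \<le> sqrt (?N * (?x\<^sup>2 + ?y\<^sup>2))"
    proof (rule real_le_rsqrt)
      \<comment> \<open>Expanding this square gives Cauchy-Schwarz for the pairs (|a|, |b|) and (?x,
        ?y).\<close>
      have "0 \<le> (\<bar>a\<bar> * ?y - \<bar>b\<bar> * ?x)\<^sup>2" by simp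
      hence "(\<bar>a\<bar> * ?x + \<bar>b\<bar> * ?y)\<^sup>2 \<le> (\<bar>a\<bar>\<^sup>2 + \<bar>b\<bar>\<^sup>2) * (?x\<^sup>2 + ?y\<^sup>2)"
        by (simp only: power2_diff power2_sum) (simp add: algebra_simps power_mult_distrib)
      thus "(\<bar>a\<bar> * ?x + \<bar>b\<bar> * ?y)\<^sup>2 \<le> ?N * (?x\<^sup>2 + ?y\<^sup>2)" by simp
    qed
    also have "\<dots> = sqrt ?N * dist (u, v) q"
      by (cases q) (simp add: real_sqrt_mult dist_norm norm_Pair)
    finally show ?thesis using N by (simp add: divide_simps mult.commute)
  qed
  \<comment> \<open>\<open>infdist\<close> to the empty set is 0 by convention, so the infimum needs
    a point of the set.\<close>
  moreover have "?S \<noteq> {}" by (auto intro: exI[of _ "0 :: 'a"])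
  ultimately show "norm ?w / sqrt ?N \<le> infdist (u, v) ?S"
    unfolding infdist_def by (auto intro!: cINF_greatest)
qed

subsection \<open>Convergence of the slow manifold\<close>

text \<open>For admissible \<epsilon> the row vector (\<open>C_coeff\<close>, -2 \<beta>) is a left
  eigenvector of the reaction matrix for the fast eigenvalue; its kernel is the slow
  eigenspace.\<close>

definition C_coeff :: "real \<Rightarrow> real \<Rightarrow> real \<Rightarrow> real \<Rightarrow> real \<Rightarrow> real \<Rightarrow> real \<Rightarrow> real" where
  "C_coeff \<alpha> \<beta> \<gamma> \<delta> \<mu> \<nu> \<epsilon> = \<epsilon> * (\<delta> - \<nu> + \<mu>) - \<alpha> - \<epsilon> * Omega \<alpha> \<beta> \<gamma> \<delta> \<mu> \<nu> \<epsilon>"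

lemma C_minus_alt:
  "C_minus \<alpha> \<beta> \<gamma> \<delta> \<mu> \<nu> \<epsilon> = {(u, v). C_coeff \<alpha> \<beta> \<gamma> \<delta> \<mu> \<nu> \<epsilon> *\<^sub>R u - (2 * \<beta>) *\<^sub>R v = 0}"
  by (simp add: C_minus_def C_coeff_def)

lemma C_coeff_tendsto: "(C_coeff \<alpha> \<beta> \<gamma> \<delta> \<mu> \<nu> \<longlongrightarrow> - 2 * \<alpha>) (at_right 0)"
  unfolding C_coeff_def[abs_def] by (rule coefficient_tendsto)

lemma scaleR_eq_iff_divide:
  fixes u v :: "'a::real_vector"
  assumes "b \<noteq> 0"
  shows "a *\<^sub>R u - b *\<^sub>R v = 0 \<longleftrightarrow> v = (a / b) *\<^sub>R u"
proof
  assume "a *\<^sub>R u - b *\<^sub>R v = 0"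
  hence "(1 / b) *\<^sub>R (a *\<^sub>R u) = (1 / b) *\<^sub>R (b *\<^sub>R v)" by simp
  thus "v = (a / b) *\<^sub>R u" using assms by simp
qed (use assms in simp)

lemma C_minus_eq_scaling_graph:
  "\<beta> \<noteq> 0 \<Longrightarrow> C_minus \<alpha> \<beta> \<gamma> \<delta> \<mu> \<nu> \<epsilon> = scaling_graph (C_coeff \<alpha> \<beta> \<gamma> \<delta> \<mu> \<nu> \<epsilon> / (2 * \<beta>))"
  unfolding C_minus_alt scaling_graph_def by (subst scaleR_eq_iff_divide) auto

lemma critical_manifold_eq_scaling_graph:
  "\<beta> \<noteq> 0 \<Longrightarrow> critical_manifold \<alpha> \<beta> = scaling_graph (- \<alpha> / \<beta>)"
  using scaleR_eq_iff_divide[of "- \<beta>" \<alpha>] by (auto simp: critical_manifold_def scaling_graph_def)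

text \<open>The roots of this quadratic are, up to the factor \<open>2 \<beta>\<close>, the slopes of the two eigenlines of the
  reaction matrix.\<close>

lemma C_coeff_quadratic:
  assumes "\<alpha> \<noteq> 0" "0 < \<epsilon>" "0 \<le> discriminant \<alpha> \<beta> \<gamma> \<delta> \<mu> \<nu> \<epsilon>" and m: "m = C_coeff \<alpha> \<beta> \<gamma> \<delta> \<mu> \<nu> \<epsilon>"
  shows "m\<^sup>2 = 2 * m * (\<epsilon> * (\<delta> - \<nu> + \<mu>) - \<alpha>) + 4 * \<beta> * \<gamma> * \<epsilon>"
proof -
  let ?p = "\<epsilon> * (\<delta> - \<nu> + \<mu>) - \<alpha>" and ?d = "discriminant \<alpha> \<beta> \<gamma> \<delta> \<mu> \<nu> \<epsilon>"
  have s: "(sgn \<alpha>)\<^sup>2 = 1" using assms(1) by (simp add: sgn_if)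
  \<comment> \<open>Squaring removes the sign of the root, so both branches of \<open>Omega\<close>
    obey the same quadratic.\<close>
  have "(m - ?p)\<^sup>2 = \<epsilon>\<^sup>2 * ?d"
    using assms(3) s by (simp add: m C_coeff_def Omega_def power_mult_distrib)
  also have "\<dots> = ?p\<^sup>2 + 4 * \<beta> * \<gamma> * \<epsilon>"
    using assms(2) by (simp add: discriminant_def power2_eq_square field_simps)
  finally show ?thesis by (simp add: power2_diff)
qed

text \<open>The limit |\<alpha>| of \<epsilon> times the root is positive, and \<open>sqrt\<close>,
  being odd, is positive only at positive arguments.\<close>

lemma eventually_discriminant_pos:
  assumes "\<alpha> \<noteq> 0"
  shows "\<forall>\<^sub>F \<epsilon> in at_right 0. 0 < discriminant \<alpha> \<beta> \<gamma> \<delta> \<mu> \<nu> \<epsilon>"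
proof -
  have "\<forall>\<^sub>F \<epsilon> in at_right 0. 0 < \<epsilon> * sqrt (discriminant \<alpha> \<beta> \<gamma> \<delta> \<mu> \<nu> \<epsilon>)"
    using assms by (intro order_tendstoD(1)[OF eps_sqrt_discriminant_tendsto]) simp
  thus ?thesis using eventually_at_right_less[of 0]
    by eventually_elim (simp add: zero_less_mult_iff)
qed

text \<open>The quadratic reads m (m + 2 \<alpha>) = \<epsilon> (2 m k + 4 \<beta> \<gamma>) with k
  = \<delta> - \<nu> + \<mu>. Near 0 the factor m is bounded and bounded away from 0, so m + 2
  \<alpha> is of order \<epsilon>.\<close>

lemma C_coeff_linear_rate:
  assumes "\<alpha> < 0"
  shows "\<exists>K. \<forall>\<^sub>F \<epsilon> in at_right 0. \<bar>C_coeff \<alpha> \<beta> \<gamma> \<delta> \<mu> \<nu> \<epsilon> + 2 * \<alpha>\<bar> \<le> K * \<epsilon>"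
proof -
  let ?k = "\<delta> - \<nu> + \<mu>" and ?m = "C_coeff \<alpha> \<beta> \<gamma> \<delta> \<mu> \<nu>"
  \<comment> \<open>The numerator uses the bound m < 4 |\<alpha>|, the denominator m > |\<alpha>|;
    both hold near 0 because m tends to 2 |\<alpha>|.\<close>
  define K where "K = (4 * \<bar>\<alpha>\<bar> * (2 * \<bar>?k\<bar>) + 4 * \<bar>\<beta> * \<gamma>\<bar>) / \<bar>\<alpha>\<bar>"
  have nz: "\<alpha> \<noteq> 0" using assms by simp
  have lim: "(?m \<longlongrightarrow> - 2 * \<alpha>) (at_right 0)" by (rule C_coeff_tendsto)
  have "\<forall>\<^sub>F \<epsilon> in at_right 0. - \<alpha> < ?m \<epsilon>" "\<forall>\<^sub>F \<epsilon> in at_right 0. ?m \<epsilon> < - 4 * \<alpha>"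
    using assms by (intro order_tendstoD[OF lim]; simp)+
  hence "\<forall>\<^sub>F \<epsilon> in at_right 0. \<bar>?m \<epsilon> + 2 * \<alpha>\<bar> \<le> K * \<epsilon>"
    using eventually_discriminant_pos[OF nz, of \<beta> \<gamma> \<delta> \<mu> \<nu>] eventually_at_right_less[of 0]
  proof eventually_elim
    case (elim \<epsilon>)
    let ?r = "?m \<epsilon>"
    have "?r * (?r + 2 * \<alpha>) = \<epsilon> * (2 * ?r * ?k + 4 * (\<beta> * \<gamma>))"
      using C_coeff_quadratic[of \<alpha> \<epsilon> \<beta> \<gamma> \<delta> \<mu> \<nu> ?r] elim assms by (simp add: power2_eq_square algebra_simps)
    hence "\<bar>?r * (?r + 2 * \<alpha>)\<bar> = \<bar>\<epsilon> * (2 * ?r * ?k + 4 * (\<beta> * \<gamma>))\<bar>" by (simp only:)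
    hence "?r * \<bar>?r + 2 * \<alpha>\<bar> = \<epsilon> * \<bar>2 * ?r * ?k + 4 * (\<beta> * \<gamma>)\<bar>"
      unfolding abs_mult[of ?r] abs_mult[of \<epsilon>] using elim assms by simp
    also have "\<dots> \<le> \<epsilon> * (\<bar>2 * ?r * ?k\<bar> + 4 * \<bar>\<beta> * \<gamma>\<bar>)"
      using elim abs_triangle_ineq[of "2 * ?r * ?k" "4 * (\<beta> * \<gamma>)"] by (intro mult_left_mono) (auto simp: abs_mult)
    also have "\<bar>2 * ?r * ?k\<bar> \<le> 4 * \<bar>\<alpha>\<bar> * (2 * \<bar>?k\<bar>)"
    proof -
      have "?r * (2 * \<bar>?k\<bar>) \<le> 4 * \<bar>\<alpha>\<bar> * (2 * \<bar>?k\<bar>)"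
        using elim assms by (intro mult_right_mono) auto
      thus ?thesis using elim assms by (simp add: abs_mult)
    qed
    finally have "?r * \<bar>?r + 2 * \<alpha>\<bar> \<le> \<epsilon> * (4 * \<bar>\<alpha>\<bar> * (2 * \<bar>?k\<bar>) + 4 * \<bar>\<beta> * \<gamma>\<bar>)"
      using elim by (simp add: mult_left_mono)
    moreover have "\<bar>\<alpha>\<bar> * \<bar>?r + 2 * \<alpha>\<bar> \<le> ?r * \<bar>?r + 2 * \<alpha>\<bar>"
      using elim assms by (intro mult_right_mono) auto
    ultimately have "\<bar>\<alpha>\<bar> * \<bar>?r + 2 * \<alpha>\<bar> \<le> \<epsilon> * (4 * \<bar>\<alpha>\<bar> * (2 * \<bar>?k\<bar>) + 4 * \<bar>\<beta> * \<gamma>\<bar>)" by linarith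
    hence "\<bar>?r + 2 * \<alpha>\<bar> \<le> \<epsilon> * (4 * \<bar>\<alpha>\<bar> * (2 * \<bar>?k\<bar>) + 4 * \<bar>\<beta> * \<gamma>\<bar>) / \<bar>\<alpha>\<bar>"
      using assms by (subst pos_le_divide_eq) (auto simp: mult.commute)
    thus ?case by (simp add: K_def mult.commute)
  qed
  thus ?thesis ..
qed

lemma hausdorff_dist_C_minus:
  assumes "\<alpha> < 0" "\<beta> \<noteq> 0" "0 < R"
  shows "\<exists>K. \<forall>\<^sub>F \<epsilon> in at_right 0.
    hausdorff_dist (C_minus \<alpha> \<beta> \<gamma> \<delta> \<mu> \<nu> \<epsilon> \<inter> cball 0 R) (critical_manifold \<alpha> \<beta> \<inter> cball 0 R) \<le> ereal (K * \<epsilon>)"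
proof -
  obtain K where K: "\<forall>\<^sub>F \<epsilon> in at_right 0. \<bar>C_coeff \<alpha> \<beta> \<gamma> \<delta> \<mu> \<nu> \<epsilon> + 2 * \<alpha>\<bar> \<le> K * \<epsilon>"
    using C_coeff_linear_rate[OF assms(1)] by blast
  \<comment> \<open>The summand 1 gives the strict inequality that the open balls in the Hausdorff
    distance require.\<close>
  let ?K = "K * R / \<bar>\<beta>\<bar> + 1"
  have "\<forall>\<^sub>F \<epsilon> in at_right 0.
      hausdorff_dist (C_minus \<alpha> \<beta> \<gamma> \<delta> \<mu> \<nu> \<epsilon> \<inter> cball 0 R) (critical_manifold \<alpha> \<beta> \<inter> cball 0 R) \<le> ereal (?K * \<epsilon>)"
    using K eventually_at_right_less[of 0]
  proof eventually_elim
    case (elim \<epsilon>)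
    let ?m = "C_coeff \<alpha> \<beta> \<gamma> \<delta> \<mu> \<nu> \<epsilon>"
    have "?m / (2 * \<beta>) - - \<alpha> / \<beta> = (?m + 2 * \<alpha>) / (2 * \<beta>)"
      using assms(2) by (simp add: field_simps)
    hence "2 * \<bar>?m / (2 * \<beta>) - - \<alpha> / \<beta>\<bar> * R = \<bar>?m + 2 * \<alpha>\<bar> * (R / \<bar>\<beta>\<bar>)"
      by (simp add: abs_mult)
    also have "\<dots> \<le> K * \<epsilon> * (R / \<bar>\<beta>\<bar>)"
      using elim assms(3) by (intro mult_right_mono) auto
    also have "\<dots> < ?K * \<epsilon>" using elim by (simp add: algebra_simps)
    finally show ?case
      unfolding C_minus_eq_scaling_graph[OF assms(2)] critical_manifold_eq_scaling_graph[OF assms(2)]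
      by (intro hausdorff_dist_scaling_graph assms(3))
  qed
  thus ?thesis ..
qed

lemma converges_on_bounded_C_minus:
  assumes "\<alpha> < 0" "\<beta> \<noteq> 0"
  shows "converges_on_bounded (C_minus \<alpha> \<beta> \<gamma> \<delta> \<mu> \<nu>) (critical_manifold \<alpha> \<beta> :: ('n::finite) state set)"
  unfolding converges_on_bounded_def
proof (intro allI impI)
  fix R :: real assume "0 < R"
  from hausdorff_dist_C_minus[OF assms this, of \<gamma> \<delta> \<mu> \<nu>, where 'a = 'n] obtain K where
    K: "\<forall>\<^sub>F \<epsilon> in at_right 0. hausdorff_dist (C_minus \<alpha> \<beta> \<gamma> \<delta> \<mu> \<nu> \<epsilon> \<inter> cball 0 R)
      (critical_manifold \<alpha> \<beta> \<inter> cball 0 R :: 'n state set) \<le> ereal (K * \<epsilon>)" by blast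
  have "((\<lambda>\<epsilon>. K * \<epsilon>) \<longlongrightarrow> K * 0) (at_right 0)" by (intro tendsto_intros)
  hence lim: "((\<lambda>\<epsilon>. ereal (K * \<epsilon>)) \<longlongrightarrow> 0) (at_right 0)" by (simp add: zero_ereal_def)
  show "((\<lambda>\<epsilon>. hausdorff_dist (C_minus \<alpha> \<beta> \<gamma> \<delta> \<mu> \<nu> \<epsilon> \<inter> cball 0 R)
      (critical_manifold \<alpha> \<beta> \<inter> cball 0 R :: 'n state set)) \<longlongrightarrow> 0) (at_right 0)"
    by (rule tendsto_sandwich[OF _ K tendsto_const lim]) (simp add: hausdorff_dist_nonneg)
qed

section \<open>Decoupling into fast and slow modes\<close>

text \<open>Both components diffuse equally, so a left eigenvector of the reaction matrix yields a
  combination with a closed scalar equation.\<close>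

lemma fast_reaction_fast_mode:
  assumes z: "fast_reaction_solution \<alpha> \<beta> \<gamma> \<delta> \<mu> \<nu> \<epsilon> z" and "0 < \<epsilon>"
    and m: "m\<^sup>2 = 2 * m * (\<epsilon> * (\<delta> - \<nu> + \<mu>) - \<alpha>) + 4 * \<beta> * \<gamma> * \<epsilon>"
  shows "heat_solution (\<delta> - \<nu> - m / (2 * \<epsilon>)) (\<lambda>t. m *\<^sub>R fst (z t) - (2 * \<beta>) *\<^sub>R snd (z t))"
  unfolding heat_solution_def
proof (intro conjI allI impI)
  let ?l = "\<delta> - \<nu> - m / (2 * \<epsilon>)"
  show "continuous_on {0..} (\<lambda>t. m *\<^sub>R fst (z t) - (2 * \<beta>) *\<^sub>R snd (z t))"
    using z by (auto simp: fast_reaction_solution_def intro!: continuous_intros)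
  fix t :: real assume "0 < t"
  define U V LU LV where UV: "U = L2_of (fst (z t))" "V = L2_of (snd (z t))"
    "LU = laplacian (fst (z t))" "LV = laplacian (snd (z t))"
  obtain u' v' where d: "((\<lambda>s. L2_of (fst (z s))) has_vector_derivative u') (at t)"
      "((\<lambda>s. L2_of (snd (z s))) has_vector_derivative v') (at t)"
    and u: "\<epsilon> *\<^sub>R u' = \<epsilon> *\<^sub>R (LU - \<mu> *\<^sub>R U) + \<alpha> *\<^sub>R U + \<beta> *\<^sub>R V"
    and v: "v' = (LV - \<nu> *\<^sub>R V) + \<gamma> *\<^sub>R U + \<delta> *\<^sub>R V"
    using z \<open>0 < t\<close> unfolding fast_reaction_solution_def UV by blast
  have "(1 / \<epsilon>) *\<^sub>R (\<epsilon> *\<^sub>R u') = (1 / \<epsilon>) *\<^sub>R (\<epsilon> *\<^sub>R (LU - \<mu> *\<^sub>R U) + \<alpha> *\<^sub>R U + \<beta> *\<^sub>R V)" by (simp only: u)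
  hence u'': "u' = LU - \<mu> *\<^sub>R U + (\<alpha> / \<epsilon>) *\<^sub>R U + (\<beta> / \<epsilon>) *\<^sub>R V"
    using \<open>0 < \<epsilon>\<close> by (simp add: scaleR_add_right)
  \<comment> \<open>The coefficient of \<open>U\<close> is where the quadratic for \<open>m\<close>
    enters, after multiplication by 2 \<epsilon>.\<close>
  have c1: "m * (\<alpha> / \<epsilon> - \<mu>) - 2 * \<beta> * \<gamma> = ?l * m"
  proof -
    have "2 * \<epsilon> * (m * (\<alpha> / \<epsilon> - \<mu>) - 2 * \<beta> * \<gamma>) = 2 * m * \<alpha> - 2 * \<epsilon> * m * \<mu> - 4 * \<epsilon> * \<beta> * \<gamma>"
      using \<open>0 < \<epsilon>\<close> by (simp add: algebra_simps)
    moreover have "2 * \<epsilon> * (?l * m) = 2 * \<epsilon> * (\<delta> - \<nu>) * m - m\<^sup>2"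
      using \<open>0 < \<epsilon>\<close> by (simp add: algebra_simps power2_eq_square)
    ultimately have "2 * \<epsilon> * (m * (\<alpha> / \<epsilon> - \<mu>) - 2 * \<beta> * \<gamma>) = 2 * \<epsilon> * (?l * m)"
      using m by (simp add: algebra_simps)
    thus ?thesis using \<open>0 < \<epsilon>\<close> by simp
  qed
  \<comment> \<open>The coefficient of \<open>V\<close> fixes the eigenvalue.\<close>
  have c2: "m * (\<beta> / \<epsilon>) - 2 * \<beta> * (\<delta> - \<nu>) = - (?l * (2 * \<beta>))"
    using \<open>0 < \<epsilon>\<close> by (simp add: field_simps)
  have "((\<lambda>s. m *\<^sub>R L2_of (fst (z s)) - (2 * \<beta>) *\<^sub>R L2_of (snd (z s))) has_vector_derivative
      m *\<^sub>R u' - (2 * \<beta>) *\<^sub>R v') (at t)"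
    using d by (intro has_vector_derivative_diff bounded_linear.has_vector_derivative[OF bounded_linear_scaleR_right])
  moreover have "m *\<^sub>R u' - (2 * \<beta>) *\<^sub>R v' = m *\<^sub>R LU - (2 * \<beta>) *\<^sub>R LV
      + (m * (\<alpha> / \<epsilon> - \<mu>) - 2 * \<beta> * \<gamma>) *\<^sub>R U + (m * (\<beta> / \<epsilon>) - 2 * \<beta> * (\<delta> - \<nu>)) *\<^sub>R V"
    unfolding u'' v by (simp add: algebra_simps)
  moreover have "\<dots> = laplacian (m *\<^sub>R fst (z t) - (2 * \<beta>) *\<^sub>R snd (z t))
      + ?l *\<^sub>R L2_of (m *\<^sub>R fst (z t) - (2 * \<beta>) *\<^sub>R snd (z t))"
    unfolding c1 c2 by (simp add: laplacian_diff laplacian_scaleR minus_H2.rep_eq scaleR_H2.rep_eq UV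
        scaleR_diff_right)
  ultimately show "((\<lambda>s. L2_of (m *\<^sub>R fst (z s) - (2 * \<beta>) *\<^sub>R snd (z s))) has_vector_derivative
      laplacian (m *\<^sub>R fst (z t) - (2 * \<beta>) *\<^sub>R snd (z t))
      + ?l *\<^sub>R L2_of (m *\<^sub>R fst (z t) - (2 * \<beta>) *\<^sub>R snd (z t))) (at t)"
    by (simp add: minus_H2.rep_eq scaleR_H2.rep_eq)
qed

text \<open>On a graph \<open>u = k v\<close> the equation for \<open>v\<close> decouples.\<close>

lemma slow_mode:
  assumes "continuous_on {0..} z" "\<And>t. 0 < t \<Longrightarrow> fst (z t) = k *\<^sub>R snd (z t)"
    and "\<And>t. 0 < t \<Longrightarrow> ((\<lambda>s. L2_of (snd (z s))) has_vector_derivative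
        (laplacian (snd (z t)) - \<nu> *\<^sub>R L2_of (snd (z t))) + \<gamma> *\<^sub>R L2_of (fst (z t)) + \<delta> *\<^sub>R L2_of (snd (z t))) (at t)"
  shows "heat_solution (\<delta> - \<nu> + \<gamma> * k) (\<lambda>t. snd (z t))"
  unfolding heat_solution_def
proof (intro conjI allI impI)
  show "continuous_on {0..} (\<lambda>t. snd (z t))" using assms(1) by (intro continuous_intros)
  fix t :: real assume "0 < t"
  thus "((\<lambda>s. L2_of (snd (z s))) has_vector_derivative
      laplacian (snd (z t)) + (\<delta> - \<nu> + \<gamma> * k) *\<^sub>R L2_of (snd (z t))) (at t)"
    using assms(3)[of t] assms(2)[of t] by (simp add: scaleR_H2.rep_eq algebra_simps)
qed

lemma limit_slow_mode:
  assumes "limit_solution \<alpha> \<beta> \<gamma> \<delta> \<nu> z" "\<alpha> \<noteq> 0"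
  shows "heat_solution (\<delta> - \<nu> + \<gamma> * (- \<beta> / \<alpha>)) (\<lambda>t. snd (z t))"
    and "0 \<le> t \<Longrightarrow> fst (z t) = (- \<beta> / \<alpha>) *\<^sub>R snd (z t)"
proof -
  have *: "fst (z t) = (- \<beta> / \<alpha>) *\<^sub>R snd (z t)" if "0 \<le> t" for t
    using assms that scaleR_eq_iff_divide[of \<alpha> "- \<beta>" "snd (z t)" "fst (z t)"]
    by (auto simp: limit_solution_def add_eq_0_iff)
  thus "0 \<le> t \<Longrightarrow> fst (z t) = (- \<beta> / \<alpha>) *\<^sub>R snd (z t)" .
  show "heat_solution (\<delta> - \<nu> + \<gamma> * (- \<beta> / \<alpha>)) (\<lambda>t. snd (z t))"
    using assms(1) by (intro slow_mode *) (auto simp: limit_solution_def)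
qed

lemma fast_reaction_slow_mode:
  assumes z: "fast_reaction_solution \<alpha> \<beta> \<gamma> \<delta> \<mu> \<nu> \<epsilon> z"
    and "\<And>t. 0 \<le> t \<Longrightarrow> fst (z t) = k *\<^sub>R snd (z t)"
  shows "heat_solution (\<delta> - \<nu> + \<gamma> * k) (\<lambda>t. snd (z t))"
  using assms by (intro slow_mode) (auto simp: fast_reaction_solution_def)

text \<open>By uniqueness v(t) = exp((a - b) t) w(t), so the difference is a scalar multiple of w(t)
  and the Laplacian no longer appears.\<close>

lemma heat_solution_compare:
  assumes v: "heat_solution a v" and w: "heat_solution b w" and "v 0 = w 0"
    and t: "0 \<le> t" "t \<le> \<tau>"
  shows "norm (v t - w t) \<le> (exp (\<bar>a - b\<bar> * \<tau>) - 1) * (exp (\<bar>b\<bar> * \<tau>) * norm (w 0))"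
    and "norm (w t) \<le> exp (\<bar>b\<bar> * \<tau>) * norm (w 0)"
proof -
  have mono: "c * t \<le> \<bar>c\<bar> * \<tau>" for c
    using mult_right_mono[OF abs_ge_self t(1), of c] mult_left_mono[OF t(2) abs_ge_zero, of c] by linarith
  have "norm (w t) \<le> exp (b * t) * norm (w 0)" by (rule heat_solution_norm_le[OF w t(1)])
  also have "\<dots> \<le> exp (\<bar>b\<bar> * \<tau>) * norm (w 0)"
    using mono[of b] by (intro mult_right_mono) simp_all
  finally show w': "norm (w t) \<le> exp (\<bar>b\<bar> * \<tau>) * norm (w 0)" .
  have "heat_solution (b + (a - b)) (\<lambda>t. exp ((a - b) * t) *\<^sub>R w t)" by (rule heat_solution_exp[OF w])
  moreover have "b + (a - b) = a" by simp
  ultimately have w_exp: "heat_solution a (\<lambda>t. exp ((a - b) * t) *\<^sub>R w t)" by (simp only:)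
  have "v t = exp ((a - b) * t) *\<^sub>R w t"
    by (rule heat_solution_unique[OF v w_exp _ t(1)]) (simp add: assms(3))
  hence "v t - w t = (exp ((a - b) * t) - 1) *\<^sub>R w t" by (simp add: scaleR_diff_left)
  hence "norm (v t - w t) = \<bar>exp ((a - b) * t) - 1\<bar> * norm (w t)" by simp
  also have "\<dots> \<le> (exp (\<bar>a - b\<bar> * \<tau>) - 1) * (exp (\<bar>b\<bar> * \<tau>) * norm (w 0))"
  proof (intro mult_mono w')
    have "exp ((a - b) * t) \<le> exp (\<bar>a - b\<bar> * \<tau>)" using mono[of "a - b"] by simp
    \<comment> \<open>The two exponents have a nonnegative sum, so by exp x >= 1 + x their
      exponentials add up to at least 2.\<close>
    moreover have "1 - exp (\<bar>a - b\<bar> * \<tau>) \<le> exp ((a - b) * t) - 1"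
    proof -
      have "(a - b) * t \<ge> - (\<bar>a - b\<bar> * \<tau>)" using mono[of "b - a"] by (simp add: abs_minus_commute algebra_simps)
      thus ?thesis
        using exp_ge_add_one_self[of "(a - b) * t"] exp_ge_add_one_self[of "\<bar>a - b\<bar> * \<tau>"] by linarith
    qed
    ultimately show "\<bar>exp ((a - b) * t) - 1\<bar> \<le> exp (\<bar>a - b\<bar> * \<tau>) - 1" by linarith
    show "0 \<le> exp (\<bar>a - b\<bar> * \<tau>) - 1" using t by simp
  qed simp
  finally show "norm (v t - w t) \<le> (exp (\<bar>a - b\<bar> * \<tau>) - 1) * (exp (\<bar>b\<bar> * \<tau>) * norm (w 0))" .
qed

subsection \<open>Semiflows\<close>

lemma solution_semiflowD:
  assumes "solution_semiflow X sol T" "z \<in> X"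
  shows "T 0 z = z" and "sol (\<lambda>t. T t z)"
  using assms by (auto simp only: solution_semiflow_def)

lemma fast_mode_decay:
  assumes T: "solution_semiflow UNIV (fast_reaction_solution \<alpha> \<beta> \<gamma> \<delta> \<mu> \<nu> \<epsilon>) T"
    and "\<alpha> \<noteq> 0" "0 < \<epsilon>" "0 \<le> discriminant \<alpha> \<beta> \<gamma> \<delta> \<mu> \<nu> \<epsilon>" "0 \<le> t"
    and m: "m = C_coeff \<alpha> \<beta> \<gamma> \<delta> \<mu> \<nu> \<epsilon>"
  shows "norm (m *\<^sub>R fst (T t z) - (2 * \<beta>) *\<^sub>R snd (T t z))
    \<le> exp ((\<delta> - \<nu> - m / (2 * \<epsilon>)) * t) * norm (m *\<^sub>R fst z - (2 * \<beta>) *\<^sub>R snd z)"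
proof -
  have "T 0 z = z" "fast_reaction_solution \<alpha> \<beta> \<gamma> \<delta> \<mu> \<nu> \<epsilon> (\<lambda>t. T t z)"
    using solution_semiflowD[OF T] by simp_all
  thus ?thesis
    using heat_solution_norm_le[OF fast_reaction_fast_mode[OF _ assms(3) C_coeff_quadratic[OF assms(2-4) m]] assms(5),
        of "\<lambda>t. T t z"] by simp
qed

text \<open>At fixed \<epsilon> the distance is a constant multiple of the norm of the fast mode.
  Decay of that mode is therefore attraction, and the constant cancels on both sides.\<close>

lemma infdist_C_minus:
  assumes "\<beta> \<noteq> 0" and m: "m = C_coeff \<alpha> \<beta> \<gamma> \<delta> \<mu> \<nu> \<epsilon>"
  shows "infdist z (C_minus \<alpha> \<beta> \<gamma> \<delta> \<mu> \<nu> \<epsilon>)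
    = norm (m *\<^sub>R fst z - (2 * \<beta>) *\<^sub>R snd z) / sqrt (m\<^sup>2 + (2 * \<beta>)\<^sup>2)"
  using infdist_kernel[of "2 * \<beta>" "fst z" "snd z" m] assms by (simp add: C_minus_alt)

text \<open>The fast mode vanishes initially, and its norm bound keeps it at 0.\<close>

lemma C_minus_invariant:
  assumes "solution_semiflow UNIV (fast_reaction_solution \<alpha> \<beta> \<gamma> \<delta> \<mu> \<nu> \<epsilon>) T"
    and "\<alpha> \<noteq> 0" "0 < \<epsilon>" "0 \<le> discriminant \<alpha> \<beta> \<gamma> \<delta> \<mu> \<nu> \<epsilon>" "0 \<le> t"
    and "z \<in> C_minus \<alpha> \<beta> \<gamma> \<delta> \<mu> \<nu> \<epsilon>"
  shows "T t z \<in> C_minus \<alpha> \<beta> \<gamma> \<delta> \<mu> \<nu> \<epsilon>"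
  using fast_mode_decay[OF assms(1-5) refl, of z] assms(6)
  by (simp add: C_minus_alt case_prod_beta)

lemma attracting_C_minus:
  assumes T: "\<And>\<epsilon>. \<epsilon> > 0 \<Longrightarrow> solution_semiflow UNIV (fast_reaction_solution \<alpha> \<beta> \<gamma> \<delta> \<mu> \<nu> \<epsilon>) (T \<epsilon>)"
    and "\<alpha> < 0" "\<beta> \<noteq> 0"
  shows "attracting T (C_minus \<alpha> \<beta> \<gamma> \<delta> \<mu> \<nu>)"
  unfolding attracting_def
proof (intro exI conjI)
  \<comment> \<open>The fast eigenvalue times \<epsilon> tends to \<alpha>; half of |\<alpha>|
    survives as a rate uniform in small \<epsilon>.\<close>
  show "0 < - \<alpha> / 2" using assms(2) by simp
  have nz: "\<alpha> \<noteq> 0" using assms(2) by simp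
  let ?m = "C_coeff \<alpha> \<beta> \<gamma> \<delta> \<mu> \<nu>"
  have "((\<lambda>\<epsilon>. \<epsilon> * (\<delta> - \<nu>) - ?m \<epsilon> / 2) \<longlongrightarrow> 0 * (\<delta> - \<nu>) - (- 2 * \<alpha>) / 2) (at_right 0)"
    by (intro tendsto_intros C_coeff_tendsto) simp
  hence "\<forall>\<^sub>F \<epsilon> in at_right 0. \<epsilon> * (\<delta> - \<nu>) - ?m \<epsilon> / 2 < \<alpha> / 2"
    using assms(2) by (intro order_tendstoD) auto
  thus "\<forall>\<^sub>F \<epsilon> in at_right 0. \<forall>z. \<forall>t\<ge>0. infdist (T \<epsilon> t z) (C_minus \<alpha> \<beta> \<gamma> \<delta> \<mu> \<nu> \<epsilon>)
      \<le> 1 * exp (- (- \<alpha> / 2) * t / \<epsilon>) * infdist z (C_minus \<alpha> \<beta> \<gamma> \<delta> \<mu> \<nu> \<epsilon>)"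
    using eventually_discriminant_pos[OF nz, of \<beta> \<gamma> \<delta> \<mu> \<nu>] eventually_at_right_less[of 0]
  proof eventually_elim
    case (elim \<epsilon>)
    have rate: "\<delta> - \<nu> - ?m \<epsilon> / (2 * \<epsilon>) \<le> \<alpha> / (2 * \<epsilon>)"
    proof -
      have "(\<epsilon> * (\<delta> - \<nu>) - ?m \<epsilon> / 2) / \<epsilon> \<le> \<alpha> / 2 / \<epsilon>" using elim by (intro divide_right_mono) auto
      thus ?thesis using elim by (simp add: diff_divide_distrib)
    qed
    show ?case
    proof (intro allI impI)
      fix z and t :: real assume "0 \<le> t"
      let ?w = "\<lambda>z. norm (?m \<epsilon> *\<^sub>R fst z - (2 * \<beta>) *\<^sub>R snd z)" and ?N = "sqrt ((?m \<epsilon>)\<^sup>2 + (2 * \<beta>)\<^sup>2)"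
      have "?w (T \<epsilon> t z) \<le> exp ((\<delta> - \<nu> - ?m \<epsilon> / (2 * \<epsilon>)) * t) * ?w z"
        using elim nz \<open>0 \<le> t\<close> by (intro fast_mode_decay[OF T]) simp_all
      also have "\<dots> \<le> exp (\<alpha> / (2 * \<epsilon>) * t) * ?w z"
        using mult_right_mono[OF rate \<open>0 \<le> t\<close>] by (intro mult_right_mono) simp_all
      finally have "?w (T \<epsilon> t z) / ?N \<le> exp (\<alpha> / (2 * \<epsilon>) * t) * ?w z / ?N"
        by (intro divide_right_mono) auto
      thus "infdist (T \<epsilon> t z) (C_minus \<alpha> \<beta> \<gamma> \<delta> \<mu> \<nu> \<epsilon>)
          \<le> 1 * exp (- (- \<alpha> / 2) * t / \<epsilon>) * infdist z (C_minus \<alpha> \<beta> \<gamma> \<delta> \<mu> \<nu> \<epsilon>)"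
        unfolding infdist_C_minus[OF assms(3) refl] by simp
    qed
  qed
qed

lemma C_minus_fst:
  assumes "z \<in> C_minus \<alpha> \<beta> \<gamma> \<delta> \<mu> \<nu> \<epsilon>" "m = C_coeff \<alpha> \<beta> \<gamma> \<delta> \<mu> \<nu> \<epsilon>" "m \<noteq> 0"
  shows "fst z = (2 * \<beta> / m) *\<^sub>R snd z"
proof -
  have "(2 * \<beta>) *\<^sub>R snd z - m *\<^sub>R fst z = 0" using assms(1,2) by (auto simp: C_minus_alt)
  thus ?thesis using scaleR_eq_iff_divide[OF assms(3)] by blast
qed

text \<open>On both manifolds the first component is a multiple of the second, and the second solves
  a scalar heat equation. Slopes and rates converge, uniformly for bounded data and times.\<close>

lemma flow_converges_C_minus:
  assumes T: "\<And>\<epsilon>. \<epsilon> > 0 \<Longrightarrow> solution_semiflow UNIV (fast_reaction_solution \<alpha> \<beta> \<gamma> \<delta> \<mu> \<nu> \<epsilon>) (T \<epsilon>)"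
    and T\<^sub>0: "solution_semiflow (critical_manifold \<alpha> \<beta>) (limit_solution \<alpha> \<beta> \<gamma> \<delta> \<nu>) T\<^sub>0"
    and "\<alpha> < 0"
  shows "flow_converges T (C_minus \<alpha> \<beta> \<gamma> \<delta> \<mu> \<nu>) T\<^sub>0 (critical_manifold \<alpha> \<beta>)"
  unfolding flow_converges_def
proof (intro allI impI)
  fix R \<tau> e :: real
  assume "0 < R" "0 < \<tau>" "0 < e"
  have nz: "\<alpha> \<noteq> 0" using assms(3) by simp
  let ?m = "C_coeff \<alpha> \<beta> \<gamma> \<delta> \<mu> \<nu>"
  define k where "k = (\<lambda>\<epsilon>. 2 * \<beta> / ?m \<epsilon>)"
  define k\<^sub>0 where "k\<^sub>0 = - \<beta> / \<alpha>"
  define b where "b = \<delta> - \<nu> + \<gamma> * k\<^sub>0"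
  \<comment> \<open>\<open>M\<close> bounds the slow component of the limit orbit up to time \<tau>,
    and \<open>A \<epsilon>\<close> its distance to that of the orbit on the slow manifold.\<close>
  define M where "M = exp (\<bar>b\<bar> * \<tau>) * R"
  define A where "A = (\<lambda>\<epsilon>. (exp (\<bar>\<gamma> * (k \<epsilon> - k\<^sub>0)\<bar> * \<tau>) - 1) * M)"
  have "(k \<longlongrightarrow> 2 * \<beta> / (- 2 * \<alpha>)) (at_right 0)"
    unfolding k_def using nz by (intro tendsto_intros C_coeff_tendsto) auto
  hence k: "(k \<longlongrightarrow> k\<^sub>0) (at_right 0)" using nz by (simp add: k\<^sub>0_def)
  have "(A \<longlongrightarrow> (exp (\<bar>\<gamma> * (k\<^sub>0 - k\<^sub>0)\<bar> * \<tau>) - 1) * M) (at_right 0)"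
    unfolding A_def by (intro tendsto_intros k)
  \<comment> \<open>The first two terms bound the error in u, split as k (v - y) + (k -
    \<open>k\<^sub>0\<close>) y; the last one bounds the error in v.\<close>
  hence "((\<lambda>\<epsilon>. \<bar>k \<epsilon>\<bar> * A \<epsilon> + \<bar>k \<epsilon> - k\<^sub>0\<bar> * M + A \<epsilon>) \<longlongrightarrow> \<bar>k\<^sub>0\<bar> * 0 + \<bar>k\<^sub>0 - k\<^sub>0\<bar> * M + 0) (at_right 0)"
    by (intro tendsto_intros k) simp_all
  hence "\<forall>\<^sub>F \<epsilon> in at_right 0. \<bar>k \<epsilon>\<bar> * A \<epsilon> + \<bar>k \<epsilon> - k\<^sub>0\<bar> * M + A \<epsilon> < e"
    using \<open>0 < e\<close> by (intro order_tendstoD) auto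
  \<comment> \<open>Positivity of the coefficient makes the division in \<open>k\<close>
    genuine.\<close>
  moreover have "\<forall>\<^sub>F \<epsilon> in at_right 0. 0 < ?m \<epsilon>"
    using assms(3) by (intro order_tendstoD(1)[OF C_coeff_tendsto]) simp
  ultimately show "\<forall>\<^sub>F \<epsilon> in at_right 0. \<forall>z\<in>C_minus \<alpha> \<beta> \<gamma> \<delta> \<mu> \<nu> \<epsilon>. \<forall>w\<in>critical_manifold \<alpha> \<beta>.
      snd z = snd w \<and> norm (snd w) \<le> R \<longrightarrow> (\<forall>t\<in>{0..\<tau>}. dist (T \<epsilon> t z) (T\<^sub>0 t w) < e)"
    using eventually_discriminant_pos[OF nz, of \<beta> \<gamma> \<delta> \<mu> \<nu>] eventually_at_right_less[of 0]
  proof eventually_elim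
    case (elim \<epsilon>)
    show ?case
    proof (intro ballI impI)
      fix z w :: "'a state" and t
      assume z: "z \<in> C_minus \<alpha> \<beta> \<gamma> \<delta> \<mu> \<nu> \<epsilon>" and w: "w \<in> critical_manifold \<alpha> \<beta>"
        and zw: "snd z = snd w \<and> norm (snd w) \<le> R" and "t \<in> {0..\<tau>}"
      hence t: "0 \<le> t" "t \<le> \<tau>" by auto
      let ?v = "\<lambda>t. snd (T \<epsilon> t z)" and ?y = "\<lambda>t. snd (T\<^sub>0 t w)"
      have sol: "fast_reaction_solution \<alpha> \<beta> \<gamma> \<delta> \<mu> \<nu> \<epsilon> (\<lambda>t. T \<epsilon> t z)" "T \<epsilon> 0 z = z"
        using solution_semiflowD[OF T UNIV_I] elim by simp_all
      have sol\<^sub>0: "limit_solution \<alpha> \<beta> \<gamma> \<delta> \<nu> (\<lambda>t. T\<^sub>0 t w)" "T\<^sub>0 0 w = w"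
        using solution_semiflowD[OF T\<^sub>0 w] by simp_all
      have u: "fst (T \<epsilon> s z) = k \<epsilon> *\<^sub>R ?v s" if "0 \<le> s" for s
        unfolding k_def using elim nz that by (intro C_minus_fst[OF C_minus_invariant[OF T _ _ _ _ z]]) simp_all
      have hv: "heat_solution (\<delta> - \<nu> + \<gamma> * k \<epsilon>) ?v"
        by (rule fast_reaction_slow_mode[OF sol(1) u])
      have hy: "heat_solution b ?y" and x: "fst (T\<^sub>0 t w) = k\<^sub>0 *\<^sub>R ?y t"
        using limit_slow_mode[OF sol\<^sub>0(1) nz] t(1) by (auto simp: b_def k\<^sub>0_def)
      have ab: "\<delta> - \<nu> + \<gamma> * k \<epsilon> - b = \<gamma> * (k \<epsilon> - k\<^sub>0)" by (simp add: b_def algebra_simps)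
      have "?v 0 = ?y 0" using sol(2) sol\<^sub>0(2) zw by simp
      note cmp = heat_solution_compare[OF hv hy this t, unfolded ab sol\<^sub>0(2)]
      have M: "exp (\<bar>b\<bar> * \<tau>) * norm (snd w) \<le> M" using zw by (simp add: M_def mult_left_mono)
      have v: "norm (?v t - ?y t) \<le> A \<epsilon>"
        unfolding A_def using \<open>0 < \<tau>\<close> by (intro order_trans[OF cmp(1)] mult_left_mono M) simp
      have y: "norm (?y t) \<le> M" using cmp(2) M by (rule order_trans)
      have "fst (T \<epsilon> t z) - fst (T\<^sub>0 t w) = k \<epsilon> *\<^sub>R (?v t - ?y t) + (k \<epsilon> - k\<^sub>0) *\<^sub>R ?y t"
        unfolding u[OF t(1)] x by (simp add: algebra_simps)
      hence "norm (fst (T \<epsilon> t z) - fst (T\<^sub>0 t w)) \<le> \<bar>k \<epsilon>\<bar> * norm (?v t - ?y t) + \<bar>k \<epsilon> - k\<^sub>0\<bar> * norm (?y t)"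
        using norm_triangle_ineq[of "k \<epsilon> *\<^sub>R (?v t - ?y t)" "(k \<epsilon> - k\<^sub>0) *\<^sub>R ?y t"] by simp
      also have "\<dots> \<le> \<bar>k \<epsilon>\<bar> * A \<epsilon> + \<bar>k \<epsilon> - k\<^sub>0\<bar> * M"
        by (intro add_mono mult_left_mono v y) auto
      finally have "norm (fst (T \<epsilon> t z) - fst (T\<^sub>0 t w)) \<le> \<bar>k \<epsilon>\<bar> * A \<epsilon> + \<bar>k \<epsilon> - k\<^sub>0\<bar> * M" .
      moreover have "dist (T \<epsilon> t z) (T\<^sub>0 t w) \<le> norm (fst (T \<epsilon> t z) - fst (T\<^sub>0 t w)) + norm (?v t - ?y t)"
        unfolding dist_prod_def dist_norm by (rule sqrt_sum_squares_le_sum) auto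
      ultimately show "dist (T \<epsilon> t z) (T\<^sub>0 t w) < e" using v elim by linarith
    qed
  qed
qed

theorem theorem3p3:
  fixes \<alpha> \<beta> \<gamma> \<delta> \<mu> \<nu> :: real
    and T :: "real \<Rightarrow> real \<Rightarrow> ('n::finite) state \<Rightarrow> 'n state"
    and T\<^sub>0 :: "real \<Rightarrow> 'n state \<Rightarrow> 'n state"
    and E :: "real set"
    and C :: "real \<Rightarrow> 'n state set"
    and C\<^sub>0 :: "'n state set"
  assumes "\<beta> \<noteq> 0" "\<gamma> \<noteq> 0" "\<delta> \<noteq> 0" and "\<alpha> < 0"
    and "\<And>\<epsilon>. \<epsilon> > 0 \<Longrightarrow> solution_semiflow UNIV (fast_reaction_solution \<alpha> \<beta> \<gamma> \<delta> \<mu> \<nu> \<epsilon>) (T \<epsilon>)"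
    and "solution_semiflow (critical_manifold \<alpha> \<beta>) (limit_solution \<alpha> \<beta> \<gamma> \<delta> \<nu>) T\<^sub>0"
  defines "E \<equiv> {\<epsilon>. \<epsilon> > 0 \<and> \<alpha> / \<epsilon> - \<mu> < 0 \<and> discriminant \<alpha> \<beta> \<gamma> \<delta> \<mu> \<nu> \<epsilon> > 0}"
    and "C \<equiv> C_minus \<alpha> \<beta> \<gamma> \<delta> \<mu> \<nu>"
    and "C\<^sub>0 \<equiv> critical_manifold \<alpha> \<beta>"
  shows "(slow_manifold E T C T\<^sub>0 C\<^sub>0 \<and> attracting T C \<and>
          (\<forall>\<epsilon>\<in>E. \<forall>t\<ge>0. T \<epsilon> t ` C \<epsilon> \<subseteq> C \<epsilon>) \<and>
          (\<forall>\<epsilon>\<in>E. \<forall>k. Ck_submanifold k (C \<epsilon>) \<longleftrightarrow> Ck_submanifold k C\<^sub>0))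
       \<and> (converges_on_bounded C C\<^sub>0 \<and>
          (\<forall>R>0. \<exists>K. \<forall>\<^sub>F \<epsilon> in at_right 0.
             hausdorff_dist (C \<epsilon> \<inter> cball 0 R) (C\<^sub>0 \<inter> cball 0 R) \<le> ereal (K * \<epsilon>)))
       \<and> flow_converges T C T\<^sub>0 C\<^sub>0"
proof -
  have inv: "T \<epsilon> t z \<in> C \<epsilon>" if "\<epsilon> \<in> E" "0 \<le> t" "z \<in> C \<epsilon>" for \<epsilon> t z
    using that assms(4) unfolding E_def C_def by (intro C_minus_invariant[OF assms(5)]) simp_all
  \<comment> \<open>Both manifolds are linear graphs, hence of class C^k for every k; preservation
    and equality of regularity follow.\<close>
  have Ck: "Ck_submanifold k (C \<epsilon>)" "Ck_submanifold k C\<^sub>0" for k \<epsilon>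
    unfolding C_def C\<^sub>0_def C_minus_eq_scaling_graph[OF assms(1)] critical_manifold_eq_scaling_graph[OF assms(1)]
    by (rule Ck_submanifold_scaling_graph)+
  have conv: "converges_on_bounded C C\<^sub>0"
    unfolding C_def C\<^sub>0_def by (rule converges_on_bounded_C_minus[OF assms(4,1)])
  have flow: "flow_converges T C T\<^sub>0 C\<^sub>0"
    unfolding C_def C\<^sub>0_def by (rule flow_converges_C_minus[OF assms(5,6,4)])
  have loc: "locally_invariant (T \<epsilon>) (C \<epsilon>)" if "\<epsilon> \<in> E" for \<epsilon>
    unfolding locally_invariant_def
  proof
    fix z assume "z \<in> C \<epsilon>"
    \<comment> \<open>Invariance holds for all times, so any positive time bound serves.\<close>
    hence "\<forall>t\<in>{0..<1}. T \<epsilon> t z \<in> C \<epsilon>" using inv[OF that] by simp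
    thus "\<exists>\<tau>>0. \<forall>t\<in>{0..<\<tau>}. T \<epsilon> t z \<in> C \<epsilon>" using zero_less_one by blast
  qed
  have "slow_manifold E T C T\<^sub>0 C\<^sub>0"
    unfolding slow_manifold_def by (intro conjI ballI allI impI Ck loc conv flow)
  moreover have "attracting T C"
    unfolding C_def by (rule attracting_C_minus[OF assms(5,4,1)])
  moreover have "\<forall>R>0. \<exists>K. \<forall>\<^sub>F \<epsilon> in at_right 0.
      hausdorff_dist (C \<epsilon> \<inter> cball 0 R) (C\<^sub>0 \<inter> cball 0 R) \<le> ereal (K * \<epsilon>)"
    unfolding C_def C\<^sub>0_def by (intro allI impI hausdorff_dist_C_minus[OF assms(4,1)])
  moreover have "\<forall>\<epsilon>\<in>E. \<forall>t\<ge>0. T \<epsilon> t ` C \<epsilon> \<subseteq> C \<epsilon>"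
    by (intro ballI allI impI image_subsetI inv)
  moreover have "\<forall>\<epsilon>\<in>E. \<forall>k. Ck_submanifold k (C \<epsilon>) \<longleftrightarrow> Ck_submanifold k C\<^sub>0" by (simp add: Ck)
  ultimately show ?thesis by (intro conjI conv flow)
qed

end
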